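(* Let $n\ge 2$, $0<\lambda\le\Lambda<\infty$, $\gamma\ge 0$ and $\alpha=\frac{1}{1+\gamma}$. There exists $\delta>0$ depending only on $n,\lambda,\Lambda,\gamma$ such that the following holds. Let $f\in C(B_1)\cap L^n(B_1)$ and let $u\in C(\overline{B}_1)$ satisfy $$|Du|^{\gamma}\,\mathcal{P}^{-}_{\lambda,\Lambda}(D^2u)\le f(x)\le |Du|^{\gamma}\,\mathcal{P}^{+}_{\lambda,\Lambda}(D^2u)\quad\text{in } B_1$$ in the viscosity sense. Then the pointwise $C^{1,\alpha}$ seminorm of $u$ satisfies $[u]_{C^{1,\alpha}}(\cdot)\in L^\delta(B_1)$. In particular, $[u]_{C^{1,\alpha}}(x)<\infty$ for almost every $x$, i.e. $u$ is (pointwise) $C^{1,\alpha}$ at almost every point.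
   Context: $B_r(x_0)\subset\mathbb{R}^n$ is the open ball of radius $r$ centered at $x_0$, and $B_r=B_r(0)$. Pointwise seminorm: with $\mathcal{P}_1$ the set of affine functions on $\mathbb{R}^n$, $$[u]_{C^{1,\alpha}}(x_0):=\sup_{r>0}\ \inf_{l\in\mathcal{P}_1}\frac{\|u-l\|_{L^\infty(B_r(x_0)\cap B_1)}}{r^{1+\alpha}}.$$ Pucci operators: for a symmetric real $n\times n$ matrix $N$ with eigenvalues $e_i(N)$, $$\mathcal{P}^{+}_{\lambda,\Lambda}(N)=\lambda\sum_{e_i(N)<0}e_i(N)+\Lambda\sum_{e_i(N)>0}e_i(N),\qquad \mathcal{P}^{-}_{\lambda,\Lambda}(N)=\Lambda\sum_{e_i(N)<0}e_i(N)+\lambda\sum_{e_i(N)>0}e_i(N).$$ Viscosity sense: $|Du|^\gamma\mathcal{P}^-_{\lambda,\Lambda}(D^2u)\le f$ in $B_1$ means that for every $x_0\in B_1$ and every $\psi\in C^2(B_1)$ such that $u-\psi$ has a local minimum at $x_0$, one has $|D\psi(x_0)|^\gamma\mathcal{P}^-_{\lambda,\Lambda}(D^2\psi(x_0))\le f(x_0)$. Likewise $|Du|^\gamma\mathcal{P}^+_{\lambda,\Lambda}(D^2u)\ge f$ in $B_1$ means that for every $x_0\in B_1$ and every $\psi\in C^2(B_1)$ such that $u-\psi$ has a local maximum at $x_0$, one has $|D\psi(x_0)|^\gamma\mathcal{P}^+_{\lambda,\Lambda}(D^2\psi(x_0))\ge f(x_0)$. (When $\gamma=0$, $|\cdot|^\gamma=1$.)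 *)

theory Defs
  imports "HOL-Analysis.Analysis" "HOL-Probability.Essential_Supremum"
begin

(* Roots of det (X I - N), repeated according to multiplicity.  A symmetric real
   matrix has exactly n of them, since all its eigenvalues are real. *)
definition eigenvalues :: "real^'n^'n \<Rightarrow> real multiset" where
  "eigenvalues N = proots (det (\<chi> i j. (if i = j then [:0, 1:] else 0) - [:N $ i $ j:]))"

definition pucci_plus :: "real \<Rightarrow> real \<Rightarrow> real^'n^'n \<Rightarrow> real" where
  "pucci_plus lam Lam N =
     lam * (\<Sum>e \<in># filter_mset (\<lambda>e. e < 0) (eigenvalues N). e) +
     Lam * (\<Sum>e \<in># filter_mset (\<lambda>e. e > 0) (eigenvalues N). e)"

definition pucci_minus :: "real \<Rightarrow> real \<Rightarrow> real^'n^'n \<Rightarrow> real" where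
  "pucci_minus lam Lam N =
     Lam * (\<Sum>e \<in># filter_mset (\<lambda>e. e < 0) (eigenvalues N). e) +
     lam * (\<Sum>e \<in># filter_mset (\<lambda>e. e > 0) (eigenvalues N). e)"

definition gradient :: "(real^'n \<Rightarrow> real) \<Rightarrow> real^'n \<Rightarrow> real^'n" where
  "gradient \<psi> x = (\<chi> i. frechet_derivative \<psi> (at x) (axis i 1))"

definition hessian :: "(real^'n \<Rightarrow> real) \<Rightarrow> real^'n \<Rightarrow> real^'n^'n" where
  "hessian \<psi> x = jacobian (gradient \<psi>) (at x)"

(* Meant for open S, so that the derivatives only depend on \<psi> on S. *)
definition C2_on :: "(real^'n) set \<Rightarrow> (real^'n \<Rightarrow> real) \<Rightarrow> bool" where
  "C2_on S \<psi> \<longleftrightarrow>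
     (\<forall>x\<in>S. \<psi> differentiable (at x)) \<and>
     (\<forall>x\<in>S. gradient \<psi> differentiable (at x)) \<and>
     continuous_on S (hessian \<psi>)"

(* t to the power g for t, g \<ge> 0, with value 1 for g = 0; note that 0 powr 0 = 0. *)
definition pow_gamma :: "real \<Rightarrow> real \<Rightarrow> real" where
  "pow_gamma t g = (if g = 0 then 1 else t powr g)"

definition visc_pucci_minus_le ::
  "real \<Rightarrow> real \<Rightarrow> real \<Rightarrow> (real^'n \<Rightarrow> real) \<Rightarrow> (real^'n \<Rightarrow> real) \<Rightarrow> bool" where
  "visc_pucci_minus_le lam Lam \<gamma> u f \<longleftrightarrow>
     (\<forall>x0 \<in> ball 0 1. \<forall>\<psi>. C2_on (ball 0 1) \<psi> \<longrightarrow>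
        (\<forall>\<^sub>F x in nhds x0. u x0 - \<psi> x0 \<le> u x - \<psi> x) \<longrightarrow>
        pow_gamma (norm (gradient \<psi> x0)) \<gamma> * pucci_minus lam Lam (hessian \<psi> x0) \<le> f x0)"

definition visc_pucci_plus_ge ::
  "real \<Rightarrow> real \<Rightarrow> real \<Rightarrow> (real^'n \<Rightarrow> real) \<Rightarrow> (real^'n \<Rightarrow> real) \<Rightarrow> bool" where
  "visc_pucci_plus_ge lam Lam \<gamma> u f \<longleftrightarrow>
     (\<forall>x0 \<in> ball 0 1. \<forall>\<psi>. C2_on (ball 0 1) \<psi> \<longrightarrow>
        (\<forall>\<^sub>F x in nhds x0. u x - \<psi> x \<le> u x0 - \<psi> x0) \<longrightarrow>
        pow_gamma (norm (gradient \<psi> x0)) \<gamma> * pucci_plus lam Lam (hessian \<psi> x0) \<ge> f x0)"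

definition affine_functions :: "(real^'n \<Rightarrow> real) set" where
  "affine_functions = {l. \<exists>p c. \<forall>x. l x = p \<bullet> x + c}"

definition Linf_norm :: "(real^'n) set \<Rightarrow> (real^'n \<Rightarrow> real) \<Rightarrow> ennreal" where
  "Linf_norm S g = esssup (lebesgue_on S) (\<lambda>x. ennreal \<bar>g x\<bar>)"

definition C1_seminorm :: "real \<Rightarrow> (real^'n \<Rightarrow> real) \<Rightarrow> real^'n \<Rightarrow> ennreal" where
  "C1_seminorm \<alpha> u x0 =
     (SUP r \<in> {0::real<..}. INF l \<in> affine_functions.
        Linf_norm (ball x0 r \<inter> ball 0 1) (\<lambda>x. u x - l x) / ennreal (r powr (1 + \<alpha>)))"

(* Membership in L^d(S) of a nonnegative, possibly infinite function, for d > 0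
   (for d < 1 this is only a quasi-normed space). *)
definition in_Lp :: "real \<Rightarrow> (real^'n) set \<Rightarrow> (real^'n \<Rightarrow> ennreal) \<Rightarrow> bool" where
  "in_Lp d S g \<longleftrightarrow>
     g \<in> borel_measurable (lebesgue_on S) \<and>
     (\<integral>\<^sup>+ x. (if g x = \<infinity> then \<infinity> else ennreal (enn2real (g x) powr d)) \<partial>lebesgue_on S) < \<infinity>"

end

(* Call x a touching point of opening t if u lies above u x + p . (z - x) - t |z - x|^(1 + alpha) on the
   unit ball for some slope p. Touching points of opening t for both u and -u have seminorm at most t,
   so it is enough that the set of points which are not touching of opening t has measure O(t^(-eps))
   for every supersolution.

   Vertices or slopes of a family of functions slid from below until they touch u depend locally
   Lipschitz continuously on the contact point: if two functions of the family touch u at nearby points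
   with very different slopes, u lies above their maximum, and a quadratic bent across the crease of
   this maximum contradicts the equation. Hence the set of contact points has measure bounded below, up to
   the L^n norm of f; this replaces the area formula and Alexandrov's theorem. Where the gradient is
   bounded away from zero the family is a Gaussian barrier plus linear functions; where it may vanish the
   family is -A |z - y|^(1 + alpha), on which |D psi|^gamma D^2 psi is scale invariant because
   alpha (1 + gamma) = 1. So near every touching point of opening t, a fixed fraction
   of each comparable ball consists of touching points of opening B t, unless f is large there in L^n, and
   a Vitali covering gives the geometric decay.
*)
theory Submission
  imports Defs
begin

section \<open>Testing with quadratics\<close>

text \<open>The obstacle is that the equation is not invariant under subtracting affine functions:
  the slope \<open>P\<close> of a touching function cannot be normalised to zero, and for
  \<open>gamma > 0\<close> a test function with zero gradient carries no information. Hence the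
  estimates split by the size of \<open>P\<close>. A large \<open>P\<close> dominates all slopes of
  the family and keeps the gradient away from zero. A small \<open>P\<close> is absorbed in
  constants, but then \<open>u\<close> could be much higher on the ball in question than at the
  touching point; the barrier without slope, whose gradient vanishes only at its centre, excludes
  this unless \<open>f\<close> is large, and cusps then supply the contact points. The exponent
  \<open>n\<close> on \<open>f\<close> is the volume distortion of a map with local Lipschitz
  constant of order \<open>1 + f\<close>. The exponent \<open>alpha\<close> is the one for which
  \<open>u (x0 + r y) / (t r^(1 + alpha))\<close> satisfies the same inequalities with
  \<open>f / t^(1 + gamma)\<close>: no power of \<open>r\<close> remains, so balls of all sizes are
  judged by the same mean of \<open>|f|^n\<close>, which a covering can add up.\<close>

lemma eigenvalues_rank_one:
  fixes e :: "real^'n::finite"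
  assumes e: "norm e = 1"
  shows "eigenvalues (\<chi> i j. c * e$i * e$j - (if i = j then b else 0))
     = add_mset (c - b) (replicate_mset (CARD('n) - 1) (- b))"
proof -
  let ?N = "\<chi> i j. c * e$i * e$j - (if i = j then b else (0::real))"
  let ?M = "\<chi> i j. (if i = j then [:0, 1:] else 0) - [:?N $ i $ j:]"
  fix k :: 'n
  \<comment> \<open>Completing \<open>e\<close> to an orthonormal basis diagonalises
    \<open>c e e^T - b I\<close>, with \<open>c\<close> appearing only at the position
    \<open>k\<close> of \<open>e\<close>.\<close>
  obtain Q where orthQ: "orthogonal_matrix Q" and Q: "Q *v (axis k 1) = e"
    using orthogonal_matrix_exists_basis[OF e, of k] by metis
  have Qik: "Q $ i $ k = e $ i" for i
    using Q by (metis matrix_vector_mult_basis column_def vec_lambda_beta)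
  have det1: "poly (det ?M) t = (t + b) ^ (CARD('n) - 1) * (t + b - c)" for t
  proof -
    let ?D = "\<chi> i j. if i = j then (if i = k then t + b - c else t + b) else (0::real)"
    \<comment> \<open>Evaluation at \<open>t\<close> passes through the determinant, a polynomial in
      the entries, so the conjugation can be done over the reals.\<close>
    have "poly (det ?M) t = det (\<chi> i j. (if i = j then t + b else 0) - c * e$i * e$j)"
      unfolding det_def poly_sum poly_mult poly_prod
      by (intro sum.cong refl arg_cong2[where f="(*)"] prod.cong)
         (auto simp: sign_def)
    also have "(\<chi> i j. (if i = j then t + b else 0) - c * e$i * e$j) = Q ** ?D ** transpose Q"
    proof -
      have QQ: "Q ** transpose Q = mat 1" using orthQ by (simp add: orthogonal_matrix_def)
      have "(Q ** ?D ** transpose Q) $ i $ j = (if i = j then t + b else 0) - c * e$i * e$j" for i j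
      proof -
        have A: "(Q ** ?D) $ i $ l = Q$i$l * (if l = k then t + b - c else t + b)" for l
          by (simp add: matrix_matrix_mult_def if_distrib cong: if_cong)
        have "(Q ** ?D ** transpose Q) $ i $ j = (\<Sum>l\<in>UNIV. Q$i$l * (if l = k then t + b - c else t + b) * Q$j$l)"
          by (subst matrix_matrix_mult_def) (simp add: A transpose_def)
        also have "\<dots> = (\<Sum>l\<in>UNIV. (t + b) * (Q$i$l * Q$j$l) - (if l = k then c * Q$i$l * Q$j$l else 0))"
          by (intro sum.cong) (auto simp: algebra_simps)
        also have "\<dots> = (t + b) * (\<Sum>l\<in>UNIV. Q$i$l * Q$j$l) - c * Q$i$k * Q$j$k"
          by (simp add: sum_subtractf sum_distrib_left)
        also have "(\<Sum>l\<in>UNIV. Q$i$l * Q$j$l) = (Q ** transpose Q) $ i $ j"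
          by (simp add: matrix_matrix_mult_def transpose_def)
        finally show ?thesis by (simp add: QQ mat_def Qik)
      qed
      then show ?thesis by (simp add: vec_eq_iff)
    qed
    also have "det (Q ** ?D ** transpose Q) = det ?D"
    proof -
      have "det Q * det (transpose Q) = 1"
        using orthQ by (metis det_I det_mul orthogonal_matrix_def)
      then show ?thesis by (simp add: det_mul)
    qed
    also have "\<dots> = (\<Prod>i\<in>UNIV. if i = k then t + b - c else t + b)"
      by (subst det_diagonal) auto
    also have "\<dots> = (t + b) ^ (CARD('n) - 1) * (t + b - c)"
      by (subst prod.remove[of _ k]) (auto simp: card_Diff_singleton)
    finally show ?thesis .
  qed
  have "det ?M = [:b, 1:] ^ (CARD('n) - 1) * [:b - c, 1:]"
    by (rule poly_eq_poly_eq_iff[THEN iffD1], rule ext, unfold det1) (simp add: algebra_simps)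
  then have "eigenvalues ?N = proots ([:b, 1:] ^ (CARD('n) - 1) * [:b - c, 1:])"
    unfolding eigenvalues_def by simp
  also have "\<dots> = repeat_mset (CARD('n) - 1) {#- b#} + {#c - b#}"
    by (subst proots_mult) (auto simp: proots_power)
  finally show ?thesis
    by (simp add: repeat_mset_replicate_mset)
qed

lemma filter_replicate_mset:
  "filter_mset P (replicate_mset k x) = (if P x then replicate_mset k x else {#})"
  by (induction k) auto

lemma pucci_minus_rank_one:
  fixes e :: "real^'n::finite"
  assumes "norm e = 1" "0 \<le> b" "b \<le> c"
  shows "pucci_minus lam Lam (\<chi> i j. c * e$i * e$j - (if i = j then b else 0))
     = lam * (c - b) - Lam * (CARD('n) - 1) * b"
  unfolding pucci_minus_def eigenvalues_rank_one[OF assms(1)] using assms(2,3)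
  \<comment> \<open>Zero eigenvalues disappear under both strict filters, so \<open>b = 0\<close>
    and \<open>b = c\<close> give different multisets.\<close>
  by (cases "b = 0"; cases "b = c") (auto simp: filter_replicate_mset algebra_simps)

text \<open>\<open>P+ (- N) = - P- (N)\<close> on the quadratics used here; negating
  \<open>c\<close> and \<open>b\<close> separately keeps the shape that
  \<open>eigenvalues_rank_one\<close> matches. It turns the subsolution inequality for
  \<open>u\<close> into the supersolution inequality for \<open>- u\<close>.\<close>

lemma pucci_plus_rank_one:
  fixes e :: "real^'n::finite"
  assumes "norm e = 1" "0 \<le> b" "b \<le> c"
  shows "pucci_plus lam Lam (\<chi> i j. (- c) * e$i * e$j - (if i = j then - b else 0))
     = - (lam * (c - b) - Lam * (CARD('n) - 1) * b)"
  unfolding pucci_plus_def eigenvalues_rank_one[OF assms(1)] using assms(2,3)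
  by (cases "b = 0"; cases "b = c") (auto simp: filter_replicate_mset algebra_simps)

text \<open>The viscosity condition tested only with quadratics whose Hessian is
  \<open>c e e\<^sup>T - b I\<close>; for \<open>0 \<le> b \<le> c\<close> its minimal Pucci operator is
  \<open>lam (c - b) - bet b\<close> with \<open>bet = Lam (n - 1)\<close>.\<close>
definition supersol ::
  "real \<Rightarrow> real \<Rightarrow> real \<Rightarrow> 'a::euclidean_space set \<Rightarrow> ('a \<Rightarrow> real) \<Rightarrow> ('a \<Rightarrow> real) \<Rightarrow> bool" where
  "supersol lam bet g D u f \<longleftrightarrow>
    (\<forall>x\<in>D. \<forall>p e b c. norm e = 1 \<longrightarrow> 0 \<le> b \<longrightarrow> b \<le> c \<longrightarrow>
      (\<forall>\<^sub>F z in nhds x. u x + p \<bullet> (z - x) + c / 2 * (e \<bullet> (z - x))\<^sup>2 - b / 2 * (norm (z - x))\<^sup>2 \<le> u z) \<longrightarrow>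
      pow_gamma (norm p) g * (lam * (c - b) - bet * b) \<le> f x)"

lemma quadratic_derivatives:
  fixes x0 p e :: "real^'n::finite"
  fixes k c b :: real
  defines "\<psi> \<equiv> \<lambda>z. k + p \<bullet> (z - x0) + c / 2 * (e \<bullet> (z - x0))\<^sup>2 - b / 2 * (norm (z - x0))\<^sup>2"
  shows "C2_on S \<psi>" and "gradient \<psi> x0 = p"
    and "hessian \<psi> x0 = (\<chi> i j. c * e$i * e$j - (if i = j then b else 0))"
proof -
  have D: "(\<psi> has_derivative (\<lambda>h. p \<bullet> h + c * (e \<bullet> (x - x0)) * (e \<bullet> h) - b * ((x - x0) \<bullet> h))) (at x)" for x
    unfolding \<psi>_def power2_norm_eq_inner
    by (rule has_derivative_eq_rhs, (rule derivative_intros refl)+)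
       (auto simp: algebra_simps inner_commute fun_eq_iff)
  have G: "gradient \<psi> = (\<lambda>x. p + (c * (e \<bullet> (x - x0))) *\<^sub>R e - b *\<^sub>R (x - x0))"
    unfolding gradient_def frechet_derivative_at[OF D, symmetric]
    by (auto simp: fun_eq_iff vec_eq_iff inner_axis)
  have DG: "(gradient \<psi> has_derivative (\<lambda>h. (c * (e \<bullet> h)) *\<^sub>R e - b *\<^sub>R h)) (at x)" for x
    unfolding G by (rule has_derivative_eq_rhs, (rule derivative_intros refl)+)
       (auto simp: algebra_simps fun_eq_iff)
  have H: "hessian \<psi> x = (\<chi> i j. c * e$i * e$j - (if i = j then b else 0))" for x
    unfolding hessian_def jacobian_def frechet_derivative_at[OF DG, symmetric]
    by (simp add: vec_eq_iff inner_axis matrix_def) (simp add: axis_def)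
  then have Hc: "hessian \<psi> = (\<lambda>x. \<chi> i j. c * e$i * e$j - (if i = j then b else 0))"
    by (rule ext)
  show "C2_on S \<psi>" unfolding C2_on_def Hc
    using D DG by (auto simp: differentiable_def)
  show "gradient \<psi> x0 = p" by (simp add: G)
  show "hessian \<psi> x0 = (\<chi> i j. c * e$i * e$j - (if i = j then b else 0))" by (rule H)
qed

text \<open>Passing from \<open>f\<close> to its absolute value gives \<open>u\<close> and
  \<open>- u\<close> a common nonnegative right-hand side, whose \<open>n\<close>-th power can be
  integrated.\<close>

lemma visc_pucci_minus_imp_supersol:
  fixes u f :: "real^'n::finite \<Rightarrow> real"
  assumes "visc_pucci_minus_le lam Lam g u f"
  shows "supersol lam (Lam * (CARD('n) - 1)) g (ball 0 1) u (\<lambda>x. \<bar>f x\<bar>)"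
  unfolding supersol_def
proof (intro ballI allI impI)
  fix x0 p e :: "real^'n" and b c :: real
  assume x0: "x0 \<in> ball 0 1" and e: "norm e = 1" and b: "0 \<le> b" "b \<le> c"
    and ev: "\<forall>\<^sub>F z in nhds x0. u x0 + p \<bullet> (z - x0) + c / 2 * (e \<bullet> (z - x0))\<^sup>2 - b / 2 * (norm (z - x0))\<^sup>2 \<le> u z"
  let ?\<psi> = "\<lambda>z. u x0 + p \<bullet> (z - x0) + c / 2 * (e \<bullet> (z - x0))\<^sup>2 - b / 2 * (norm (z - x0))\<^sup>2"
  have ev': "\<forall>\<^sub>F z in nhds x0. u x0 - ?\<psi> x0 \<le> u z - ?\<psi> z"
    using ev by eventually_elim simp
  have "pow_gamma (norm (gradient ?\<psi> x0)) g * pucci_minus lam Lam (hessian ?\<psi> x0) \<le> f x0"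
    using assms x0 ev' quadratic_derivatives(1) unfolding visc_pucci_minus_le_def by blast
  then show "pow_gamma (norm p) g * (lam * (c - b) - Lam * (CARD('n) - 1) * b) \<le> \<bar>f x0\<bar>"
    unfolding quadratic_derivatives using pucci_minus_rank_one[OF e b, of lam Lam] by simp
qed

lemma visc_pucci_plus_imp_supersol:
  fixes u f :: "real^'n::finite \<Rightarrow> real"
  assumes "visc_pucci_plus_ge lam Lam g u f"
  shows "supersol lam (Lam * (CARD('n) - 1)) g (ball 0 1) (\<lambda>x. - u x) (\<lambda>x. \<bar>f x\<bar>)"
  unfolding supersol_def
proof (intro ballI allI impI)
  fix x0 p e :: "real^'n" and b c :: real
  assume x0: "x0 \<in> ball 0 1" and e: "norm e = 1" and b: "0 \<le> b" "b \<le> c"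
    and ev: "\<forall>\<^sub>F z in nhds x0. - u x0 + p \<bullet> (z - x0) + c / 2 * (e \<bullet> (z - x0))\<^sup>2 - b / 2 * (norm (z - x0))\<^sup>2 \<le> - u z"
  let ?\<psi> = "\<lambda>z. u x0 + (- p) \<bullet> (z - x0) + (- c) / 2 * (e \<bullet> (z - x0))\<^sup>2 - (- b) / 2 * (norm (z - x0))\<^sup>2"
  have ev': "\<forall>\<^sub>F z in nhds x0. u z - ?\<psi> z \<le> u x0 - ?\<psi> x0"
    using ev by eventually_elim simp
  have "pow_gamma (norm (gradient ?\<psi> x0)) g * pucci_plus lam Lam (hessian ?\<psi> x0) \<ge> f x0"
    using assms x0 ev' quadratic_derivatives(1) unfolding visc_pucci_plus_ge_def by blast
  then have "f x0 \<le> pow_gamma (norm p) g * - (lam * (c - b) - Lam * (CARD('n) - 1) * b)"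
    unfolding quadratic_derivatives pucci_plus_rank_one[OF e b, of lam Lam] norm_minus_cancel .
  then show "pow_gamma (norm p) g * (lam * (c - b) - Lam * (CARD('n) - 1) * b) \<le> \<bar>f x0\<bar>"
    unfolding mult_minus_right by linarith
qed

section \<open>The crease estimate\<close>

lemma pow_gamma_pos: "0 < t \<Longrightarrow> 0 < pow_gamma t g"
  by (simp add: pow_gamma_def)

lemma pow_gamma_nonneg: "0 \<le> pow_gamma t g"
  by (simp add: pow_gamma_def)

lemma pow_gamma_mono: "0 \<le> g \<Longrightarrow> 0 \<le> s \<Longrightarrow> s \<le> t \<Longrightarrow> pow_gamma s g \<le> pow_gamma t g"
  by (simp add: pow_gamma_def powr_mono2)

text \<open>A supersolution above the maximum of a paraboloid and of an affine perturbation of slope \<open>S\<close>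
  cannot touch that maximum near the crease unless \<open>S\<close> is small: otherwise a quadratic
  bent along \<open>e\<close> touches from below.\<close>
lemma crease_estimate_aux:
  fixes u f :: "'a::euclidean_space \<Rightarrow> real"
  assumes lam: "0 < lam" and bet: "0 \<le> bet" and g: "0 \<le> g"
    and th: "\<theta> = lam / (2 * (lam + bet))" and N: "N = 5 / sqrt \<theta>"
    and sup: "supersol lam bet g D u f" and sub: "cball x (N * \<rho>) \<subseteq> D"
    and cont: "continuous_on (cball x (N * \<rho>)) u"
    and fF: "\<And>z. z \<in> cball x (N * \<rho>) \<Longrightarrow> f z \<le> F"
    and pos: "0 \<le> F" "0 < \<rho>" "0 \<le> b" "0 < S" and e: "norm e = 1"
    and bp: "4 * N * b * \<rho> \<le> norm p" and Sp: "8 * S \<le> norm p"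
    and u1: "\<And>z. z \<in> cball x (N * \<rho>) \<Longrightarrow> u x + p \<bullet> (z - x) - b / 2 * (norm (z - x))\<^sup>2 \<le> u z"
    and u2: "\<And>z. z \<in> cball x (N * \<rho>) \<Longrightarrow>
        u x + p \<bullet> (z - x) - b / 2 * (norm (z - x))\<^sup>2 + S * (e \<bullet> (z - x) - 2 * \<rho>) \<le> u z"
  shows "S \<le> (13 + 13 * (lam + bet + 1) / lam) * \<rho> * (b + F / pow_gamma (norm p / 2) g)"
proof -
  \<comment> \<open>With these constants \<open>q\<close> below is at most \<open>max 0 (S (s - 2\<rho>))\<close>, \<open>s = e \<bullet> h\<close>, on the boundary of
    \<open>-\<rho> \<le> s \<le> 4\<rho>, |h| \<le> N\<rho>\<close>: \<open>25 c1 = 2\<close> and \<open>c2 N\<^sup>2 = 2\<close>.\<close>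
  define c1 where "c1 = (2/25::real)"
  define c2 where "c2 = \<theta> * c1"
  define K where "K = 13 + 13 * (lam + bet + 1) / lam"
  define G where "G = pow_gamma (norm p / 2) g"
  have p0: "norm p > 0" using Sp pos by linarith
  have G0: "G > 0" unfolding G_def using p0 by (intro pow_gamma_pos) auto
  have th0: "0 < \<theta>" "\<theta> \<le> 1/2" using lam bet unfolding th by (auto simp: field_simps)
  have c2: "0 < c2" "c2 \<le> c1 / 2" using th0 by (auto simp: c2_def c1_def)
  have N2: "c2 * N\<^sup>2 = 2" using th0 by (simp add: c2_def N power_divide c1_def)
  \<comment> \<open>The choice of \<theta> makes the concave part of \<open>q\<close> cost exactly
    half of what its convex part gains in the Pucci operator.\<close>
  have c2l: "2 * c2 * (lam + bet) = c1 * lam"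
    using lam bet unfolding c2_def th by (simp add: field_simps)
  have N0: "N \<ge> 5"
  proof -
    have "sqrt \<theta> \<le> 1" using th0 by simp
    then show ?thesis unfolding N using th0 by (simp add: field_simps)
  qed
  have c2N: "c2 * N \<le> 2/5"
  proof -
    have "c2 * N * 5 \<le> c2 * N * N" using N0 c2 by (intro mult_left_mono) auto
    then show ?thesis using N2 by (simp add: power2_eq_square mult.assoc)
  qed
  define q where "q h = S / \<rho> * (c1 * (e \<bullet> h + \<rho>)\<^sup>2 - c2 * (norm h)\<^sup>2)" for h
  define w where "w z = u z - (u x + p \<bullet> (z - x) - b / 2 * (norm (z - x))\<^sup>2 + q (z - x))" for z
  define R where "R = cball x (N * \<rho>) \<inter> {z. - \<rho> \<le> e \<bullet> (z - x)} \<inter> {z. e \<bullet> (z - x) \<le> 4 * \<rho>}"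
  have "compact R" unfolding R_def
    by (intro compact_Int_closed compact_cball closed_Collect_le continuous_intros)
  moreover have xR: "x \<in> R" using pos N0 by (simp add: R_def)
  moreover have "continuous_on R w" unfolding w_def q_def
    by (intro continuous_intros continuous_on_subset[OF cont]) (auto simp: R_def)
  ultimately obtain z0 where z0: "z0 \<in> R" and zmin: "\<And>z. z \<in> R \<Longrightarrow> w z0 \<le> w z"
    using continuous_attains_inf[of R w] by blast
  \<comment> \<open>At the centre \<open>q\<close> equals \<open>c1 * S * \<rho> > 0\<close>, so the
    minimum of \<open>w\<close> over \<open>R\<close> is negative. On the faces
    \<open>s = - \<rho>\<close> and \<open>norm h = N * \<rho>\<close> the bound \<open>u1\<close>
    makes \<open>w\<close> nonnegative, on \<open>s = 4 * \<rho>\<close> the bound \<open>u2\<close>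
    does; the minimum is therefore interior and yields a test quadratic.\<close>
  have "w x < 0" using pos by (simp add: w_def q_def c1_def)
  then have w0: "w z0 < 0" using zmin[OF xR] by linarith
  have z0c: "z0 \<in> cball x (N * \<rho>)" using z0 by (simp add: R_def)
  have wq: "0 \<le> w z0 + q (z0 - x)" "S * (e \<bullet> (z0 - x) - 2 * \<rho>) \<le> w z0 + q (z0 - x)"
    using u1[OF z0c] u2[OF z0c] unfolding w_def by auto
  define s where "s = e \<bullet> (z0 - x)"
  have s: "- \<rho> \<le> s" "s \<le> 4 * \<rho>" using z0 by (auto simp: R_def s_def)
  have s1: "s \<noteq> - \<rho>"
  proof
    assume "s = - \<rho>"
    then have "q (z0 - x) \<le> 0" unfolding q_def s_def[symmetric] using pos c2
      by (simp add: mult_nonneg_nonpos)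
    then show False using wq(1) w0 by linarith
  qed
  have s2: "s \<noteq> 4 * \<rho>"
  proof
    assume "s = 4 * \<rho>"
    then have "q (z0 - x) \<le> S / \<rho> * (c1 * (5 * \<rho>)\<^sup>2)"
      unfolding q_def s_def[symmetric] using pos c2 by (intro mult_left_mono) auto
    also have "\<dots> = S * (2 * \<rho>)" using pos by (simp add: c1_def power2_eq_square)
    finally show False using wq(2) w0 \<open>s = 4 * \<rho>\<close> by (simp add: s_def[symmetric])
  qed
  have s3: "dist x z0 \<noteq> N * \<rho>"
  proof
    assume "dist x z0 = N * \<rho>"
    then have "c2 * (norm (z0 - x))\<^sup>2 = 2 * \<rho>\<^sup>2"
      using N2 by (simp add: dist_norm norm_minus_commute power_mult_distrib mult.assoc[symmetric])
    moreover have "(s + \<rho>)\<^sup>2 \<le> (5 * \<rho>)\<^sup>2" using s pos by (intro power_mono) auto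
    ultimately have "c1 * (s + \<rho>)\<^sup>2 - c2 * (norm (z0 - x))\<^sup>2 \<le> 0"
      by (simp add: c1_def power2_eq_square)
    then have "q (z0 - x) \<le> 0" unfolding q_def s_def[symmetric] using pos
      by (intro mult_nonneg_nonpos) auto
    then show False using wq(1) w0 by linarith
  qed
  have h0: "norm (z0 - x) < N * \<rho>" using s3 z0c by (simp add: dist_norm norm_minus_commute)
  have evR: "\<forall>\<^sub>F z in nhds z0. z \<in> R"
  proof -
    have op: "open (ball x (N * \<rho>) \<inter> {z. - \<rho> < e \<bullet> (z - x)} \<inter> {z. e \<bullet> (z - x) < 4 * \<rho>})"
      by (intro open_Int open_ball open_Collect_less continuous_intros)
    have "z0 \<in> ball x (N * \<rho>) \<inter> {z. - \<rho> < e \<bullet> (z - x)} \<inter> {z. e \<bullet> (z - x) < 4 * \<rho>}"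
      using h0 s s1 s2 by (auto simp: s_def dist_norm norm_minus_commute)
    from eventually_nhds_in_open[OF op this] show ?thesis
      by eventually_elim (auto simp: R_def)
  qed
  define p' where "p' = p - b *\<^sub>R (z0 - x) + (2 * c1 * S / \<rho> * (s + \<rho>)) *\<^sub>R e - (2 * c2 * S / \<rho>) *\<^sub>R (z0 - x)"
  define ct where "ct = 2 * c1 * S / \<rho>"
  define bt where "bt = b + 2 * c2 * S / \<rho>"
  have ex: "\<forall>\<^sub>F z in nhds z0. u z0 + p' \<bullet> (z - z0) + ct / 2 * (e \<bullet> (z - z0))\<^sup>2 - bt / 2 * (norm (z - z0))\<^sup>2 \<le> u z"
    using evR
  proof eventually_elim
    case (elim z)
    define k where "k = z - z0"
    define h where "h = z0 - x"
    have zx: "z - x = h + k" by (simp add: k_def h_def)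
    have nhk: "(norm (h + k))\<^sup>2 = (norm h)\<^sup>2 + 2 * (h \<bullet> k) + (norm k)\<^sup>2"
      by (simp add: power2_norm_eq_inner inner_commute algebra_simps)
    have "w z0 \<le> w z" using zmin elim by blast
    then have "u z \<ge> u z0 + (p \<bullet> (h + k) - b / 2 * (norm (h + k))\<^sup>2 + q (h + k))
       - (p \<bullet> h - b / 2 * (norm h)\<^sup>2 + q h)"
      unfolding w_def zx h_def[symmetric] by linarith
    moreover have "(p \<bullet> (h + k) - b / 2 * (norm (h + k))\<^sup>2 + q (h + k)) - (p \<bullet> h - b / 2 * (norm h)\<^sup>2 + q h)
      = p' \<bullet> k + ct / 2 * (e \<bullet> k)\<^sup>2 - bt / 2 * (norm k)\<^sup>2"
    proof -
      have "q (h + k) - q h = S / \<rho> * (2 * c1 * (s + \<rho>) * (e \<bullet> k) + c1 * (e \<bullet> k)\<^sup>2 - 2 * c2 * (h \<bullet> k) - c2 * (norm k)\<^sup>2)"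
        unfolding q_def nhk s_def h_def[symmetric]
        by (simp add: inner_add_right power2_eq_square algebra_simps)
      then show ?thesis
        unfolding p'_def ct_def bt_def nhk h_def[symmetric]
        by (simp add: inner_add_right inner_add_left inner_diff_left algebra_simps add_divide_distrib diff_divide_distrib)
    qed
    ultimately show ?case by (simp add: k_def[symmetric])
  qed
  have z0D: "z0 \<in> D" using z0c sub by blast
  have K1: "b * \<rho> \<le> \<rho> * (b + F / G)" using pos G0 by (simp add: algebra_simps)
  have nn: "0 \<le> \<rho> * (b + F / G)" using pos G0 by simp
  have K0: "K \<ge> 13" using lam bet by (simp add: K_def)
  show ?thesis
  proof (cases "bt \<le> ct")
    \<comment> \<open>\<open>supersol\<close> admits only test quadratics with
      \<open>b <= c\<close>. If that fails for \<open>bt\<close> and \<open>ct\<close>, the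
      curvature \<open>b\<close> dominates \<open>S / \<rho>\<close>, and the claim follows from
      this alone.\<close>
    case False
    then have "\<rho> * ct < \<rho> * bt" using pos by simp
    moreover have "\<rho> * ct = 2 * c1 * S" "\<rho> * bt = b * \<rho> + 2 * c2 * S"
      unfolding bt_def ct_def using pos by (simp_all add: distrib_left)
    ultimately have "2 * c1 * S - 2 * c2 * S < b * \<rho>" by linarith
    moreover have "c2 * S \<le> c1 / 2 * S" using c2 pos by (intro mult_right_mono) auto
    ultimately have "c1 * S < b * \<rho>" by linarith
    then have "S \<le> 13 * (b * \<rho>)" using pos by (simp add: c1_def)
    also have "\<dots> \<le> 13 * (\<rho> * (b + F / G))" using K1 by simp
    also have "\<dots> \<le> K * (\<rho> * (b + F / G))" using nn K0 by (intro mult_right_mono) auto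
    finally show ?thesis unfolding K_def G_def by (simp add: mult.assoc)
  next
    case True
    have bt0: "0 \<le> bt" using pos c2 by (simp add: bt_def)
    have test: "pow_gamma (norm p') g * (lam * (ct - bt) - bet * bt) \<le> f z0"
      using sup z0D e True bt0 ex unfolding supersol_def by blast
    define X where "X = S / \<rho> * c1 * lam - (lam + bet) * b"
    have X: "lam * (ct - bt) - bet * bt = X"
    proof -
      have "lam * (ct - bt) - bet * bt = S / \<rho> * (2 * c1 * lam - 2 * c2 * (lam + bet)) - (lam + bet) * b"
        unfolding ct_def bt_def using pos by (simp add: field_simps)
      then show ?thesis unfolding c2l X_def by simp
    qed
    \<comment> \<open>The weight \<open>|D psi|^g\<close> must not degenerate at the contact point:
      \<open>bp\<close> bounds the gradient of the paraboloid by \<open>norm p / 4\<close>, and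
      \<open>Sp\<close> bounds that of \<open>q\<close> by
      \<open>8/5 * S <= norm p / 5\<close>.\<close>
    have pn: "norm p' \<ge> norm p / 2"
    proof -
      have a: "norm (b *\<^sub>R (z0 - x)) \<le> norm p / 4"
      proof -
        have "b * norm (z0 - x) \<le> b * (N * \<rho>)" using h0 pos by (intro mult_left_mono) auto
        then show ?thesis using bp pos by (simp add: mult.commute mult.left_commute)
      qed
      have bb: "norm ((2 * c1 * S / \<rho> * (s + \<rho>)) *\<^sub>R e) \<le> 4/5 * S"
      proof -
        have "2 * c1 * S / \<rho> * (s + \<rho>) \<le> 2 * c1 * S / \<rho> * (5 * \<rho>)"
          using s pos by (intro mult_left_mono) (auto simp: c1_def)
        then show ?thesis using e s pos by (simp add: c1_def)
      qed
      have cc: "norm ((2 * c2 * S / \<rho>) *\<^sub>R (z0 - x)) \<le> 4/5 * S"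
      proof -
        have "2 * c2 * S / \<rho> * norm (z0 - x) \<le> 2 * c2 * S / \<rho> * (N * \<rho>)"
          using h0 pos c2 by (intro mult_left_mono) auto
        also have "\<dots> = 2 * S * (c2 * N)" using pos by simp
        also have "\<dots> \<le> 2 * S * (2/5)" using c2N pos by (intro mult_left_mono) auto
        finally show ?thesis using pos c2 by simp
      qed
      have "norm p \<le> norm p' + norm (b *\<^sub>R (z0 - x)) + norm ((2 * c1 * S / \<rho> * (s + \<rho>)) *\<^sub>R e)
         + norm ((2 * c2 * S / \<rho>) *\<^sub>R (z0 - x))"
      proof -
        have "p = p' + b *\<^sub>R (z0 - x) - (2 * c1 * S / \<rho> * (s + \<rho>)) *\<^sub>R e + (2 * c2 * S / \<rho>) *\<^sub>R (z0 - x)"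
          by (simp add: p'_def)
        then show ?thesis
          using norm_triangle_ineq norm_triangle_ineq4 by (smt (verit))
      qed
      moreover have "t / 2 \<le> t'" if "t \<le> t' + A + B + E" "A \<le> t / 4" "B \<le> 4/5 * S" "E \<le> 4/5 * S" "8 * S \<le> t" "0 \<le> t"
        for t t' A B E :: real using that by linarith
      ultimately show ?thesis using a bb cc Sp norm_ge_zero by blast
    qed
    have XF: "X \<le> F / G"
    proof (cases "X \<le> 0")
      case True
      then show ?thesis using pos G0 by (meson divide_nonneg_pos order_trans)
    next
      case False
      have "G \<le> pow_gamma (norm p') g" unfolding G_def using pn g by (intro pow_gamma_mono) auto
      then have "G * X \<le> pow_gamma (norm p') g * X" using False by (intro mult_right_mono) auto
      also have "\<dots> \<le> f z0" using test X by simp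
      also have "\<dots> \<le> F" using fF z0c by blast
      finally show ?thesis using G0 by (simp add: field_simps)
    qed
    then have "S * (c1 * lam) \<le> \<rho> * ((lam + bet) * b + F / G)"
      using pos unfolding X_def by (simp add: field_simps)
    also have "\<dots> \<le> \<rho> * ((lam + bet + 1) * (b + F / G))"
      using pos lam bet G0 by (intro mult_left_mono) (auto simp: algebra_simps)
    finally have "S \<le> ((lam + bet + 1) / (c1 * lam)) * (\<rho> * (b + F / G))"
      using lam pos_le_divide_eq[of "c1 * lam" S "\<rho> * ((lam + bet + 1) * (b + F / G))"]
      by (simp add: c1_def mult_ac)
    also have "\<dots> \<le> K * (\<rho> * (b + F / G))"
      using nn lam bet unfolding K_def c1_def by (intro mult_right_mono) (auto simp: field_simps)
    finally show ?thesis unfolding K_def G_def by (simp add: mult.assoc)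
  qed
qed

text \<open>Frees the estimate from the smallness of \<open>S\<close>. The crease with slope
  \<open>S' = min S (norm p / C)\<close> still lies below \<open>u\<close>: where
  \<open>e \<bullet> (z - x) >= 2 * \<rho>\<close> it is lower than the one with \<open>S\<close>,
  elsewhere it is below the paraboloid. Callers take \<rho> so small that the second entry of the
  minimum cannot satisfy the bound.\<close>

lemma crease_estimate:
  assumes lam: "0 < lam" and bet: "0 \<le> bet" and g: "0 \<le> g"
  obtains N C :: real where "1 \<le> N" "1 \<le> C"
    "\<And>(u::'a::euclidean_space \<Rightarrow> real) f D x p b S e \<rho> F.
      supersol lam bet g D u f \<Longrightarrow> cball x (N * \<rho>) \<subseteq> D \<Longrightarrow>
      continuous_on (cball x (N * \<rho>)) u \<Longrightarrow>
      (\<And>z. z \<in> cball x (N * \<rho>) \<Longrightarrow> f z \<le> F) \<Longrightarrow>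
      0 \<le> F \<Longrightarrow> 0 < \<rho> \<Longrightarrow> 0 \<le> b \<Longrightarrow> 0 \<le> S \<Longrightarrow> norm e = 1 \<Longrightarrow> C * b * \<rho> \<le> norm p \<Longrightarrow>
      (\<And>z. z \<in> cball x (N * \<rho>) \<Longrightarrow> u x + p \<bullet> (z - x) - b / 2 * (norm (z - x))\<^sup>2 \<le> u z) \<Longrightarrow>
      (\<And>z. z \<in> cball x (N * \<rho>) \<Longrightarrow>
        u x + p \<bullet> (z - x) - b / 2 * (norm (z - x))\<^sup>2 + S * (e \<bullet> (z - x) - 2 * \<rho>) \<le> u z) \<Longrightarrow>
      min S (norm p / C) \<le> C * \<rho> * (b + F / pow_gamma (norm p / 2) g)"
proof -
  define \<theta> where "\<theta> = lam / (2 * (lam + bet))"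
  define N where "N = 5 / sqrt \<theta>"
  define K where "K = 13 + 13 * (lam + bet + 1) / lam"
  define C where "C = K + 4 * N + 8"
  have th0: "0 < \<theta>" "\<theta> \<le> 1" using lam bet unfolding \<theta>_def by (auto simp: field_simps)
  then have "sqrt \<theta> \<le> 1" by simp
  then have "sqrt \<theta> \<le> 5" by linarith
  then have N1: "1 \<le> N" unfolding N_def using th0 by (simp add: le_divide_eq)
  have K0: "13 \<le> K" using lam bet by (simp add: K_def)
  have C1: "1 \<le> C" "K \<le> C" "4 * N \<le> C" "8 \<le> C" using N1 K0 by (auto simp: C_def)
  show ?thesis
  proof (rule that[OF N1 C1(1)])
    fix u f :: "'a \<Rightarrow> real" and D x p b S e \<rho> F
    assume sup: "supersol lam bet g D u f" and sub: "cball x (N * \<rho>) \<subseteq> D"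
      and cont: "continuous_on (cball x (N * \<rho>)) u"
      and fF: "\<And>z. z \<in> cball x (N * \<rho>) \<Longrightarrow> f z \<le> F"
      and pos: "0 \<le> F" "0 < \<rho>" "0 \<le> b" "0 \<le> S" and e: "norm e = 1"
      and bp: "C * b * \<rho> \<le> norm p"
      and u1: "\<And>z. z \<in> cball x (N * \<rho>) \<Longrightarrow> u x + p \<bullet> (z - x) - b / 2 * (norm (z - x))\<^sup>2 \<le> u z"
      and u2: "\<And>z. z \<in> cball x (N * \<rho>) \<Longrightarrow>
        u x + p \<bullet> (z - x) - b / 2 * (norm (z - x))\<^sup>2 + S * (e \<bullet> (z - x) - 2 * \<rho>) \<le> u z"
    define S' where "S' = min S (norm p / C)"
    have S'0: "S' \<ge> 0" using pos C1 by (simp add: S'_def)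
    have nn: "0 \<le> \<rho> * (b + F / pow_gamma (norm p / 2) g)"
      using pos pow_gamma_nonneg by simp
    have CC: "K * \<rho> * (b + F / pow_gamma (norm p / 2) g) \<le> C * \<rho> * (b + F / pow_gamma (norm p / 2) g)"
      using mult_right_mono[OF C1(2) nn] by (simp add: mult.assoc)
    show "min S (norm p / C) \<le> C * \<rho> * (b + F / pow_gamma (norm p / 2) g)"
    proof (cases "S' = 0")
      case True
      then show ?thesis using mult_nonneg_nonneg[OF _ nn, of C] C1 unfolding S'_def by (simp add: mult.assoc)
    next
      case False
      then have S'1: "0 < S'" using S'0 by simp
      have "S' \<le> K * \<rho> * (b + F / pow_gamma (norm p / 2) g)"
        unfolding K_def
      proof (rule crease_estimate_aux[OF lam bet g \<theta>_def N_def sup sub cont fF pos(1-3) S'1 e _ _ u1])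
        have "4 * N * (b * \<rho>) \<le> C * (b * \<rho>)" using C1 pos by (intro mult_right_mono) auto
        then show "4 * N * b * \<rho> \<le> norm p" using bp by (simp add: mult.assoc)
        have "S' * 8 \<le> (norm p / C) * C" unfolding S'_def using C1 pos
          by (intro mult_mono) auto
        then show "8 * S' \<le> norm p" using C1 by simp
        fix z assume z: "z \<in> cball x (N * \<rho>)"
        show "u x + p \<bullet> (z - x) - b / 2 * (norm (z - x))\<^sup>2 + S' * (e \<bullet> (z - x) - 2 * \<rho>) \<le> u z"
        proof (cases "e \<bullet> (z - x) - 2 * \<rho> \<ge> 0")
          case True
          then have "S' * (e \<bullet> (z - x) - 2 * \<rho>) \<le> S * (e \<bullet> (z - x) - 2 * \<rho>)"
            by (intro mult_right_mono) (auto simp: S'_def)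
          then show ?thesis using u2[OF z] by linarith
        next
          case False
          then have "S' * (e \<bullet> (z - x) - 2 * \<rho>) \<le> 0" using S'0 by (intro mult_nonneg_nonpos) auto
          then show ?thesis using u1[OF z] by linarith
        qed
      qed auto
      then show ?thesis using CC unfolding S'_def by linarith
    qed
  qed
qed

section \<open>Vitali coverings and Lipschitz images\<close>

text \<open>The disjoint balls of the Vitali subfamily carry disjoint shares of \<nu>, and each
  share pays for the set \<open>Q x\<close> attached to its centre. With \<open>Q\<close> and
  \<open>M\<close> abstract, the same argument covers a set by enlarged balls and an image by balls
  around image points.\<close>

lemma vitali_emeasure_le:
  fixes r :: "'a::euclidean_space \<Rightarrow> real"
  assumes r: "\<And>x. x \<in> S \<Longrightarrow> 0 < r x \<and> r x \<le> R"
    and nu: "sets \<nu> = sets lebesgue"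
    and V: "\<And>C. C \<subseteq> S \<Longrightarrow> S \<subseteq> (\<Union>x\<in>C. cball x (5 * r x)) \<Longrightarrow> V \<subseteq> (\<Union>x\<in>C. Q x)"
    and Q: "\<And>x. x \<in> S \<Longrightarrow> Q x \<in> sets M"
    and QB: "\<And>x. x \<in> S \<Longrightarrow> emeasure M (Q x) \<le> emeasure \<nu> (cball x (r x))"
    and U: "\<And>x. x \<in> S \<Longrightarrow> cball x (r x) \<subseteq> U" "U \<in> sets lebesgue"
  shows "emeasure M V \<le> emeasure \<nu> U"
proof -
  have "S \<subseteq> (\<Union>x\<in>S. cball x (r x))"
  proof
    fix x assume "x \<in> S"
    then show "x \<in> (\<Union>x\<in>S. cball x (r x))" using r[of x] by (intro UN_I[of x]) auto
  qed
  then obtain C where C: "countable C" "C \<subseteq> S"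
    "pairwise (\<lambda>i j. disjnt (cball i (r i)) (cball j (r j))) C" "S \<subseteq> (\<Union>i\<in>C. cball i (5 * r i))"
    by (rule Vitali_covering_lemma_cballs[of S "\<lambda>x. x" r S R]) (use r in auto)
  define I where "I = to_nat_on C ` C"
  define h where "h = from_nat_into C"
  have hI: "h n \<in> C" if "n \<in> I" for n
    using that C(1) by (auto simp: I_def h_def)
  have hC: "\<exists>n\<in>I. h n = x" if "x \<in> C" for x
    using that C(1) by (auto simp: I_def h_def)
  have inj: "inj_on h I"
    using C(1) by (auto simp: I_def h_def inj_on_def)
  define A where "A n = (if n \<in> I then cball (h n) (r (h n)) else {})" for n
  define B where "B n = (if n \<in> I then Q (h n) else {})" for n
  have "V \<subseteq> (\<Union>x\<in>C. Q x)" using V C by blast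
  also have "\<dots> \<subseteq> (\<Union>n. B n)"
  proof
    fix v assume "v \<in> (\<Union>x\<in>C. Q x)"
    then obtain x where x: "x \<in> C" "v \<in> Q x" by blast
    then obtain n where "n \<in> I" "h n = x" using hC by blast
    then have "v \<in> B n" using x by (simp add: B_def)
    then show "v \<in> (\<Union>n. B n)" by blast
  qed
  finally have VB: "V \<subseteq> (\<Union>n. B n)" .
  have Bs: "range B \<subseteq> sets M" using Q hI C by (auto simp: B_def)
  have As: "range A \<subseteq> sets \<nu>" unfolding nu by (auto simp: A_def)
  have dis: "disjoint_family A"
    unfolding disjoint_family_on_def
  proof (intro ballI impI)
    fix m n :: nat assume "m \<noteq> n"
    show "A m \<inter> A n = {}"
    proof (cases "m \<in> I \<and> n \<in> I")
      case True
      then have "h m \<noteq> h n" using inj \<open>m \<noteq> n\<close> by (auto simp: inj_on_def)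
      then show ?thesis using C(3) hI True by (auto simp: pairwise_def disjnt_def A_def)
    qed (auto simp: A_def)
  qed
  have "emeasure M V \<le> emeasure M (\<Union>n. B n)" using VB Bs by (intro emeasure_mono) auto
  also have "\<dots> \<le> (\<Sum>n. emeasure M (B n))" by (intro emeasure_subadditive_countably Bs)
  also have "\<dots> \<le> (\<Sum>n. emeasure \<nu> (A n))"
    using QB hI C by (intro suminf_le) (auto simp: A_def B_def)
  also have "\<dots> = emeasure \<nu> (\<Union>n. A n)" by (intro suminf_emeasure As dis)
  also have "\<dots> \<le> emeasure \<nu> U"
  proof (rule emeasure_mono)
    have "A n \<subseteq> U" for n
      using U(1)[of "h n"] hI[of n] C(2) by (cases "n \<in> I") (auto simp only: A_def if_True if_False)
    then show "(\<Union>n. A n) \<subseteq> U" by blast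
  qed (simp add: nu U(2))
  finally show ?thesis .
qed

lemma one_plus_power_le:
  fixes t :: real assumes "0 \<le> t" shows "(1 + t) ^ n \<le> 2 ^ n * (1 + t ^ n)"
proof -
  have "(1 + t) ^ n \<le> (2 * max 1 t) ^ n" using assms by (intro power_mono) auto
  also have "\<dots> = 2 ^ n * max 1 t ^ n" by (simp add: power_mult_distrib)
  also have "max 1 t ^ n \<le> 1 + t ^ n" using assms by (auto simp: max_def)
  finally show ?thesis by simp
qed

lemma emeasure_lebesgue_cball:
  fixes c :: "'a::euclidean_space"
  assumes "0 \<le> r"
  shows "emeasure lebesgue (cball c r) = ennreal (unit_ball_vol (real DIM('a)) * r ^ DIM('a))"
  using emeasure_cball[OF assms, of c] by simp

text \<open>A ball of radius \<open>r\<close> around \<open>x\<close>, enlarged five times, is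
  mapped into a ball of radius \<open>5 * r * L * (1 + f x)\<close>; Lipschitz control from the
  centre suffices for this. The volume of that ball is bounded by the mass of the unenlarged one
  under a multiple of the density \<open>1 + f^n\<close>, because \<open>f x <= f z + 1\<close>
  there.\<close>

lemma emeasure_lipschitz_image_le:
  fixes T :: "'a::euclidean_space \<Rightarrow> 'a"
  assumes D: "open D" and cont: "continuous_on D f" and f0: "\<And>x. x \<in> D \<Longrightarrow> 0 \<le> f x"
    and L: "0 < L"
    and lip: "\<And>x. x \<in> S \<Longrightarrow> \<exists>\<delta>>0. \<forall>x'\<in>S. dist x' x < \<delta> \<longrightarrow>
        dist (T x') (T x) \<le> L * (1 + f x) * dist x' x"
    and SW: "S \<subseteq> W" and W: "W \<in> sets lebesgue" "W \<subseteq> D" and V: "V \<subseteq> T ` S"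
  shows "emeasure lebesgue V \<le> ennreal ((20 * L) ^ DIM('a)) *
      (emeasure lebesgue W + (\<integral>\<^sup>+x\<in>D. ennreal (f x ^ DIM('a)) \<partial>lebesgue))"
proof -
  let ?n = "DIM('a)"
  \<comment> \<open>20 collects the Vitali factor 5, a factor 2 from
    \<open>1 + f x <= 2 * (1 + f z)\<close> and a factor 2 from
    \<open>one_plus_power_le\<close>.\<close>
  define K where "K = (20 * L) ^ ?n"
  have K0: "0 < K" using L by (simp add: K_def)
  let ?I = "\<integral>\<^sup>+x\<in>D. ennreal (f x ^ ?n) \<partial>lebesgue"
  have Dm: "D \<in> sets lebesgue" using D by (simp add: borel_open)
  have fm: "(\<lambda>x. indicator D x * f x) \<in> borel_measurable lebesgue"
  proof -
    have "(\<lambda>x. indicator D x *\<^sub>R f x) \<in> borel_measurable borel"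
      using D by (intro borel_measurable_continuous_on_indicator cont) (simp add: borel_open)
    then show ?thesis by (simp add: measurable_completion measurable_lborel1)
  qed
  have fm2: "(\<lambda>x. ennreal (f x ^ ?n) * indicator D x) \<in> borel_measurable lebesgue"
  proof -
    have "(\<lambda>x. ennreal ((indicator D x * f x) ^ ?n) * indicator D x) \<in> borel_measurable lebesgue"
      using fm Dm by measurable
    then show ?thesis by (rule measurable_cong[THEN iffD1, rotated]) (auto simp: indicator_def)
  qed
  define \<nu> where "\<nu> = density lebesgue (\<lambda>z. ennreal K * (indicator D z + ennreal (f z ^ ?n) * indicator D z))"
  have nm: "(\<lambda>z. ennreal K * (indicator D z + ennreal (f z ^ ?n) * indicator D z)) \<in> borel_measurable lebesgue"
    using fm2 Dm by measurable
  have step: "emeasure lebesgue V \<le> ennreal K * (emeasure lebesgue W + ennreal e + ?I)" if e: "0 < e" for e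
  proof -
    \<comment> \<open>The covering balls leave the merely measurable set \<open>W\<close>; they are
      kept inside an open set that exceeds \<open>W\<close> by measure less than
      \<open>e\<close>.\<close>
    obtain U0 where U0: "open U0" "W \<subseteq> U0" "U0 - W \<in> lmeasurable" "emeasure lebesgue (U0 - W) < ennreal e"
      using sets_lebesgue_outer_open[OF W(1) e] by blast
    define U where "U = U0 \<inter> D"
    have U: "open U" "W \<subseteq> U" "U \<subseteq> D" using U0 D W by (auto simp: U_def)
    have "\<forall>x\<in>S. \<exists>r. 0 < r \<and> r \<le> 1 \<and> cball x r \<subseteq> U \<and> (\<forall>z\<in>cball x r. f x \<le> f z + 1) \<and>
       (\<forall>x'\<in>S \<inter> cball x (5 * r). dist (T x') (T x) \<le> L * (1 + f x) * dist x' x)"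
    proof
      fix x assume x: "x \<in> S"
      then have xU: "x \<in> U" using SW U by auto
      obtain r1 where r1: "0 < r1" "cball x r1 \<subseteq> U" using U(1) xU open_contains_cball by blast
      have "isCont f x" using cont D xU U by (auto simp: continuous_on_eq_continuous_at)
      then obtain r2 where r2: "0 < r2" "\<And>z. dist z x < r2 \<Longrightarrow> dist (f z) (f x) < 1"
        unfolding continuous_at_eps_delta by (metis zero_less_one)
      obtain r3 where r3: "0 < r3" "\<And>x'. x' \<in> S \<Longrightarrow> dist x' x < r3 \<Longrightarrow> dist (T x') (T x) \<le> L * (1 + f x) * dist x' x"
        using lip[OF x] by blast
      define r where "r = min (min 1 r1) (min (r2 / 2) (r3 / 10))"
      have r: "0 < r" "r \<le> 1" "r \<le> r1" "r < r2" "5 * r < r3"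
        using r1 r2 r3 by (auto simp: r_def)
      show "\<exists>r. 0 < r \<and> r \<le> 1 \<and> cball x r \<subseteq> U \<and> (\<forall>z\<in>cball x r. f x \<le> f z + 1) \<and>
       (\<forall>x'\<in>S \<inter> cball x (5 * r). dist (T x') (T x) \<le> L * (1 + f x) * dist x' x)"
      proof (intro exI[of _ r] conjI ballI)
        show "cball x r \<subseteq> U" using r r1 subset_cball[of r r1 x] by blast
        fix z assume "z \<in> cball x r"
        then have "dist z x < r2" using r by (simp add: dist_commute)
        then show "f x \<le> f z + 1" using r2(2)[of z] by (simp add: dist_real_def)
      next
        fix x' assume "x' \<in> S \<inter> cball x (5 * r)"
        then show "dist (T x') (T x) \<le> L * (1 + f x) * dist x' x" using r3 r by (simp add: dist_commute)
      qed (use r in auto)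
    qed
    from bchoice[OF this] obtain r where r: "\<And>x. x \<in> S \<Longrightarrow> 0 < r x \<and> r x \<le> 1"
      "\<And>x. x \<in> S \<Longrightarrow> cball x (r x) \<subseteq> U" "\<And>x z. x \<in> S \<Longrightarrow> z \<in> cball x (r x) \<Longrightarrow> f x \<le> f z + 1"
      "\<And>x x'. x \<in> S \<Longrightarrow> x' \<in> S \<inter> cball x (5 * r x) \<Longrightarrow> dist (T x') (T x) \<le> L * (1 + f x) * dist x' x"
      by blast
    have "emeasure lebesgue V \<le> emeasure \<nu> U"
    proof (rule vitali_emeasure_le[where r=r and R=1 and S=S and Q="\<lambda>x. cball (T x) (5 * r x * (L * (1 + f x)))"])
      fix x assume x: "x \<in> S"
      then have fx: "0 \<le> f x" using f0 SW W by blast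
      have r0: "0 < r x" using r(1) x by blast
      let ?c = "5 * (L * (1 + f x))"
      have c0: "0 \<le> ?c" using fx L by simp
      have "emeasure lebesgue (cball (T x) (5 * r x * (L * (1 + f x))))
         = ennreal (unit_ball_vol (real ?n) * (5 * r x * (L * (1 + f x))) ^ ?n)"
        using fx L r0 by (intro emeasure_lebesgue_cball) auto
      also have "\<dots> = ennreal (?c ^ ?n) * emeasure lebesgue (cball x (r x))"
        using r0 c0 by (subst emeasure_lebesgue_cball)
          (simp_all add: ennreal_mult'[symmetric] power_mult_distrib mult_ac)
      also have "\<dots> = (\<integral>\<^sup>+z. ennreal (?c ^ ?n) * indicator (cball x (r x)) z \<partial>lebesgue)"
        by (simp add: nn_integral_cmult_indicator)
      also have "\<dots> \<le> (\<integral>\<^sup>+z. ennreal K * (indicator D z + ennreal (f z ^ ?n) * indicator D z) * indicator (cball x (r x)) z \<partial>lebesgue)"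
      proof (intro nn_integral_mono)
        fix z
        show "ennreal (?c ^ ?n) * indicator (cball x (r x)) z \<le>
          ennreal K * (indicator D z + ennreal (f z ^ ?n) * indicator D z) * indicator (cball x (r x)) z"
        proof (cases "z \<in> cball x (r x)")
          case True
          then have zD: "z \<in> D" using r(2)[OF x] U by blast
          have fz: "0 \<le> f z" using f0 zD by blast
          have "?c \<le> 10 * L * (1 + f z)"
          proof -
            have "L * (1 + f x) \<le> L * (2 * (1 + f z))"
              using r(3)[OF x True] fz L by (intro mult_left_mono) auto
            then show ?thesis by (simp add: algebra_simps)
          qed
          then have "?c ^ ?n \<le> (10 * L * (1 + f z)) ^ ?n" using c0 by (intro power_mono)
          also have "\<dots> = (10 * L) ^ ?n * (1 + f z) ^ ?n" by (simp add: power_mult_distrib)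
          also have "\<dots> \<le> (10 * L) ^ ?n * (2 ^ ?n * (1 + f z ^ ?n))"
            using L one_plus_power_le[OF fz] by (intro mult_left_mono) auto
          also have "\<dots> = K * (1 + f z ^ ?n)"
          proof -
            have "20 * L = (10 * L) * 2" by simp
            then show ?thesis unfolding K_def by (simp only: power_mult_distrib mult.assoc)
          qed
          finally have "ennreal (?c ^ ?n) \<le> ennreal (K * (1 + f z ^ ?n))" by (rule ennreal_leI)
          also have "\<dots> = ennreal K * (1 + ennreal (f z ^ ?n))"
            using K0 fz by (simp add: ennreal_mult' ennreal_plus)
          finally show ?thesis using True zD by simp
        qed simp
      qed
      also have "\<dots> = emeasure \<nu> (cball x (r x))"
        unfolding \<nu>_def by (subst emeasure_density[OF nm]) auto
      finally show "emeasure lebesgue (cball (T x) (5 * r x * (L * (1 + f x)))) \<le> emeasure \<nu> (cball x (r x))" .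
    next
      fix C assume C: "C \<subseteq> S" "S \<subseteq> (\<Union>x\<in>C. cball x (5 * r x))"
      show "V \<subseteq> (\<Union>x\<in>C. cball (T x) (5 * r x * (L * (1 + f x))))"
      proof
        fix v assume "v \<in> V"
        then obtain x' where x': "x' \<in> S" "v = T x'" using V by blast
        then obtain x where x: "x \<in> C" "x' \<in> cball x (5 * r x)" using C by blast
        have xS: "x \<in> S" using x C by blast
        have fx: "0 \<le> f x" using f0 SW W xS by blast
        have "dist (T x') (T x) \<le> L * (1 + f x) * dist x' x" using r(4) xS x x' by blast
        also have "\<dots> \<le> L * (1 + f x) * (5 * r x)" using x fx L
          by (intro mult_left_mono) (auto simp: dist_commute)
        finally have "v \<in> cball (T x) (5 * r x * (L * (1 + f x)))"
          using x' by (simp add: dist_commute mult_ac)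
        then show "v \<in> (\<Union>x\<in>C. cball (T x) (5 * r x * (L * (1 + f x))))" using x by blast
      qed
    qed (use r U in \<open>auto simp: \<nu>_def borel_open\<close>)
    also have "emeasure \<nu> U = (\<integral>\<^sup>+z. ennreal K * (indicator D z + ennreal (f z ^ ?n) * indicator D z) * indicator U z \<partial>lebesgue)"
      unfolding \<nu>_def using U by (subst emeasure_density[OF nm]) (auto simp: borel_open)
    also have "\<dots> \<le> (\<integral>\<^sup>+z. ennreal K * (indicator U z + ennreal (f z ^ ?n) * indicator D z) \<partial>lebesgue)"
      by (intro nn_integral_mono) (auto simp: indicator_def)
    also have "\<dots> = ennreal K * (emeasure lebesgue U + ?I)"
    proof -
      have m: "(\<lambda>z. indicator U z :: ennreal) \<in> borel_measurable lebesgue"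
        using U by (intro borel_measurable_indicator) (simp add: borel_open)
      show ?thesis
        using nn_integral_cmult[OF borel_measurable_add[OF m fm2], of "ennreal K"]
          nn_integral_add[OF m fm2] U by (simp add: borel_open)
    qed
    also have "emeasure lebesgue U \<le> emeasure lebesgue W + ennreal e"
    proof -
      have "emeasure lebesgue U \<le> emeasure lebesgue (W \<union> (U0 - W))"
        using U0 W by (intro emeasure_mono) (auto simp: U_def fmeasurableD)
      also have "\<dots> \<le> emeasure lebesgue W + emeasure lebesgue (U0 - W)"
        using U0 W by (intro emeasure_subadditive) (auto simp: fmeasurableD)
      finally show ?thesis using U0(4) by (meson add_left_mono less_imp_le order_trans)
    qed
    finally show ?thesis by (simp add: add_right_mono mult_left_mono)
  qed
  show ?thesis
    unfolding K_def[symmetric]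
  proof (rule ennreal_le_epsilon)
    fix e :: real assume e: "0 < e"
    have "emeasure lebesgue V \<le> ennreal K * (emeasure lebesgue W + ennreal (e / K) + ?I)"
      using step[of "e / K"] e K0 by simp
    also have "\<dots> = ennreal K * (emeasure lebesgue W + ?I) + ennreal e"
      using e K0 by (simp add: algebra_simps ennreal_mult'[symmetric])
    finally show "emeasure lebesgue V \<le> ennreal K * (emeasure lebesgue W + ?I) + ennreal e" .
  qed
qed

text \<open>Since \<open>x' = x\<close> is allowed with arbitrarily small \<open>\<rho>\<close>, the relation is a function of \<open>x\<close>.\<close>
lemma emeasure_lipschitz_relation_le:
  fixes R :: "'a::euclidean_space \<Rightarrow> 'a \<Rightarrow> bool"
  assumes D: "open D" and cont: "continuous_on D f" and f0: "\<And>x. x \<in> D \<Longrightarrow> 0 \<le> f x"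
    and L: "0 < L"
    and lip: "\<And>x y. R x y \<Longrightarrow> \<exists>\<delta>>0. \<forall>\<rho> x' y'. 0 < \<rho> \<longrightarrow> \<rho> < \<delta> \<longrightarrow> R x' y' \<longrightarrow> dist x' x \<le> \<rho> \<longrightarrow>
        dist y' y \<le> L * (1 + f x) * \<rho>"
    and RW: "\<And>x y. R x y \<Longrightarrow> x \<in> W" and W: "W \<in> sets lebesgue" "W \<subseteq> D"
    and V: "\<And>y. y \<in> V \<Longrightarrow> \<exists>x. R x y"
  shows "emeasure lebesgue V \<le> ennreal ((20 * L) ^ DIM('a)) *
      (emeasure lebesgue W + (\<integral>\<^sup>+x\<in>D. ennreal (f x ^ DIM('a)) \<partial>lebesgue))"
proof -
  have uniq: "y' = y" if R: "R x y" "R x y'" for x y y'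
  proof -
    obtain \<delta> where \<delta>: "0 < \<delta>" "\<And>\<rho>. 0 < \<rho> \<Longrightarrow> \<rho> < \<delta> \<Longrightarrow> dist y' y \<le> L * (1 + f x) * \<rho>"
      using lip[OF R(1)] R(2) by (metis dist_self less_imp_le)
    have K: "0 < L * (1 + f x)" using L f0[of x] RW[OF R(1)] W by (auto simp: add_pos_nonneg)
    have "dist y' y \<le> e" if e: "0 < e" for e
    proof -
      define \<rho> where "\<rho> = min (\<delta> / 2) (e / (L * (1 + f x)))"
      have "0 < \<rho>" "\<rho> < \<delta>" using \<delta> e K by (auto simp: \<rho>_def)
      then have "dist y' y \<le> L * (1 + f x) * \<rho>" by (rule \<delta>(2))
      also have "\<dots> \<le> L * (1 + f x) * (e / (L * (1 + f x)))"
        using K by (intro mult_left_mono) (auto simp: \<rho>_def)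
      also have "\<dots> = e" using less_imp_neq[OF K] by (simp only: times_divide_eq_right nonzero_mult_div_cancel_left)
      finally show ?thesis .
    qed
    then show ?thesis using field_le_epsilon[of "dist y' y" 0] by simp
  qed
  define S where "S = {x. \<exists>y. R x y}"
  define T where "T x = (SOME y. R x y)" for x
  have RT: "R x (T x)" if "x \<in> S" for x
    using that unfolding S_def T_def by (auto intro: someI_ex)
  show ?thesis
  proof (rule emeasure_lipschitz_image_le[OF D cont f0 L, where S=S and T=T])
    fix x assume x: "x \<in> S"
    obtain \<delta> where \<delta>: "0 < \<delta>" "\<And>\<rho> x' y'. 0 < \<rho> \<Longrightarrow> \<rho> < \<delta> \<Longrightarrow> R x' y' \<Longrightarrow> dist x' x \<le> \<rho> \<Longrightarrow>
        dist y' (T x) \<le> L * (1 + f x) * \<rho>"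
      using lip[OF RT[OF x]] by blast
    show "\<exists>\<delta>>0. \<forall>x'\<in>S. dist x' x < \<delta> \<longrightarrow> dist (T x') (T x) \<le> L * (1 + f x) * dist x' x"
    proof (intro exI[of _ \<delta>] conjI ballI impI \<delta>(1))
      fix x' assume x': "x' \<in> S" "dist x' x < \<delta>"
      show "dist (T x') (T x) \<le> L * (1 + f x) * dist x' x"
      proof (cases "x' = x")
        case False
        then show ?thesis using \<delta>(2)[OF _ x'(2) RT[OF x'(1)]] by simp
      qed simp
    qed
  next
    show "V \<subseteq> T ` S"
    proof
      fix y assume "y \<in> V"
      then obtain x where x: "R x y" using V by blast
      then have xS: "x \<in> S" by (auto simp: S_def)
      then have "T x = y" using uniq[OF x RT] by simp
      then show "y \<in> T ` S" using xS by blast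
    qed
  qed (use RW W in \<open>auto simp: S_def\<close>)
qed

section \<open>Sliding Gaussian barriers\<close>

text \<open>Like the classical barrier \<open>|x|^(-p)\<close>, this radial function is a strict
  subsolution for Pucci operators away from the origin when \<open>k\<close> is large. It is also
  smooth at the origin, and \<open>exp s >= 1 + s\<close> gives paraboloids that touch it from below
  globally.\<close>

definition gauss :: "real \<Rightarrow> 'a::real_inner \<Rightarrow> real" where
  "gauss k x = exp (- (k * (norm x)\<^sup>2))"

lemma gauss_bounds: "0 \<le> k \<Longrightarrow> 0 < gauss k x \<and> gauss k x \<le> 1"
  by (simp add: gauss_def)

lemma gauss_add: "gauss k (x + h) = gauss k x * exp (- (k * (2 * (x \<bullet> h) + (norm h)\<^sup>2)))"
proof -
  have "(norm (x + h))\<^sup>2 = (norm x)\<^sup>2 + (2 * (x \<bullet> h) + (norm h)\<^sup>2)"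
    by (simp add: power2_norm_eq_inner inner_commute algebra_simps)
  then show ?thesis unfolding gauss_def exp_add[symmetric] by (simp add: algebra_simps)
qed

lemma gauss_ge_linear:
  assumes "0 \<le> k"
  shows "gauss k x * (1 - 2 * k * (x \<bullet> h) - k * (norm h)\<^sup>2) \<le> gauss k (x + h)"
proof -
  have "1 - 2 * k * (x \<bullet> h) - k * (norm h)\<^sup>2 \<le> exp (- (k * (2 * (x \<bullet> h) + (norm h)\<^sup>2)))"
    using exp_ge_add_one_self[of "- (k * (2 * (x \<bullet> h) + (norm h)\<^sup>2))"] by (simp add: algebra_simps)
  then show ?thesis unfolding gauss_add using gauss_bounds[OF assms, of x] by simp
qed

text \<open>Squares \<open>1 + t / 2 <= exp (t / 2)\<close>; the lower bound on \<open>t\<close>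
  keeps the left side nonnegative.\<close>

lemma exp_ge_square: fixes t :: real assumes "- 2 \<le> t" shows "1 + t + t\<^sup>2 / 4 \<le> exp t"
proof -
  have "(1 + t / 2)\<^sup>2 \<le> (exp (t / 2))\<^sup>2"
    using assms exp_ge_add_one_self[of "t / 2"] by (intro power_mono) auto
  also have "\<dots> = exp t" by (simp add: power2_eq_square exp_add[symmetric])
  finally show ?thesis by (simp add: power2_eq_square algebra_simps)
qed

text \<open>A one-sided expansion without remainder: Taylor's formula has
  \<open>2 * k\<^sup>2\<close> and \<open>k\<close> where the statement has
  \<open>k\<^sup>2 / 2\<close> and \<open>2 * k\<close>, and the slack absorbs the higher-order
  terms for small \<open>h\<close>. The quadratic part is of the form \<open>c e e^T - b I\<close>
  with \<open>e\<close> along \<open>x\<close>, which is what \<open>supersol\<close> tests.\<close>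

lemma gauss_ge_quadratic:
  fixes x :: "'a::real_inner"
  assumes k: "0 < k"
  shows "\<forall>\<^sub>F h in nhds 0. gauss k x * (1 - 2 * k * (x \<bullet> h) + k\<^sup>2 / 2 * (x \<bullet> h)\<^sup>2 - 2 * k * (norm h)\<^sup>2) \<le> gauss k (x + h)"
proof -
  have "((\<lambda>h. k * (2 * (x \<bullet> h) + (norm h)\<^sup>2)) \<longlongrightarrow> k * (2 * (x \<bullet> 0) + (norm (0::'a))\<^sup>2)) (nhds 0)"
    by (intro tendsto_intros filterlim_ident)
  then have e1: "\<forall>\<^sub>F h in nhds 0. k * (2 * (x \<bullet> h) + (norm h)\<^sup>2) < 2"
    by (rule order_tendstoD) simp
  have "((\<lambda>h::'a. k * (norm h)\<^sup>2) \<longlongrightarrow> k * (norm (0::'a))\<^sup>2) (nhds 0)"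
    by (intro tendsto_intros filterlim_ident)
  then have e2: "\<forall>\<^sub>F h in nhds (0::'a). k * (norm h)\<^sup>2 < 4"
    by (rule order_tendstoD) simp
  from e1 e2 show ?thesis
  proof eventually_elim
    case (elim h)
    define A where "A = x \<bullet> h"
    define B where "B = (norm h)\<^sup>2"
    have B0: "0 \<le> B" by (simp add: B_def)
    have "k * (k * B * B) \<le> k * (4 * B)"
      using elim(2) k B0 unfolding B_def[symmetric] by (intro mult_left_mono mult_right_mono) auto
    moreover have "k\<^sup>2 * (2 * A\<^sup>2 - B\<^sup>2) \<le> k\<^sup>2 * (2 * A + B)\<^sup>2"
    proof -
      have "0 \<le> 2 * (A + B)\<^sup>2" by simp
      then have "2 * A\<^sup>2 - B\<^sup>2 \<le> (2 * A + B)\<^sup>2" by (simp add: power2_eq_square algebra_simps)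
      then show ?thesis using k by (intro mult_left_mono) auto
    qed
    moreover have "k\<^sup>2 * (2 * A\<^sup>2 - B\<^sup>2) = 4 * (k\<^sup>2 / 2 * A\<^sup>2) - k * (k * B * B)"
      by (simp add: power2_eq_square algebra_simps)
    moreover have "(- (k * (2 * A + B)))\<^sup>2 = k\<^sup>2 * (2 * A + B)\<^sup>2" by (simp add: power_mult_distrib)
    moreover have "k * (2 * A + B) = 2 * k * A + k * B" "k * (4 * B) = 4 * (k * B)" by (simp_all add: algebra_simps)
    ultimately have "1 - 2 * k * A + k\<^sup>2 / 2 * A\<^sup>2 - 2 * k * B \<le> 1 + (- (k * (2 * A + B))) + (- (k * (2 * A + B)))\<^sup>2 / 4"
      by linarith
    also have "\<dots> \<le> exp (- (k * (2 * A + B)))"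
      using elim(1) by (intro exp_ge_square) (simp add: A_def B_def)
    finally show ?case
      unfolding gauss_add using gauss_bounds[of k x] k by (simp add: A_def B_def)
  qed
qed

lemma continuous_on_gauss: "continuous_on S (gauss k)"
  unfolding gauss_def by (intro continuous_intros)

text \<open>Chebyshev's inequality at level 1; it charges to the integral those contact points at
  which a strict subsolution forces \<open>f >= 1\<close>.\<close>

lemma emeasure_level_le_nn_integral:
  fixes f :: "'a::euclidean_space \<Rightarrow> real"
  assumes D: "open D" and cont: "continuous_on D f"
  shows "{x\<in>D. 1 \<le> f x} \<in> sets lebesgue"
    "emeasure lebesgue {x\<in>D. 1 \<le> f x} \<le> (\<integral>\<^sup>+x\<in>D. ennreal (f x ^ n) \<partial>lebesgue)"
proof -
  have "closedin (top_of_set D) (D \<inter> f -` {1..})"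
    using cont by (intro continuous_closedin_preimage) auto
  then obtain T where T: "closed T" "D \<inter> f -` {1..} = T \<inter> D"
    by (auto simp: closedin_closed Int_commute)
  have "{x\<in>D. 1 \<le> f x} = T \<inter> D" using T(2) by auto
  then show m: "{x\<in>D. 1 \<le> f x} \<in> sets lebesgue"
    using T(1) D by (simp add: borel_open borel_closed)
  have "emeasure lebesgue {x\<in>D. 1 \<le> f x} = (\<integral>\<^sup>+x. indicator {x\<in>D. 1 \<le> f x} x \<partial>lebesgue)"
    using m by simp
  also have "\<dots> \<le> (\<integral>\<^sup>+x\<in>D. ennreal (f x ^ n) \<partial>lebesgue)"
  proof (rule nn_integral_mono)
    fix x
    show "indicator {x\<in>D. 1 \<le> f x} x \<le> ennreal (f x ^ n) * indicator D x"
      by (auto simp: indicator_def one_le_power ennreal_leI[of 1, simplified])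
  qed
  finally show "emeasure lebesgue {x\<in>D. 1 \<le> f x} \<le> (\<integral>\<^sup>+x\<in>D. ennreal (f x ^ n) \<partial>lebesgue)" .
qed

text \<open>Sliding \<open>P \<bullet> z + S gauss z + y \<bullet> z\<close> from below: the contact map \<open>y \<mapsto> x\<close> has a locally Lipschitz
  inverse because the touching functions have nonvanishing gradient, and outside \<open>ball 0 (1/2)\<close>
  the barrier is a strict subsolution, which forces \<open>f \<ge> 1\<close> at contact points.\<close>
lemma barrier_estimate:
  fixes C1 lam bet g :: real
  assumes lam: "0 < lam" and bet: "0 \<le> bet" and g: "0 \<le> g" and C1: "0 \<le> C1"
  obtains k S c :: real where "0 < k" "0 < S" "0 < c"
    "\<And>(u::'a::euclidean_space \<Rightarrow> real) f P x1 G.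
      continuous_on (cball 0 3) u \<Longrightarrow> continuous_on (ball 0 3) f \<Longrightarrow> (\<And>x. x \<in> ball 0 3 \<Longrightarrow> 0 \<le> f x) \<Longrightarrow>
      supersol lam bet g (ball 0 3) u f \<Longrightarrow> norm x1 \<le> 2 \<Longrightarrow>
      (\<And>z. z \<in> cball 0 3 \<Longrightarrow> u x1 + P \<bullet> (z - x1) - C1 \<le> u z) \<Longrightarrow>
      6 * k * S + 2 \<le> norm P \<or> P = 0 \<and> (\<forall>x\<in>ball 0 (1/2). u x1 + S + 5 < u x) \<Longrightarrow>
      G \<in> sets lebesgue \<Longrightarrow> G \<subseteq> ball 0 3 \<Longrightarrow>
      (\<And>x y. x \<in> ball 0 (1/2) \<Longrightarrow> norm y \<le> 1 \<Longrightarrow>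
        (\<And>z. z \<in> cball 0 3 \<Longrightarrow>
          u x + (P + y - (2 * k * S * gauss k x) *\<^sub>R x) \<bullet> (z - x) - k * S * (norm (z - x))\<^sup>2 \<le> u z) \<Longrightarrow>
        u x \<le> u x1 + P \<bullet> (x - x1) + S + 5 \<Longrightarrow> x \<in> G) \<Longrightarrow>
      ennreal c \<le> emeasure lebesgue G + (\<integral>\<^sup>+x\<in>ball 0 3. ennreal (f x ^ DIM('a)) \<partial>lebesgue)"
proof -
  obtain N C where N: "1 \<le> N" and C: "1 \<le> C" and crease:
    "\<And>(u::'a \<Rightarrow> real) f D x p b S e \<rho> F.
      supersol lam bet g D u f \<Longrightarrow> cball x (N * \<rho>) \<subseteq> D \<Longrightarrow>
      continuous_on (cball x (N * \<rho>)) u \<Longrightarrow>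
      (\<And>z. z \<in> cball x (N * \<rho>) \<Longrightarrow> f z \<le> F) \<Longrightarrow>
      0 \<le> F \<Longrightarrow> 0 < \<rho> \<Longrightarrow> 0 \<le> b \<Longrightarrow> 0 \<le> S \<Longrightarrow> norm e = 1 \<Longrightarrow> C * b * \<rho> \<le> norm p \<Longrightarrow>
      (\<And>z. z \<in> cball x (N * \<rho>) \<Longrightarrow> u x + p \<bullet> (z - x) - b / 2 * (norm (z - x))\<^sup>2 \<le> u z) \<Longrightarrow>
      (\<And>z. z \<in> cball x (N * \<rho>) \<Longrightarrow>
        u x + p \<bullet> (z - x) - b / 2 * (norm (z - x))\<^sup>2 + S * (e \<bullet> (z - x) - 2 * \<rho>) \<le> u z) \<Longrightarrow>
      min S (norm p / C) \<le> C * \<rho> * (b + F / pow_gamma (norm p / 2) g)"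
    using crease_estimate[OF lam bet g, where 'a='a] by blast
  \<comment> \<open>Chosen so that \<open>lam * k / 4 = 4 * lam + 4 * bet + 1\<close>: for
    \<open>norm x >= 1/2\<close> the convex part of the barrier beats the concave one by a fixed
    amount.\<close>
  define k where "k = (16 * lam + 16 * bet + 4) / lam"
  have k16: "16 \<le> k" using lam bet by (simp add: k_def field_simps)
  have lk: "lam * k = 16 * lam + 16 * bet + 4" using lam by (simp add: k_def)
  \<comment> \<open>\<open>g3\<close> is the value of \<open>gauss k\<close> on the sphere of radius
    3, \<open>d\<close> its gap to the value on the sphere of radius 2, where \<open>x1\<close> lies
    at worst.\<close>
  define g3 where "g3 = exp (- (k * 9))"
  define d where "d = exp (- (k * 4)) - g3"
  have g3: "0 < g3" by (simp add: g3_def)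
  have d: "0 < d" using k16 by (simp add: d_def g3_def)
  \<comment> \<open>The first summand makes the gap \<open>S * d\<close> exceed the loss
    \<open>C1\<close> plus the 5 that a slope \<open>y\<close> in the unit ball can contribute,
    which keeps contact points off the sphere of radius 3. The second makes the gradient of the
    barrier at least 2 and its Pucci operator at least 1 for \<open>norm x >= 1/2\<close>.\<close>
  define S where "S = (C1 + 6) / d + 2 / (k * g3)"
  have S0: "0 < S" using C1 d g3 k16 by (simp add: S_def add_pos_pos)
  have Sd: "C1 + 6 \<le> S * d"
  proof -
    have "(C1 + 6) / d * d \<le> S * d" using d g3 k16 by (intro mult_right_mono) (auto simp: S_def)
    then show ?thesis using d by simp
  qed
  have Sk: "2 \<le> S * k * g3"
  proof -
    have "2 / (k * g3) * (k * g3) \<le> S * (k * g3)"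
      using C1 d g3 k16 by (intro mult_right_mono) (auto simp: S_def)
    then show ?thesis using g3 k16 by (simp add: mult.assoc)
  qed
  have gg3: "g3 \<le> gauss k x" if "norm x \<le> 3" for x :: 'a
  proof -
    have "(norm x)\<^sup>2 \<le> 3\<^sup>2" using that by (intro power_mono) auto
    then show ?thesis using k16 by (simp add: g3_def gauss_def)
  qed
  define b where "b = 2 * k * S"
  have b0: "0 \<le> b" using k16 S0 by (simp add: b_def)
  define G0 where "G0 = pow_gamma (1/2) g"
  have G0: "0 < G0" by (simp add: G0_def pow_gamma_pos)
  define L where "L = C * (b + 2 / G0)"
  have L0: "0 < L" using C b0 G0 by (simp add: L_def add_nonneg_pos)
  let ?n = "DIM('a)"
  define \<omega> where "\<omega> = unit_ball_vol (real ?n)"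
  have om: "0 < \<omega>" by (simp add: \<omega>_def)
  define c where "c = \<omega> / (2 * (20 * L) ^ ?n)"
  have c0: "0 < c" using om L0 by (simp add: c_def)
  show ?thesis
  proof (rule that[OF _ S0 c0])
    show "0 < k" using k16 by simp
    fix u f :: "'a \<Rightarrow> real" and P x1 G
    assume uc: "continuous_on (cball 0 3) u" and fc: "continuous_on (ball 0 3) f"
      and f0: "\<And>x. x \<in> ball 0 3 \<Longrightarrow> 0 \<le> f x"
      and sup: "supersol lam bet g (ball 0 3) u f" and x1: "norm x1 \<le> 2"
      and low: "\<And>z. z \<in> cball 0 3 \<Longrightarrow> u x1 + P \<bullet> (z - x1) - C1 \<le> u z"
      and alt: "6 * k * S + 2 \<le> norm P \<or> P = 0 \<and> (\<forall>x\<in>ball 0 (1/2). u x1 + S + 5 < u x)"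
      and G: "G \<in> sets lebesgue" "G \<subseteq> ball 0 3"
      and inG: "\<And>x y. x \<in> ball 0 (1/2) \<Longrightarrow> norm y \<le> 1 \<Longrightarrow>
        (\<And>z. z \<in> cball 0 3 \<Longrightarrow>
          u x + (P + y - (2 * k * S * gauss k x) *\<^sub>R x) \<bullet> (z - x) - k * S * (norm (z - x))\<^sup>2 \<le> u z) \<Longrightarrow>
        u x \<le> u x1 + P \<bullet> (x - x1) + S + 5 \<Longrightarrow> x \<in> G"

    \<comment> \<open>Contact points of the barrier family and the touching functions there\<close>
    define R where "R x y \<longleftrightarrow> norm x < 3 \<and> norm y \<le> 1 \<and>
      (\<forall>z\<in>cball 0 3. u x + (P + y) \<bullet> (z - x) + S * (gauss k z - gauss k x) \<le> u z)" for x y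
    have Rtouch: "u x + (P + y - (2 * k * S * gauss k x) *\<^sub>R x) \<bullet> (z - x) - k * S * (norm (z - x))\<^sup>2 \<le> u z"
      if "R x y" "z \<in> cball 0 3" for x y z
    proof -
      have gb: "0 < gauss k x" "gauss k x \<le> 1" using gauss_bounds[of k x] k16 by auto
      have "gauss k x * (1 - 2 * k * (x \<bullet> (z - x)) - k * (norm (z - x))\<^sup>2) \<le> gauss k z"
        using gauss_ge_linear[of k x "z - x"] k16 by simp
      then have "S * (gauss k x * (1 - 2 * k * (x \<bullet> (z - x)) - k * (norm (z - x))\<^sup>2) - gauss k x) \<le> S * (gauss k z - gauss k x)"
        using S0 by (intro mult_left_mono) auto
      moreover have "gauss k x * (S * k * (norm (z - x))\<^sup>2) \<le> 1 * (S * k * (norm (z - x))\<^sup>2)"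
        using gb S0 k16 by (intro mult_right_mono) auto
      moreover have "u x + (P + y) \<bullet> (z - x) + S * (gauss k z - gauss k x) \<le> u z"
        using that unfolding R_def by blast
      moreover have "S * (gauss k x * (1 - 2 * k * (x \<bullet> (z - x)) - k * (norm (z - x))\<^sup>2) - gauss k x)
        = - (S * gauss k x * (2 * k * (x \<bullet> (z - x)))) - gauss k x * (S * k * (norm (z - x))\<^sup>2)"
        by (simp add: algebra_simps)
      moreover have "(P + y - (2 * k * S * gauss k x) *\<^sub>R x) \<bullet> (z - x)
        = (P + y) \<bullet> (z - x) - S * gauss k x * (2 * k * (x \<bullet> (z - x)))"
        by (simp add: inner_diff_left)
      ultimately show ?thesis by (simp add: mult.commute[of k S])
    qed
    have Rval: "u x \<le> u x1 + P \<bullet> (x - x1) + S + 5" if "R x y" for x y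
    proof -
      have x1': "x1 \<in> cball 0 3" using x1 by simp
      have n: "norm x \<le> 3" "norm y \<le> 1" using that by (auto simp: R_def)
      have "u x + (P + y) \<bullet> (x1 - x) + S * (gauss k x1 - gauss k x) \<le> u x1"
        using that x1' by (auto simp: R_def)
      moreover have "S * (gauss k x1 - gauss k x) \<ge> S * (0 - 1)"
        using S0 gauss_bounds[of k x] gauss_bounds[of k x1] k16 by (intro mult_left_mono) auto
      moreover have "\<bar>y \<bullet> (x1 - x)\<bar> \<le> 5"
      proof -
        have "\<bar>y \<bullet> (x1 - x)\<bar> \<le> norm y * norm (x1 - x)" by (rule Cauchy_Schwarz_ineq2)
        also have "\<dots> \<le> 1 * 5"
          using n x1 norm_triangle_ineq4[of x1 x] by (intro mult_mono) auto
        finally show ?thesis by simp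
      qed
      ultimately show ?thesis by (simp add: inner_add_left inner_diff_right)
    qed
    \<comment> \<open>Both alternatives of the hypothesis serve this bound. For large
      \<open>P\<close> the Gaussian contributes at most \<open>6 * k * S\<close> and
      \<open>y\<close> at most 1. For \<open>P = 0\<close>, \<open>Rval\<close> and the size of
      \<open>u\<close> exclude contact in \<open>ball 0 (1/2)\<close>, and outside it the Gaussian
      alone has gradient at least 2.\<close>
    have Rgrad: "1 \<le> norm (P + y - (2 * k * S * gauss k x) *\<^sub>R x)" if R: "R x y" for x y
    proof -
      have n: "norm x \<le> 3" "norm y \<le> 1" using R by (auto simp: R_def)
      have gb: "0 < gauss k x" "gauss k x \<le> 1" using gauss_bounds[of k x] k16 by auto
      show ?thesis
      proof (cases "6 * k * S + 2 \<le> norm P")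
        case True
        have "2 * k * S * gauss k x * norm x \<le> 2 * k * S * 1 * 3"
          using n gb k16 S0 by (intro mult_mono) auto
        then have "norm ((2 * k * S * gauss k x) *\<^sub>R x) \<le> 6 * k * S"
          using gb k16 S0 by simp
        then show ?thesis using True n
            norm_triangle_ineq4[of "P + y - (2 * k * S * gauss k x) *\<^sub>R x" "y - (2 * k * S * gauss k x) *\<^sub>R x"]
            norm_triangle_ineq4[of y "(2 * k * S * gauss k x) *\<^sub>R x"] by simp
      next
        case False
        then have P0: "P = 0" and big: "\<And>x. x \<in> ball 0 (1/2) \<Longrightarrow> u x1 + S + 5 < u x" using alt by auto
        have x2: "1/2 \<le> norm x"
        proof (rule ccontr)
          assume "\<not> 1/2 \<le> norm x"
          then have "u x1 + S + 5 < u x" using big by simp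
          then show False using Rval[OF R] P0 by simp
        qed
        have "2 * k * S * g3 * (1/2) \<le> 2 * k * S * gauss k x * norm x"
          using gg3[OF n(1)] x2 k16 S0 g3 gb by (intro mult_mono) auto
        moreover have "2 * k * S * g3 * (1/2) = S * k * g3" by simp
        moreover have "norm ((2 * k * S * gauss k x) *\<^sub>R x) = 2 * k * S * gauss k x * norm x"
          using gb k16 S0 by simp
        ultimately have "2 \<le> norm ((2 * k * S * gauss k x) *\<^sub>R x)"
          using Sk by linarith
        then show ?thesis using n norm_triangle_ineq4[of y "y - (2 * k * S * gauss k x) *\<^sub>R x"] P0 by simp
      qed
    qed
    have Rf: "1 \<le> f x" if R: "R x y" and x2: "1/2 \<le> norm x" for x y
    proof -
      have n: "norm x \<le> 3" "norm y \<le> 1" "x \<in> ball 0 3" using R by (auto simp: R_def)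
      have gb: "0 < gauss k x" "gauss k x \<le> 1" using gauss_bounds[of k x] k16 by auto
      have nx: "norm x \<noteq> 0" using x2 by auto
      define e where "e = x /\<^sub>R norm x"
      \<comment> \<open>\<open>ct\<close> and \<open>bt\<close> are read off from
        \<open>gauss_ge_quadratic\<close>, with the square of \<open>x \<bullet> h\<close> rewritten
        along the unit vector \<open>e\<close>.\<close>
      define ct where "ct = S * gauss k x * k\<^sup>2 * (norm x)\<^sup>2"
      define bt where "bt = 4 * k * S * gauss k x"
      define p where "p = P + y - (2 * k * S * gauss k x) *\<^sub>R x"
      have x4: "1/4 \<le> (norm x)\<^sup>2"
      proof -
        have "(1/2)\<^sup>2 \<le> (norm x)\<^sup>2" using x2 by (intro power_mono) auto
        then show ?thesis by (simp add: power2_eq_square)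
      qed
      have ctbt: "bt \<le> ct"
      proof -
        have "16 * (1/4) \<le> k * (norm x)\<^sup>2" using k16 x4 by (intro mult_mono) auto
        then have "S * gauss k x * k * 4 \<le> S * gauss k x * k * (k * (norm x)\<^sup>2)"
          using S0 gb k16 by (intro mult_left_mono) auto
        then show ?thesis by (simp add: bt_def ct_def power2_eq_square mult_ac)
      qed
      have en: "norm e = 1" using nx by (simp add: e_def)
      have "\<forall>\<^sub>F h in nhds 0. gauss k x * (1 - 2 * k * (x \<bullet> h) + k\<^sup>2 / 2 * (x \<bullet> h)\<^sup>2 - 2 * k * (norm h)\<^sup>2) \<le> gauss k (x + h)"
        using k16 by (intro gauss_ge_quadratic) auto
      moreover have "filterlim (\<lambda>z. z - x) (nhds 0) (nhds x)"
      proof -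
        have "((\<lambda>z. z - x) \<longlongrightarrow> x - x) (nhds x)" by (intro tendsto_intros filterlim_ident)
        then show ?thesis by simp
      qed
      ultimately have ev: "\<forall>\<^sub>F z in nhds x. gauss k x * (1 - 2 * k * (x \<bullet> (z - x)) + k\<^sup>2 / 2 * (x \<bullet> (z - x))\<^sup>2
          - 2 * k * (norm (z - x))\<^sup>2) \<le> gauss k (x + (z - x))"
        by (rule eventually_compose_filterlim)
      have ev2: "\<forall>\<^sub>F z in nhds x. z \<in> ball 0 3" using n(3) by (intro eventually_nhds_in_open) auto
      have "\<forall>\<^sub>F z in nhds x. u x + p \<bullet> (z - x) + ct / 2 * (e \<bullet> (z - x))\<^sup>2 - bt / 2 * (norm (z - x))\<^sup>2 \<le> u z"
        using ev ev2
      proof eventually_elim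
        case (elim z)
        have A: "S * (gauss k x * (1 - 2 * k * (x \<bullet> (z - x)) + k\<^sup>2 / 2 * (x \<bullet> (z - x))\<^sup>2 - 2 * k * (norm (z - x))\<^sup>2)) \<le> S * gauss k z"
          using elim(1) S0 by (intro mult_left_mono) auto
        have B: "u x + (P + y) \<bullet> (z - x) + S * (gauss k z - gauss k x) \<le> u z"
          using R elim(2) by (auto simp: R_def)
        have E: "ct / 2 * (e \<bullet> (z - x))\<^sup>2 = S * gauss k x * (k\<^sup>2 / 2 * (x \<bullet> (z - x))\<^sup>2)"
          using nx by (simp add: ct_def e_def power_mult_distrib power_inverse)
        have "p \<bullet> (z - x) = (P + y) \<bullet> (z - x) - S * gauss k x * (2 * k * (x \<bullet> (z - x)))"
          by (simp add: p_def inner_diff_left)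
        then show ?case unfolding E bt_def using A B by (simp add: algebra_simps)
      qed
      moreover have "0 \<le> bt" using gb k16 S0 by (simp add: bt_def)
      ultimately have test: "pow_gamma (norm p) g * (lam * (ct - bt) - bet * bt) \<le> f x"
        using sup n(3) en ctbt unfolding supersol_def by blast
      have "1 \<le> S * gauss k x * k"
      proof -
        have "S * k * g3 \<le> S * k * gauss k x" using gg3[OF n(1)] S0 k16 by (intro mult_left_mono) auto
        then show ?thesis using Sk by (simp add: mult_ac)
      qed
      also have "\<dots> \<le> S * gauss k x * k * (lam * k * (norm x)\<^sup>2 - 4 * lam - 4 * bet)"
      proof -
        have "lam * k * (1/4) \<le> lam * k * (norm x)\<^sup>2" using x4 lam k16 by (intro mult_left_mono) auto
        then have "1 \<le> lam * k * (norm x)\<^sup>2 - 4 * lam - 4 * bet" using lk by simp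
        then show ?thesis using S0 gb k16 by simp
      qed
      also have "\<dots> = lam * (ct - bt) - bet * bt"
        by (simp add: ct_def bt_def power2_eq_square algebra_simps)
      finally have X: "1 \<le> lam * (ct - bt) - bet * bt" .
      have "1 \<le> pow_gamma (norm p) g"
        using Rgrad[OF R] g pow_gamma_mono[of g 1 "norm p"] by (simp add: p_def pow_gamma_def split: if_splits)
      then have "1 * 1 \<le> pow_gamma (norm p) g * (lam * (ct - bt) - bet * bt)"
        using X by (intro mult_mono) auto
      then show ?thesis using test by simp
    qed
    \<comment> \<open>Contact inside \<open>ball 0 (1/2)\<close> lies in \<open>G\<close> by
      hypothesis, contact outside it in the level set by \<open>Rf\<close>.\<close>
    define W where "W = G \<union> {x \<in> ball 0 3. 1 \<le> f x}"
    have RW: "x \<in> W" if R: "R x y" for x y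
    proof (cases "1/2 \<le> norm x")
      case True
      then show ?thesis using Rf[OF R] R by (auto simp: W_def R_def)
    next
      case False
      then have "x \<in> G" using inG[of x y] Rtouch[OF R] Rval[OF R] R by (auto simp: R_def)
      then show ?thesis by (simp add: W_def)
    qed

    \<comment> \<open>Every slope in the unit ball has a contact point\<close>
    have Ex: "\<exists>x. R x y" if y: "y \<in> cball 0 1" for y
    proof -
      define w where "w z = u z - (P + y) \<bullet> z - S * gauss k z" for z
      have "continuous_on (cball 0 3) w"
        unfolding w_def by (intro continuous_intros uc continuous_on_gauss)
      moreover have "compact (cball (0::'a) 3)" "x1 \<in> cball 0 3" using x1 by auto
      ultimately obtain x where x: "x \<in> cball 0 3" and xmin: "\<And>z. z \<in> cball 0 3 \<Longrightarrow> w x \<le> w z"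
        using continuous_attains_inf[of "cball 0 3" w] by blast
      have "norm x \<noteq> 3"
      proof
        assume x3: "norm x = 3"
        have "gauss k x = g3" by (simp add: gauss_def g3_def x3)
        moreover have "exp (- (k * 4)) \<le> gauss k x1"
        proof -
          have "(norm x1)\<^sup>2 \<le> 2\<^sup>2" using x1 by (intro power_mono) auto
          then show ?thesis using k16 by (simp add: gauss_def)
        qed
        ultimately have "S * d \<le> S * (gauss k x1 - gauss k x)"
          using S0 by (intro mult_left_mono) (auto simp: d_def)
        then have "C1 + 6 \<le> S * gauss k x1 - S * gauss k x" using Sd by (simp add: algebra_simps)
        moreover have "u x1 + P \<bullet> (x - x1) - C1 \<le> u x" using low x by blast
        moreover have "w x \<le> w x1" using xmin[of x1] x1 by simp
        moreover have "\<bar>y \<bullet> (x1 - x)\<bar> \<le> 5"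
        proof -
          have "\<bar>y \<bullet> (x1 - x)\<bar> \<le> norm y * norm (x1 - x)" by (rule Cauchy_Schwarz_ineq2)
          also have "\<dots> \<le> 1 * 5"
            using y x1 x3 norm_triangle_ineq4[of x1 x] by (intro mult_mono) auto
          finally show ?thesis by simp
        qed
        ultimately show False unfolding w_def by (simp add: inner_add_left inner_diff_right)
      qed
      then have "R x y"
        using x xmin y unfolding R_def w_def by (auto simp: algebra_simps)
      then show ?thesis by blast
    qed

    \<comment> \<open>Lipschitz dependence of the slope on the contact point\<close>
    have lip: "\<exists>\<delta>>0. \<forall>\<rho> x' y'. 0 < \<rho> \<longrightarrow> \<rho> < \<delta> \<longrightarrow> R x' y' \<longrightarrow> dist x' x \<le> \<rho> \<longrightarrow>
        dist y' y \<le> L * (1 + f x) * \<rho>" if R: "R x y" for x y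
    proof -
      have x3: "norm x < 3" "x \<in> ball 0 3" using R by (auto simp: R_def)
      define p where "p = P + y - (2 * k * S * gauss k x) *\<^sub>R x"
      have p1: "1 \<le> norm p" using Rgrad[OF R] by (simp add: p_def)
      have fx: "0 \<le> f x" using f0 x3 by blast
      define F where "F = 1 + f x"
      define E where "E = b + F / pow_gamma (norm p / 2) g"
      have Gp: "G0 \<le> pow_gamma (norm p / 2) g" unfolding G0_def using p1 g by (intro pow_gamma_mono) auto
      have E0: "0 \<le> E" using b0 fx pow_gamma_nonneg[of "norm p / 2" g] by (simp add: E_def F_def)
      have EL: "C * E \<le> L * (1 + f x)"
      proof -
        have "F / pow_gamma (norm p / 2) g \<le> F / G0"
          using Gp G0 fx by (intro divide_left_mono) (auto simp: F_def)
        then have "E \<le> b * 1 + (1 + f x) / G0" unfolding E_def F_def by simp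
        also have "\<dots> \<le> b * (1 + f x) + (1 + f x) * (2 / G0)"
          using b0 fx G0 by (intro add_mono mult_left_mono) (auto simp: field_simps)
        also have "\<dots> = (b + 2 / G0) * (1 + f x)" by (simp add: algebra_simps)
        finally show ?thesis using C unfolding L_def by (simp add: mult.assoc)
      qed
      have "isCont f x" using fc x3 by (auto simp: continuous_on_eq_continuous_at)
      then obtain r2 where r2: "0 < r2" "\<And>z. dist z x < r2 \<Longrightarrow> dist (f z) (f x) < 1"
        unfolding continuous_at_eps_delta by (metis zero_less_one)
      \<comment> \<open>The first two bounds keep \<open>cball x (N * \<rho>)\<close> inside the
        domain and \<open>f <= f x + 1\<close> on it; the third gives the curvature condition of
        \<open>crease\<close>; the last makes \<open>C * \<rho> * E\<close> smaller than
        \<open>norm p / C\<close>, so that the minimum is \<open>s\<close>.\<close>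
      define \<delta> where "\<delta> = min (min ((3 - norm x) / N) (r2 / N)) (min (1 / (C * (b + 1))) (1 / (C * C * (E + 1))))"
      have d0: "0 < \<delta>" using x3 N C r2 b0 E0 by (simp add: \<delta>_def)
      show ?thesis
      proof (intro exI[of _ \<delta>] conjI d0 allI impI)
        fix \<rho> x' y' assume rho: "0 < \<rho>" "\<rho> < \<delta>" and R': "R x' y'" and xx: "dist x' x \<le> \<rho>"
        have "\<rho> < (3 - norm x) / N" "\<rho> < r2 / N" "\<rho> < 1 / (C * (b + 1))" "\<rho> < 1 / (C * C * (E + 1))"
          using rho by (auto simp: \<delta>_def)
        then have r: "N * \<rho> < 3 - norm x" "N * \<rho> < r2" "\<rho> * (C * (b + 1)) < 1" "\<rho> * (C * C * (E + 1)) < 1"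
          using N C b0 E0 by (simp_all add: pos_less_divide_eq mult.commute)
        have sub: "cball x (N * \<rho>) \<subseteq> ball 0 3"
        proof
          fix z assume "z \<in> cball x (N * \<rho>)"
          then have "norm (z - x) \<le> N * \<rho>" by (simp add: dist_norm norm_minus_commute)
          then show "z \<in> ball 0 3" using r norm_triangle_sub[of z x] by simp
        qed
        then have sub': "cball x (N * \<rho>) \<subseteq> cball 0 3" by auto
        show "dist y' y \<le> L * (1 + f x) * \<rho>"
        proof (cases "y' = y")
          case False
          define s where "s = norm (y' - y)"
          have s0: "0 < s" using False by (simp add: s_def)
          define e where "e = (y' - y) /\<^sub>R s"
          have en: "norm e = 1" using s0 by (simp add: e_def s_def)
          have se: "s *\<^sub>R e = y' - y" using s0 by (simp add: e_def)
          have "min s (norm p / C) \<le> C * \<rho> * (b + F / pow_gamma (norm p / 2) g)"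
          proof (rule crease[OF sup sub])
            show "continuous_on (cball x (N * \<rho>)) u" using uc sub' continuous_on_subset by blast
            show "C * b * \<rho> \<le> norm p"
            proof -
              have "\<rho> * (C * b) \<le> \<rho> * (C * (b + 1))" using rho C by (intro mult_left_mono) auto
              then show ?thesis using r(3) p1 by (simp add: mult_ac)
            qed
            fix z assume z: "z \<in> cball x (N * \<rho>)"
            then have z3: "z \<in> cball 0 3" using sub' by blast
            have "dist z x < r2" using z r by (simp add: dist_commute)
            then show "f z \<le> F" using r2(2)[of z] by (simp add: dist_real_def F_def)
            show t1: "u x + p \<bullet> (z - x) - b / 2 * (norm (z - x))\<^sup>2 \<le> u z"
              using Rtouch[OF R z3] by (simp add: p_def b_def)
            have x'3: "x' \<in> cball 0 3" using R' by (simp add: R_def)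
            \<comment> \<open>Since \<open>u x'\<close> lies above the function touching at
              \<open>x\<close>, the one touching at \<open>x'\<close> exceeds the former at
              \<open>z\<close> by at least \<open>(y' - y) \<bullet> (z - x')\<close>. Recentring
              this at \<open>x\<close> costs \<open>s * \<rho>\<close>, within the
              \<open>2 * s * \<rho>\<close> that the crease allows.\<close>
            have a1: "u x' + (P + y') \<bullet> (z - x') + S * (gauss k z - gauss k x') \<le> u z"
              using R' z3 by (simp add: R_def)
            have a2: "u x + (P + y) \<bullet> (x' - x) + S * (gauss k x' - gauss k x) \<le> u x'"
              using R x'3 by (simp add: R_def)
            have a3: "S * (gauss k x * (1 - 2 * k * (x \<bullet> (z - x)) - k * (norm (z - x))\<^sup>2)) \<le> S * gauss k z"
              using gauss_ge_linear[of k x "z - x"] k16 S0 by simp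
            have a4: "gauss k x * (S * k * (norm (z - x))\<^sup>2) \<le> 1 * (S * k * (norm (z - x))\<^sup>2)"
              using gauss_bounds[of k x] S0 k16 by (intro mult_right_mono) auto
            have a5: "(y' - y) \<bullet> (z - x') \<ge> s * (e \<bullet> (z - x) - \<rho>)"
            proof -
              have "e \<bullet> (x' - x) \<le> norm e * norm (x' - x)" by (rule norm_cauchy_schwarz)
              then have "e \<bullet> (z - x) - \<rho> \<le> e \<bullet> (z - x')"
                using xx en by (simp add: dist_norm inner_diff_right)
              then have "s * (e \<bullet> (z - x) - \<rho>) \<le> s * (e \<bullet> (z - x'))" using s0 by simp
              then show ?thesis unfolding se[symmetric] by simp
            qed
            have a6: "s * (e \<bullet> (z - x) - 2 * \<rho>) \<le> s * (e \<bullet> (z - x) - \<rho>)"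
              using s0 rho by simp
            have a7: "(P + y') \<bullet> (z - x') + (P + y) \<bullet> (x' - x) = (P + y) \<bullet> (z - x) + (y' - y) \<bullet> (z - x')"
              by (simp add: algebra_simps inner_diff_left inner_diff_right inner_add_left)
            have a8: "p \<bullet> (z - x) = (P + y) \<bullet> (z - x) - S * gauss k x * (2 * k * (x \<bullet> (z - x)))"
              by (simp add: p_def inner_diff_left)
            have a9: "S * (gauss k x * (1 - 2 * k * (x \<bullet> (z - x)) - k * (norm (z - x))\<^sup>2))
              = S * gauss k x - S * gauss k x * (2 * k * (x \<bullet> (z - x))) - gauss k x * (S * k * (norm (z - x))\<^sup>2)"
              by (simp add: algebra_simps)
            have a10: "b / 2 * (norm (z - x))\<^sup>2 = S * k * (norm (z - x))\<^sup>2" by (simp add: b_def)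
            have a11: "S * (gauss k z - gauss k x') + S * (gauss k x' - gauss k x) = S * gauss k z - S * gauss k x"
              by (simp add: algebra_simps)
            show "u x + p \<bullet> (z - x) - b / 2 * (norm (z - x))\<^sup>2 + s * (e \<bullet> (z - x) - 2 * \<rho>) \<le> u z"
              unfolding a8 a10 using a1 a2 a3[unfolded a9] a4 a5 a6 a7 a11 by linarith
          qed (use rho b0 s0 en fx in \<open>auto simp: F_def\<close>)
          then have m: "min s (norm p / C) \<le> C * \<rho> * E" by (simp add: E_def)
          have "C * \<rho> * E < 1 / C"
          proof -
            have "\<rho> * (C * C * E) \<le> \<rho> * (C * C * (E + 1))" using rho C by (intro mult_left_mono) auto
            then have "(C * \<rho> * E) * C < 1" using r(4) by (simp add: mult_ac)
            then show ?thesis using C by (simp add: pos_less_divide_eq)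
          qed
          also have "1 / C \<le> norm p / C" using p1 C by (simp add: divide_right_mono)
          finally have "s \<le> C * \<rho> * E" using m by linarith
          also have "\<dots> = C * E * \<rho>" by simp
          also have "\<dots> \<le> L * (1 + f x) * \<rho>" using EL rho by (intro mult_right_mono) auto
          finally show ?thesis by (simp add: s_def dist_norm)
        qed (use rho fx L0 in auto)
      qed
    qed

    \<comment> \<open>Measure of the set of contact points\<close>
    let ?I = "\<integral>\<^sup>+x\<in>ball 0 3. ennreal (f x ^ ?n) \<partial>lebesgue"
    note lev = emeasure_level_le_nn_integral(1)[OF open_ball fc] emeasure_level_le_nn_integral(2)[OF open_ball fc, of ?n]
    have "emeasure lebesgue (cball (0::'a) 1) \<le> ennreal ((20 * L) ^ ?n) * (emeasure lebesgue W + ?I)"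
    proof (rule emeasure_lipschitz_relation_le[where R=R])
      show "W \<in> sets lebesgue" using G lev by (simp add: W_def)
      show "W \<subseteq> ball 0 3" using G by (auto simp: W_def)
    qed (use fc f0 L0 lip RW Ex in auto)
    also have "emeasure lebesgue W \<le> emeasure lebesgue G + ?I"
    proof -
      have "emeasure lebesgue W \<le> emeasure lebesgue G + emeasure lebesgue {x \<in> ball 0 3. 1 \<le> f x}"
        unfolding W_def using G lev by (intro emeasure_subadditive) auto
      then show ?thesis using lev(2) by (meson add_left_mono order_trans)
    qed
    also have "emeasure lebesgue G + ?I + ?I \<le> 2 * (emeasure lebesgue G + ?I)"
      unfolding mult_2 by (simp add: add.assoc add_left_mono add_increasing)
    finally have *: "emeasure lebesgue (cball (0::'a) 1) \<le> ennreal ((20 * L) ^ ?n) * (2 * (emeasure lebesgue G + ?I))"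
      by (simp add: add_right_mono mult_left_mono)
    have "ennreal \<omega> = ennreal (2 * (20 * L) ^ ?n) * ennreal c"
      using om L0 by (simp add: c_def ennreal_mult'[symmetric])
    moreover have "emeasure lebesgue (cball (0::'a) 1) = ennreal \<omega>"
      by (subst emeasure_lebesgue_cball) (auto simp: \<omega>_def)
    moreover have "ennreal ((20 * L) ^ ?n) * (2 * X) = ennreal (2 * (20 * L) ^ ?n) * X" for X
      using L0 by (simp add: ennreal_mult' mult_ac)
    ultimately have "ennreal (2 * (20 * L) ^ ?n) * ennreal c \<le> ennreal (2 * (20 * L) ^ ?n) * (emeasure lebesgue G + ?I)"
      using * by metis
    then show "ennreal c \<le> emeasure lebesgue G + ?I"
      using L0 by (subst (asm) ennreal_mult_le_mult_iff) auto
  qed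
qed

section \<open>Sliding cusps\<close>

text \<open>Bernoulli's inequality \<open>x powr a <= 1 + a * (x - 1)\<close> for
  \<open>x = t / s\<close>, obtained from convexity of \<open>exp\<close> between 0 and
  \<open>ln x\<close>.\<close>

lemma powr_le_tangent:
  fixes s t a :: real
  assumes s: "0 < s" and t: "0 \<le> t" and a: "0 < a" "a \<le> 1"
  shows "t powr a \<le> s powr a + a * s powr (a - 1) * (t - s)"
proof (cases "t = 0")
  case True
  have "s powr (a - 1) * s = s powr a" using s by (simp add: powr_diff)
  then show ?thesis using True a by (simp add: algebra_simps mult_left_le_one_le)
next
  case False
  define x where "x = t / s"
  have x: "0 < x" using s t False by (simp add: x_def)
  have "exp ((1 - a) *\<^sub>R 0 + a *\<^sub>R ln x) \<le> (1 - a) * exp 0 + a * exp (ln x)"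
    using a by (intro convex_onD[OF exp_convex]) auto
  then have "x powr a \<le> 1 + a * (x - 1)"
    using x by (simp add: powr_def algebra_simps)
  then have "s powr a * x powr a \<le> s powr a * (1 + a * (x - 1))"
    by (intro mult_left_mono) auto
  moreover have "s powr a * x powr a = t powr a"
    using s t by (simp add: x_def powr_divide)
  moreover have "s powr a * (1 + a * (x - 1)) = s powr a + a * s powr (a - 1) * (t - s)"
    using s by (simp add: x_def powr_diff field_simps)
  ultimately show ?thesis by simp
qed

text \<open>The concave tangent inequality with exponent \<open>1 / p\<close> at
  \<open>s powr p\<close> and \<open>t powr p\<close>, solved for \<open>t powr p\<close>.\<close>

lemma powr_ge_tangent:
  fixes s t p :: real
  assumes s: "0 < s" and t: "0 \<le> t" and p: "1 \<le> p"
  shows "s powr p + p * s powr (p - 1) * (t - s) \<le> t powr p"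
proof -
  have "(t powr p) powr (1/p) \<le> (s powr p) powr (1/p) + 1/p * (s powr p) powr (1/p - 1) * (t powr p - s powr p)"
    using s t p by (intro powr_le_tangent) auto
  moreover have "(s powr p) powr (1/p - 1) = s powr (1 - p)" using p by (simp add: powr_powr algebra_simps)
  ultimately have "t - s \<le> 1/p * s powr (1 - p) * (t powr p - s powr p)"
    using s t p by (simp add: powr_powr)
  then have "(p * s powr (p - 1)) * (t - s) \<le> (p * s powr (p - 1)) * (1/p * s powr (1 - p) * (t powr p - s powr p))"
    using s p by (intro mult_left_mono) auto
  also have "\<dots> = (s powr (p - 1) * s powr (1 - p)) * (t powr p - s powr p)" using p by simp
  also have "s powr (p - 1) * s powr (1 - p) = 1" using s by (simp add: powr_add[symmetric])
  finally show ?thesis by simp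
qed

text \<open>Up to the factor \<open>1 + a\<close>, the gradient of \<open>norm v powr (1 + a)\<close>.\<close>
definition vpow :: "real \<Rightarrow> 'a::real_inner \<Rightarrow> 'a" where
  "vpow a v = (norm v powr (a - 1)) *\<^sub>R v"

lemma norm_vpow: "norm (vpow a v) = norm v powr a"
  by (cases "v = 0") (auto simp: vpow_def powr_diff)

text \<open>\<open>norm w powr (1 + a)\<close> is a concave power of
  \<open>(norm w)\<^sup>2\<close>, and the latter is an exact quadratic in \<open>h\<close>. The
  tangent line of the power thus gives a paraboloid above the cusp for all \<open>h\<close>, with no
  remainder.\<close>

lemma norm_powr_le_quadratic:
  fixes v h :: "'a::real_inner"
  assumes v: "v \<noteq> 0" and a: "0 < a" "a \<le> 1"
  shows "norm (v + h) powr (1 + a) \<le> norm v powr (1 + a) + (1 + a) * (vpow a v \<bullet> h)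
    + (1 + a) / 2 * norm v powr (a - 1) * (norm h)\<^sup>2"
proof -
  have sq: "(norm w)\<^sup>2 powr ((1 + a) / 2) = norm w powr (1 + a)" for w :: 'a
  proof (cases "w = 0")
    case False
    have "(norm w)\<^sup>2 powr ((1 + a) / 2) = (norm w powr 2) powr ((1 + a) / 2)" using False by simp
    also have "\<dots> = norm w powr (2 * ((1 + a) / 2))" by (rule powr_powr)
    also have "2 * ((1 + a) / 2) = 1 + a" by (simp add: field_simps)
    finally show ?thesis .
  qed simp
  have sq2: "(norm v)\<^sup>2 powr ((1 + a) / 2 - 1) = norm v powr (a - 1)"
  proof -
    have "(norm v)\<^sup>2 powr ((1 + a) / 2 - 1) = (norm v powr 2) powr ((1 + a) / 2 - 1)" using v by simp
    also have "\<dots> = norm v powr (2 * ((1 + a) / 2 - 1))" by (rule powr_powr)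
    also have "2 * ((1 + a) / 2 - 1) = a - 1" by (simp add: field_simps)
    finally show ?thesis .
  qed
  have e: "(norm (v + h))\<^sup>2 - (norm v)\<^sup>2 = 2 * (v \<bullet> h) + (norm h)\<^sup>2"
    by (simp add: power2_norm_eq_inner inner_commute algebra_simps)
  have "(norm (v + h))\<^sup>2 powr ((1 + a) / 2) \<le> (norm v)\<^sup>2 powr ((1 + a) / 2)
     + (1 + a) / 2 * (norm v)\<^sup>2 powr ((1 + a) / 2 - 1) * ((norm (v + h))\<^sup>2 - (norm v)\<^sup>2)"
    using v a by (intro powr_le_tangent) auto
  then show ?thesis unfolding sq sq2 e by (simp add: vpow_def algebra_simps add_divide_distrib)
qed

lemma norm_powr_ge_tangent:
  fixes v h :: "'a::real_inner"
  assumes a: "0 < a"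
  shows "norm v powr (1 + a) + (1 + a) * (vpow a v \<bullet> h) \<le> norm (v + h) powr (1 + a)"
proof (cases "v = 0")
  case False
  have "norm v * norm v + v \<bullet> h = v \<bullet> (v + h)"
    by (simp add: inner_add_right dot_square_norm power2_eq_square)
  also have "\<dots> \<le> norm v * norm (v + h)" by (rule norm_cauchy_schwarz)
  finally have "v \<bullet> h \<le> norm v * (norm (v + h) - norm v)" by (simp add: algebra_simps)
  then have "(1 + a) * norm v powr (a - 1) * (v \<bullet> h) \<le> (1 + a) * norm v powr (a - 1) * (norm v * (norm (v + h) - norm v))"
    using a by (intro mult_left_mono) auto
  also have "\<dots> = (1 + a) * norm v powr (1 + a - 1) * (norm (v + h) - norm v)"
    using False by (simp add: powr_diff)
  also have "\<dots> \<le> norm (v + h) powr (1 + a) - norm v powr (1 + a)"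
    using powr_ge_tangent[of "norm v" "norm (v + h)" "1 + a"] False a by simp
  finally show ?thesis by (simp add: vpow_def)
qed (use a in \<open>simp add: vpow_def\<close>)

text \<open>Here the constant is independent of \<open>v\<close>, so the bound survives at the
  vertex. For \<open>norm h <= norm v\<close> it follows from the quadratic bound because
  \<open>a - 1 <= 0\<close>; otherwise every term is controlled by
  \<open>norm h powr (1 + a)\<close>, and 6 is 4 for the left side plus 2 for the gradient
  term.\<close>

lemma norm_powr_le_holder:
  fixes v h :: "'a::real_inner"
  assumes a: "0 < a" "a \<le> 1"
  shows "norm (v + h) powr (1 + a) \<le> norm v powr (1 + a) + (1 + a) * (vpow a v \<bullet> h) + 6 * norm h powr (1 + a)"
proof (cases "h = 0")
  case False
  show ?thesis
  proof (cases "norm h \<le> norm v")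
    case True
    then have v: "v \<noteq> 0" using False by auto
    have "norm v powr (a - 1) * (norm h)\<^sup>2 \<le> norm h powr (a - 1) * (norm h)\<^sup>2"
      using True False a by (intro mult_right_mono powr_mono2') auto
    also have "\<dots> = norm h powr (1 + a)"
    proof -
      have "norm h powr (1 + a) = norm h powr ((a - 1) + 2)" by (simp add: add.commute)
      also have "\<dots> = norm h powr (a - 1) * norm h powr 2" by (rule powr_add)
      finally show ?thesis using False by simp
    qed
    finally have 1: "norm v powr (a - 1) * (norm h)\<^sup>2 \<le> norm h powr (1 + a)" .
    have "(1 + a) / 2 * (norm v powr (a - 1) * (norm h)\<^sup>2) \<le> 6 * norm h powr (1 + a)"
      using 1 a by (intro mult_mono) auto
    then show ?thesis using norm_powr_le_quadratic[OF v a, of h] by (simp add: mult.assoc)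
  next
    case False
    have "norm (v + h) powr (1 + a) \<le> (2 * norm h) powr (1 + a)"
      using False a norm_triangle_ineq[of v h] by (intro powr_mono2) auto
    also have "\<dots> = 2 powr (1 + a) * norm h powr (1 + a)" by (simp add: powr_mult)
    also have "\<dots> \<le> 2 powr 2 * norm h powr (1 + a)" using a by (intro mult_right_mono powr_mono) auto
    finally have 1: "norm (v + h) powr (1 + a) \<le> 4 * norm h powr (1 + a)" by simp
    have "\<bar>vpow a v \<bullet> h\<bar> \<le> norm v powr a * norm h"
      using Cauchy_Schwarz_ineq2[of "vpow a v" h] by (simp add: norm_vpow)
    also have "\<dots> \<le> norm h powr a * norm h" using False a by (intro mult_right_mono powr_mono2) auto
    also have "\<dots> = norm h powr (1 + a)" by (simp add: powr_add)
    finally have "(1 + a) * \<bar>vpow a v \<bullet> h\<bar> \<le> 2 * norm h powr (1 + a)" using a by (intro mult_mono) auto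
    then have "- (2 * norm h powr (1 + a)) \<le> (1 + a) * (vpow a v \<bullet> h)"
      using a abs_mult[of "1 + a" "vpow a v \<bullet> h"] by linarith
    then show ?thesis using 1 powr_ge_zero[of "norm v" "1 + a"] by linarith
  qed
qed (use a in \<open>simp add: vpow_def\<close>)

text \<open>Inverts \<open>vpow\<close> through
  \<open>v = (norm v powr (1 - a)) *\<^sub>R vpow a v\<close>. The difference splits into a part
  with a common factor and a radial part, which the concave tangent inequality controls. The factor
  \<open>norm v powr (1 - a)\<close> is the degeneration that the weight \<open>|D psi|^g\<close>
  has to compensate.\<close>

lemma norm_diff_le_vpow_aux:
  fixes v w :: "'a::real_inner"
  assumes a: "0 < a" "a \<le> 1" and v: "v \<noteq> 0" and wv: "norm w \<le> norm v"
  shows "norm (v - w) \<le> (1 + 1 / a) * norm v powr (1 - a) * norm (vpow a v - vpow a w)"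
proof -
  define A where "A = norm v powr (1 - a)"
  define B where "B = norm w powr (1 - a)"
  define E where "E = norm (vpow a v - vpow a w)"
  have inv: "x = (norm x powr (1 - a)) *\<^sub>R vpow a x" for x :: 'a
  proof (cases "x = 0")
    case False
    have "norm x powr (1 - a) * norm x powr (a - 1) = 1" using False by (simp flip: powr_add)
    then show ?thesis by (simp add: vpow_def)
  qed (simp add: vpow_def)
  have AB: "B \<le> A" unfolding A_def B_def using wv a by (intro powr_mono2) auto
  have A0: "0 \<le> A" by (simp add: A_def)
  have "v - w = A *\<^sub>R (vpow a v - vpow a w) + (A - B) *\<^sub>R vpow a w"
    using inv[of v] inv[of w] by (simp add: A_def B_def algebra_simps)
  then have "norm (v - w) \<le> A * E + (A - B) * norm w powr a"
    using norm_triangle_ineq[of "A *\<^sub>R (vpow a v - vpow a w)" "(A - B) *\<^sub>R vpow a w"] AB A0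
    by (simp add: norm_vpow E_def)
  moreover have "(A - B) * norm w powr a \<le> norm v - norm w"
  proof -
    have "A * norm w powr a \<le> A * norm v powr a" using wv a A0 by (intro mult_left_mono powr_mono2) auto
    moreover have "A * norm v powr a = norm v" using v by (simp add: A_def flip: powr_add)
    moreover have "B * norm w powr a = norm w" by (cases "w = 0") (simp_all add: B_def flip: powr_add)
    ultimately show ?thesis by (simp add: left_diff_distrib)
  qed
  moreover have "norm v - norm w \<le> 1 / a * A * E"
  proof -
    have "norm w powr a \<le> norm v powr a + a * norm v powr (a - 1) * (norm w - norm v)"
      using v a by (intro powr_le_tangent) auto
    then have "a * norm v powr (a - 1) * (norm v - norm w) \<le> norm v powr a - norm w powr a"
      by (simp add: algebra_simps)
    also have "\<dots> \<le> E" using norm_triangle_ineq2[of "vpow a v" "vpow a w"] by (simp add: E_def norm_vpow)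
    finally have "(1 / a * A) * (a * norm v powr (a - 1) * (norm v - norm w)) \<le> (1 / a * A) * E"
      using a A0 by (intro mult_left_mono) auto
    moreover have "(1 / a * A) * (a * norm v powr (a - 1) * (norm v - norm w)) = (A * norm v powr (a - 1)) * (norm v - norm w)"
      using a by simp
    moreover have "A * norm v powr (a - 1) = 1" using v by (simp add: A_def flip: powr_add)
    ultimately show ?thesis by simp
  qed
  ultimately have "norm (v - w) \<le> A * E + 1 / a * A * E" by linarith
  then show ?thesis by (simp add: A_def E_def algebra_simps)
qed

text \<open>Exchanging the roles of \<open>v\<close> and \<open>w\<close> removes the ordering of
  their norms; comparability of the norms limits the cost to a factor 2.\<close>

lemma norm_diff_le_vpow:
  fixes v w :: "'a::real_inner"
  assumes a: "0 < a" "a \<le> 1" and v: "v \<noteq> 0" and wv: "norm w \<le> 2 * norm v"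
  shows "norm (v - w) \<le> 2 * (1 + 1 / a) * norm v powr (1 - a) * norm (vpow a v - vpow a w)"
proof (cases "norm w \<le> norm v")
  case True
  have "1 * ((1 + 1 / a) * norm v powr (1 - a) * norm (vpow a v - vpow a w)) \<le>
     2 * ((1 + 1 / a) * norm v powr (1 - a) * norm (vpow a v - vpow a w))"
    using a by (intro mult_right_mono) auto
  then show ?thesis using norm_diff_le_vpow_aux[OF a v True] by linarith
next
  case False
  then have w: "w \<noteq> 0" by auto
  have "norm w powr (1 - a) \<le> (2 * norm v) powr (1 - a)" using wv a by (intro powr_mono2) auto
  also have "\<dots> = 2 powr (1 - a) * norm v powr (1 - a)" by (simp add: powr_mult)
  also have "\<dots> \<le> 2 powr 1 * norm v powr (1 - a)" using a by (intro mult_right_mono powr_mono) auto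
  finally have "norm w powr (1 - a) \<le> 2 * norm v powr (1 - a)" by simp
  then have "((1 + 1 / a) * norm (vpow a v - vpow a w)) * norm w powr (1 - a) \<le>
    ((1 + 1 / a) * norm (vpow a v - vpow a w)) * (2 * norm v powr (1 - a))"
    using a by (intro mult_left_mono) auto
  moreover have "norm (w - v) \<le> (1 + 1 / a) * norm w powr (1 - a) * norm (vpow a w - vpow a v)"
    using False by (intro norm_diff_le_vpow_aux[OF a w]) auto
  ultimately have "norm (w - v) \<le> ((1 + 1 / a) * norm (vpow a v - vpow a w)) * (2 * norm v powr (1 - a))"
    by (simp only: norm_minus_commute[of "vpow a w"] mult_ac)
  then show ?thesis by (simp only: norm_minus_commute[of v] mult_ac)
qed

text \<open>When the lengths differ by more than a factor 2, the lengths of the gradients alone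
  differ by a fixed fraction of \<open>norm v powr a\<close>. The constant for short
  \<open>w\<close> also serves for long \<open>w\<close>, because
  \<open>2 powr a - 1 >= 1 - 2 powr (- a)\<close>.\<close>

lemma norm_vpow_diff_ge:
  fixes v w :: "'a::real_inner"
  assumes a: "0 < a" and far: "norm w < norm v / 2 \<or> 2 * norm v < norm w"
  shows "(1 - 2 powr (- a)) * norm v powr a \<le> norm (vpow a v - vpow a w)"
  using far
proof
  assume "norm w < norm v / 2"
  then have "norm w powr a \<le> (norm v / 2) powr a" using a by (intro powr_mono2) auto
  also have "\<dots> = 2 powr (- a) * norm v powr a" by (simp add: powr_divide powr_minus field_simps)
  finally show ?thesis using norm_triangle_ineq2[of "vpow a v" "vpow a w"]
    by (simp add: norm_vpow left_diff_distrib)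
next
  assume w: "2 * norm v < norm w"
  then have "(2 * norm v) powr a \<le> norm w powr a" using a by (intro powr_mono2) auto
  then have 1: "2 powr a * norm v powr a \<le> norm w powr a" by (simp add: powr_mult)
  have "1 \<le> (2 powr a) * 1" using a ge_one_powr_ge_zero[of 2 a] by simp
  then have t: "1 \<le> (2::real) powr a" by simp
  have "1 - 2 powr (- a) \<le> 2 powr a - 1"
  proof -
    have "0 \<le> (2 powr a - 1)\<^sup>2 / 2 powr a" by simp
    also have "\<dots> = 2 powr a - 2 + 2 powr (- a)"
      using powr_gt_zero[of 2 a] by (simp add: powr_minus power2_eq_square field_simps)
    finally show ?thesis by simp
  qed
  then have "(1 - 2 powr (- a)) * norm v powr a \<le> (2 powr a - 1) * norm v powr a"
    by (intro mult_right_mono) auto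
  also have "\<dots> \<le> norm w powr a - norm v powr a" using 1 by (simp add: algebra_simps)
  finally show ?thesis using norm_triangle_ineq2[of "vpow a w" "vpow a v"]
    by (simp add: norm_vpow norm_minus_commute)
qed

text \<open>Sliding \<open>- A * norm (z - y) powr (1 + a)\<close> over vertices \<open>y\<close>. For \<open>a = 1 / (1 + g)\<close> the quantity
  \<open>|D\<psi>|\<^sup>g |D\<^sup>2\<psi>|\<close> is scale invariant on this family, so that the map from contact points to
  vertices is locally Lipschitz although the gradient degenerates at the vertex.\<close>
lemma vertex_estimate:
  fixes C1 C2 lam bet g a :: real
  assumes lam: "0 < lam" and bet: "0 \<le> bet" and g: "0 \<le> g" and a_def: "a = 1 / (1 + g)"
    and C1: "0 \<le> C1" and C2: "0 \<le> C2"
  obtains A c :: real where "1 \<le> A" "0 < c"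
    "\<And>(u::'a::euclidean_space \<Rightarrow> real) f m0 z0 G.
      continuous_on (cball 0 3) u \<Longrightarrow> continuous_on (ball 0 3) f \<Longrightarrow> (\<And>x. x \<in> ball 0 3 \<Longrightarrow> 0 \<le> f x) \<Longrightarrow>
      supersol lam bet g (ball 0 3) u f \<Longrightarrow> norm z0 < 1/2 \<Longrightarrow> u z0 \<le> m0 + C2 \<Longrightarrow>
      (\<And>z. z \<in> cball 0 3 \<Longrightarrow> m0 - C1 \<le> u z) \<Longrightarrow>
      G \<in> sets lebesgue \<Longrightarrow> G \<subseteq> ball 0 3 \<Longrightarrow>
      (\<And>x q. x \<in> ball 0 1 \<Longrightarrow> norm q \<le> 2 * A \<Longrightarrow>
        (\<And>z. z \<in> cball 0 3 \<Longrightarrow> u x + q \<bullet> (z - x) - 6 * A * norm (z - x) powr (1 + a) \<le> u z) \<Longrightarrow>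
        u x \<le> m0 + C2 + A \<Longrightarrow> x \<in> G) \<Longrightarrow>
      ennreal c \<le> emeasure lebesgue G + (\<integral>\<^sup>+x\<in>ball 0 3. ennreal (f x ^ DIM('a)) \<partial>lebesgue)"
proof -
  obtain N C where N: "1 \<le> N" and C: "1 \<le> C" and crease:
    "\<And>(u::'a \<Rightarrow> real) f D x p b S e \<rho> F.
      supersol lam bet g D u f \<Longrightarrow> cball x (N * \<rho>) \<subseteq> D \<Longrightarrow>
      continuous_on (cball x (N * \<rho>)) u \<Longrightarrow>
      (\<And>z. z \<in> cball x (N * \<rho>) \<Longrightarrow> f z \<le> F) \<Longrightarrow>
      0 \<le> F \<Longrightarrow> 0 < \<rho> \<Longrightarrow> 0 \<le> b \<Longrightarrow> 0 \<le> S \<Longrightarrow> norm e = 1 \<Longrightarrow> C * b * \<rho> \<le> norm p \<Longrightarrow>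
      (\<And>z. z \<in> cball x (N * \<rho>) \<Longrightarrow> u x + p \<bullet> (z - x) - b / 2 * (norm (z - x))\<^sup>2 \<le> u z) \<Longrightarrow>
      (\<And>z. z \<in> cball x (N * \<rho>) \<Longrightarrow>
        u x + p \<bullet> (z - x) - b / 2 * (norm (z - x))\<^sup>2 + S * (e \<bullet> (z - x) - 2 * \<rho>) \<le> u z) \<Longrightarrow>
      min S (norm p / C) \<le> C * \<rho> * (b + F / pow_gamma (norm p / 2) g)"
    using crease_estimate[OF lam bet g, where 'a='a] by blast
  have a: "0 < a" "a \<le> 1" using g by (auto simp: a_def)
  have ag: "a * g = 1 - a" using g by (simp add: a_def field_simps)
  \<comment> \<open>\<open>A / 64\<close> exceeds \<open>C1 + C2\<close>, and 1/64 is a lower bound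
    for \<open>(1/8) powr (1 + a)\<close>: a vertex within 1/8 of \<open>z0\<close> then has its
    contact point within 1/4 of itself.\<close>
  define A where "A = 64 * (C1 + C2 + 1)"
  have A: "64 \<le> A" using C1 C2 by (simp add: A_def)
  \<comment> \<open>\<open>M\<close> dominates the two bounds for \<open>s\<close> in
    \<open>sM\<close>: \<open>C\<close> comes from the crease, \<open>N\<^sup>2 + 1\<close> from
    slopes too close for the crease to rise above the expansion errors.\<close>
  define M where "M = C + N\<^sup>2 + 1"
  have M: "C \<le> M" "N\<^sup>2 + 1 \<le> M" "0 < M" using C by (auto simp: M_def add_pos_nonneg)
  define L where "L = 4 * (1 + 1 / a) * M"
  have L0: "0 < L" using a M by (simp add: L_def add_pos_pos)
  let ?n = "DIM('a)"
  define \<omega> where "\<omega> = unit_ball_vol (real ?n) * (1/8) ^ ?n"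
  have om: "0 < \<omega>" by (simp add: \<omega>_def)
  define K where "K = (20 * L) ^ ?n"
  have K0: "0 \<le> K" using L0 by (simp add: K_def)
  define c where "c = \<omega> / (1 + K)"
  have c0: "0 < c" using om K0 by (simp add: c_def add_pos_nonneg)
  define \<kappa> where "\<kappa> = 1 - (2::real) powr (- a)"
  have kap: "0 < \<kappa>"
  proof -
    have "(2::real) powr (- a) < 2 powr 0" using a by (intro powr_less_mono) auto
    then show ?thesis by (simp add: \<kappa>_def)
  qed
  show ?thesis
  proof (rule that[OF _ c0])
    show "1 \<le> A" using A by simp
    fix u f :: "'a \<Rightarrow> real" and m0 z0 G
    assume uc: "continuous_on (cball 0 3) u" and fc: "continuous_on (ball 0 3) f"
      and f0: "\<And>x. x \<in> ball 0 3 \<Longrightarrow> 0 \<le> f x"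
      and sup: "supersol lam bet g (ball 0 3) u f" and z0: "norm z0 < 1/2" "u z0 \<le> m0 + C2"
      and low: "\<And>z. z \<in> cball 0 3 \<Longrightarrow> m0 - C1 \<le> u z"
      and G: "G \<in> sets lebesgue" "G \<subseteq> ball 0 3"
      and inG: "\<And>x q. x \<in> ball 0 1 \<Longrightarrow> norm q \<le> 2 * A \<Longrightarrow>
        (\<And>z. z \<in> cball 0 3 \<Longrightarrow> u x + q \<bullet> (z - x) - 6 * A * norm (z - x) powr (1 + a) \<le> u z) \<Longrightarrow>
        u x \<le> m0 + C2 + A \<Longrightarrow> x \<in> G"

    \<comment> \<open>Contact points and vertices\<close>
    define Q where "Q x y \<longleftrightarrow> norm x < 1 \<and> norm (x - y) \<le> 1 \<and> u x \<le> m0 + C2 + A \<and>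
      (\<forall>z\<in>cball 0 3. u x + A * (norm (x - y) powr (1 + a) - norm (z - y) powr (1 + a)) \<le> u z)" for x y
    \<comment> \<open>At a contact point equal to its vertex the gradient is zero and the crease
      estimate says nothing. Such a vertex is itself a contact point and so lies in
      \<open>G\<close>; only vertices outside \<open>G\<close> are counted through the Lipschitz
      relation, and these satisfy \<open>R\<close>.\<close>
    define R where "R x y \<longleftrightarrow> Q x y \<and> x \<noteq> y" for x y
    have Qx: "\<exists>x. Q x y" if y: "y \<in> cball z0 (1/8)" for y
    proof -
      define w where "w z = u z + A * norm (z - y) powr (1 + a)" for z
      have "continuous_on (cball 0 3) w" unfolding w_def using a
        by (intro continuous_intros uc continuous_on_powr') auto
      moreover have z03: "compact (cball (0::'a) 3)" "z0 \<in> cball 0 3" using z0 by auto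
      ultimately obtain x where x: "x \<in> cball 0 3" and xmin: "\<And>z. z \<in> cball 0 3 \<Longrightarrow> w x \<le> w z"
        using continuous_attains_inf[of "cball 0 3" w] by blast
      define t where "t = (1/8::real) powr (1 + a)"
      have t1: "1/64 \<le> t" "t \<le> 1"
      proof -
        have "(1/8::real) powr 2 \<le> (1/8) powr (1 + a)" using a by (intro powr_mono') auto
        then show "1/64 \<le> t" by (simp add: t_def power2_eq_square)
        show "t \<le> 1" using a powr_mono2[of "1 + a" "1/8" 1] by (simp add: t_def)
      qed
      have wz0: "w z0 \<le> m0 + C2 + A * t"
      proof -
        have "norm (z0 - y) powr (1 + a) \<le> t" unfolding t_def
          using y a by (intro powr_mono2) (auto simp: dist_norm)
        then have "A * norm (z0 - y) powr (1 + a) \<le> A * t" using A by (intro mult_left_mono) auto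
        then show ?thesis using z0 by (simp add: w_def)
      qed
      have wx: "w x \<le> m0 + C2 + A * t" using wz0 xmin[OF z03(2)] by linarith
      have xy: "norm (x - y) < 1/4"
      proof (rule ccontr)
        assume "\<not> norm (x - y) < 1/4"
        then have "(1/4) powr (1 + a) \<le> norm (x - y) powr (1 + a)" using a by (intro powr_mono2) auto
        moreover have "2 * t \<le> (1/4) powr (1 + a)"
        proof -
          have "(1/4) powr (1 + a) = (2 * (1/8)) powr (1 + a)" by simp
          also have "\<dots> = 2 powr (1 + a) * t" unfolding t_def by (rule powr_mult)
          also have "\<dots> \<ge> 2 powr 1 * t" using a t1 by (intro mult_right_mono powr_mono) auto
          finally show ?thesis by simp
        qed
        ultimately have "A * (2 * t) \<le> A * norm (x - y) powr (1 + a)" using A by (intro mult_left_mono) auto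
        then have "A * (2 * t) + (m0 - C1) \<le> m0 + C2 + A * t" using low[OF x] wx by (simp add: w_def)
        then have "A * t \<le> C1 + C2" by simp
        moreover have "A * (1/64) \<le> A * t" using A t1 by (intro mult_left_mono) auto
        ultimately show False by (simp add: A_def)
      qed
      have "norm x \<le> norm (x - y) + norm (y - z0) + norm z0"
        using norm_triangle_ineq[of "x - y" "y - z0"] norm_triangle_ineq[of "x - z0" z0] by simp
      then have x1: "norm x < 1" using xy y z0 by (simp add: dist_norm norm_minus_commute)
      have "0 \<le> A * norm (x - y) powr (1 + a)" using A by simp
      moreover have "A * t \<le> A * 1" using A t1 by (intro mult_left_mono) auto
      ultimately have "u x \<le> m0 + C2 + A" using wx unfolding w_def by linarith
      moreover have "u x + A * (norm (x - y) powr (1 + a) - norm (z - y) powr (1 + a)) \<le> u z" if "z \<in> cball 0 3" for z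
        using xmin[OF that] by (simp add: w_def algebra_simps)
      ultimately have "Q x y" using x1 xy by (auto simp: Q_def)
      then show ?thesis by blast
    qed
    \<comment> \<open>The Holder bound converts the cusp with vertex \<open>y\<close> into one
      centred at the contact point, at the cost of opening \<open>6 * A\<close>.\<close>
    have Qtouch: "u x + (- (A * (1 + a)) *\<^sub>R vpow a (x - y)) \<bullet> (z - x) - 6 * A * norm (z - x) powr (1 + a) \<le> u z"
      if "Q x y" "z \<in> cball 0 3" for x y z
    proof -
      have "norm (z - y) powr (1 + a) \<le> norm (x - y) powr (1 + a) + (1 + a) * (vpow a (x - y) \<bullet> (z - x)) + 6 * norm (z - x) powr (1 + a)"
        using norm_powr_le_holder[OF a, of "x - y" "z - x"] by simp
      then have "A * norm (z - y) powr (1 + a) \<le> A * (norm (x - y) powr (1 + a) + (1 + a) * (vpow a (x - y) \<bullet> (z - x)) + 6 * norm (z - x) powr (1 + a))"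
        using A by (intro mult_left_mono) auto
      moreover have "u x + A * (norm (x - y) powr (1 + a) - norm (z - y) powr (1 + a)) \<le> u z"
        using that by (auto simp: Q_def)
      ultimately show ?thesis by (simp add: algebra_simps)
    qed
    have QG: "x \<in> G" if Q: "Q x y" for x y
    proof (rule inG[where q="- (A * (1 + a)) *\<^sub>R vpow a (x - y)"])
      show "x \<in> ball 0 1" "u x \<le> m0 + C2 + A" using Q by (auto simp: Q_def)
      have "norm (x - y) powr a \<le> 1" using Q a powr_mono2[of a "norm (x - y)" 1] by (simp add: Q_def)
      then have "(A * (1 + a)) * norm (x - y) powr a \<le> (A * 2) * 1" using A a by (intro mult_mono) auto
      then show "norm (- (A * (1 + a)) *\<^sub>R vpow a (x - y)) \<le> 2 * A" using A a by (simp add: norm_vpow)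
    qed (rule Qtouch[OF Q])

    \<comment> \<open>Lipschitz dependence of the vertex on the contact point\<close>
    have lip: "\<exists>\<delta>>0. \<forall>\<rho> x' y'. 0 < \<rho> \<longrightarrow> \<rho> < \<delta> \<longrightarrow> R x' y' \<longrightarrow> dist x' x \<le> \<rho> \<longrightarrow>
        dist y' y \<le> L * (1 + f x) * \<rho>" if R: "R x y" for x y
    proof -
      have Qxy: "Q x y" using R by (simp add: R_def)
      define v where "v = x - y"
      have v: "v \<noteq> 0" using R by (simp add: v_def R_def)
      have x1: "norm x < 1" "x \<in> ball 0 3" using Qxy by (auto simp: Q_def)
      define p where "p = - (A * (1 + a)) *\<^sub>R vpow a v"
      define b where "b = A * (1 + a) * norm v powr (a - 1)"
      have b0: "0 \<le> b" using A a by (simp add: b_def)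
      have np: "norm p = A * (1 + a) * norm v powr a" using A a by (simp add: p_def norm_vpow)
      have p0: "0 < norm p" using np A a v by simp
      have fx: "0 \<le> f x" using f0 x1 by blast
      define F where "F = 1 + f x"
      define E where "E = b + F / pow_gamma (norm p / 2) g"
      \<comment> \<open>\<open>norm p\<close> is of order \<open>norm v powr a\<close> and
        \<open>a * g = 1 - a\<close>, so the weight in the equation is at least
        \<open>norm v powr (1 - a)\<close>, the inverse of the order of the curvature
        \<open>b\<close>.\<close>
      have Gp: "norm v powr (1 - a) \<le> pow_gamma (norm p / 2) g"
      proof -
        have 1: "norm v powr a \<le> norm p / 2"
        proof -
          have "64 * 1 \<le> A * (1 + a)" using A a by (intro mult_mono) auto
          then have "2 * norm v powr a \<le> A * (1 + a) * norm v powr a" by (intro mult_right_mono) auto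
          then show ?thesis by (simp add: np)
        qed
        have "norm v powr (1 - a) = pow_gamma (norm v powr a) g"
          using v ag by (auto simp: pow_gamma_def powr_powr)
        also have "\<dots> \<le> pow_gamma (norm p / 2) g" using g 1 by (intro pow_gamma_mono) auto
        finally show ?thesis .
      qed
      have vp: "0 < norm v powr (1 - a)" using v by simp
      have E0: "0 \<le> E" using b0 fx pow_gamma_nonneg[of "norm p / 2" g] by (simp add: E_def F_def)
      have Eb: "b \<le> E" using fx pow_gamma_nonneg[of "norm p / 2" g] by (simp add: E_def F_def)
      have EL: "norm v powr (1 - a) * (E / (A * (1 + a))) \<le> 2 * (1 + f x)"
      proof -
        have "norm v powr (1 - a) * (F / pow_gamma (norm p / 2) g) \<le> norm v powr (1 - a) * (F / norm v powr (1 - a))"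
          using Gp vp fx by (intro mult_left_mono divide_left_mono) (auto simp: F_def intro!: mult_pos_pos less_le_trans[OF vp Gp])
        also have "\<dots> = F" using vp by simp
        finally have 1: "norm v powr (1 - a) * (F / pow_gamma (norm p / 2) g) \<le> F" .
        have "norm v powr (1 - a) * b = A * (1 + a) * (norm v powr (1 - a) * norm v powr (a - 1))"
          by (simp add: b_def)
        also have "norm v powr (1 - a) * norm v powr (a - 1) = 1" using v by (simp flip: powr_add)
        finally have 2: "norm v powr (1 - a) * b = A * (1 + a)" by simp
        have "1 * F \<le> (A * (1 + a)) * F" using A a fx mult_mono[of 1 A 1 "1 + a"]
          by (intro mult_right_mono) (auto simp: F_def)
        then have "norm v powr (1 - a) * E \<le> (A * (1 + a)) * (1 + F)"
          using 1 2 by (simp add: E_def distrib_left)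
        also have "\<dots> \<le> (A * (1 + a)) * (2 * (1 + f x))" using A a fx by (intro mult_left_mono) (auto simp: F_def)
        finally show ?thesis using A a by (simp add: pos_divide_le_eq mult_ac)
      qed
      have "isCont f x" using fc x1 by (auto simp: continuous_on_eq_continuous_at)
      then obtain r2 where r2: "0 < r2" "\<And>z. dist z x < r2 \<Longrightarrow> dist (f z) (f x) < 1"
        unfolding continuous_at_eps_delta by (metis zero_less_one)
      \<comment> \<open>\<delta> may depend on \<open>v\<close>, in contrast to \<open>L\<close>; it
        is obtained from finitely many limits as \<rho> tends to 0.\<close>
      have lim: "((\<lambda>\<rho>. X * \<rho>) \<longlongrightarrow> X * 0) (at_right 0)" for X :: real
        by (intro tendsto_intros)
      have lim2: "((\<lambda>\<rho>. b / 2 * \<rho> + 6 * A * N powr (1 + a) * \<rho> powr a) \<longlongrightarrow> b / 2 * 0 + 6 * A * N powr (1 + a) * 0) (at_right 0)"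
      proof -
        have "((\<lambda>\<rho>. \<rho> powr a) \<longlongrightarrow> 0 powr a) (at_right (0::real))"
          using a by (intro tendsto_powr' tendsto_intros) (auto simp: eventually_at_right_less eventually_at_right_field intro: exI[of _ 1])
        then have "((\<lambda>\<rho>. \<rho> powr a) \<longlongrightarrow> 0) (at_right (0::real))" by simp
        then show ?thesis by (intro tendsto_intros)
      qed
      have "\<forall>\<^sub>F \<rho> in at_right 0. N * \<rho> < 1 \<and> N * \<rho> < r2 \<and> C * b * \<rho> < norm p \<and> C * E * \<rho> < \<kappa> * norm p \<and> C * E * \<rho> < norm p / C
        \<and> b / 2 * \<rho> + 6 * A * N powr (1 + a) * \<rho> powr a < \<kappa> * norm p"
        using r2 p0 kap C
        by (intro eventually_conj order_tendstoD(2)[OF lim] order_tendstoD(2)[OF lim2]) auto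
      then obtain \<delta> where d0: "0 < \<delta>" and d: "\<And>\<rho>. 0 < \<rho> \<Longrightarrow> \<rho> < \<delta> \<Longrightarrow> N * \<rho> < 1 \<and> N * \<rho> < r2 \<and> C * b * \<rho> < norm p
         \<and> C * E * \<rho> < \<kappa> * norm p \<and> C * E * \<rho> < norm p / C
         \<and> b / 2 * \<rho> + 6 * A * N powr (1 + a) * \<rho> powr a < \<kappa> * norm p"
        unfolding eventually_at_right_field by blast
      show ?thesis
      proof (intro exI[of _ \<delta>] conjI d0 allI impI)
        fix \<rho> x' y' assume rho: "0 < \<rho>" "\<rho> < \<delta>" and R': "R x' y'" and xx: "dist x' x \<le> \<rho>"
        note r = d[OF rho]
        have Q': "Q x' y'" using R' by (simp add: R_def)
        have sub: "cball x (N * \<rho>) \<subseteq> ball 0 3"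
        proof
          fix z assume "z \<in> cball x (N * \<rho>)"
          then have "norm (z - x) \<le> N * \<rho>" by (simp add: dist_norm norm_minus_commute)
          then show "z \<in> ball 0 3" using r x1 norm_triangle_sub[of z x] by simp
        qed
        then have sub': "cball x (N * \<rho>) \<subseteq> cball 0 3" by auto
        \<comment> \<open>Measured from \<open>x\<close>, not from the contact point
          \<open>x'\<close>, so that both slopes are gradients at the centre of the crease;
          \<open>s\<close> and \<open>e\<close> are length and direction of their
          difference.\<close>
        define v' where "v' = x - y'"
        define p' where "p' = - (A * (1 + a)) *\<^sub>R vpow a v'"
        define s where "s = norm (p' - p)"
        have sV: "s = A * (1 + a) * norm (vpow a v - vpow a v')"
        proof -
          have "p' - p = (A * (1 + a)) *\<^sub>R (vpow a v - vpow a v')" by (simp add: p'_def p_def algebra_simps)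
          then show ?thesis unfolding s_def using A a by simp
        qed
        have s0: "0 \<le> s" by (simp add: s_def)
        obtain e where en: "norm e = 1" and se: "s *\<^sub>R e = p' - p"
        proof (cases "p' = p")
          case True
          obtain e :: 'a where "norm e = 1" using vector_choose_size[of 1] by auto
          then show ?thesis using that True by (auto simp: s_def)
        next
          case False
          then show ?thesis by (intro that[of "(p' - p) /\<^sub>R s"]) (auto simp: s_def)
        qed
        \<comment> \<open>Convexity of the second cusp and the paraboloid bound for the first pay
          for the recentring from \<open>x'\<close> to \<open>x\<close>. \<open>Err\<close> is left
          open because the second cusp is expanded by the Holder bound or by the quadratic one,
          according to what is known about \<open>norm v'\<close>.\<close>
        have main: "u x + p \<bullet> (z - x) + s * (e \<bullet> (z - x) - \<rho>) - b / 2 * \<rho>\<^sup>2 - Err \<le> u z"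
          if z: "z \<in> cball 0 3" and Err: "A * norm (z - y') powr (1 + a) \<le> A * norm v' powr (1 + a) - p' \<bullet> (z - x) + Err" for z Err
        proof -
          define k where "k = x' - x"
          have kn: "norm k \<le> \<rho>" using xx by (simp add: k_def dist_norm)
          have x'3: "x' \<in> cball 0 3" using Q' by (auto simp: Q_def)
          have a1: "u x' + A * (norm (v' + k) powr (1 + a) - norm (z - y') powr (1 + a)) \<le> u z"
            using Q' z by (auto simp: Q_def v'_def k_def)
          have a2: "u x + A * (norm v powr (1 + a) - norm (v + k) powr (1 + a)) \<le> u x'"
            using Qxy x'3 by (auto simp: Q_def v_def k_def)
          have a3: "A * norm (v + k) powr (1 + a) \<le> A * norm v powr (1 + a) - p \<bullet> k + b / 2 * \<rho>\<^sup>2"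
          proof -
            have "A * norm (v + k) powr (1 + a) \<le> A * (norm v powr (1 + a) + (1 + a) * (vpow a v \<bullet> k) + (1 + a) / 2 * norm v powr (a - 1) * (norm k)\<^sup>2)"
              using A norm_powr_le_quadratic[OF v a, of k] by (intro mult_left_mono) auto
            also have "\<dots> = A * norm v powr (1 + a) - p \<bullet> k + b / 2 * (norm k)\<^sup>2"
              by (simp add: p_def b_def algebra_simps)
            also have "b / 2 * (norm k)\<^sup>2 \<le> b / 2 * \<rho>\<^sup>2"
              using b0 kn by (intro mult_left_mono power_mono) auto
            finally show ?thesis by simp
          qed
          have a4: "A * norm v' powr (1 + a) - p' \<bullet> k \<le> A * norm (v' + k) powr (1 + a)"
          proof -
            have "A * (norm v' powr (1 + a) + (1 + a) * (vpow a v' \<bullet> k)) \<le> A * norm (v' + k) powr (1 + a)"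
              using A norm_powr_ge_tangent[of a v' k] a by (intro mult_left_mono) auto
            then show ?thesis by (simp add: p'_def algebra_simps)
          qed
          have a5: "(p' - p) \<bullet> (z - x) - (p' - p) \<bullet> k \<ge> s * (e \<bullet> (z - x) - \<rho>)"
          proof -
            have "e \<bullet> k \<le> norm e * norm k" by (rule norm_cauchy_schwarz)
            then have "e \<bullet> (z - x) - \<rho> \<le> e \<bullet> (z - x) - e \<bullet> k" using kn en by simp
            then have "s * (e \<bullet> (z - x) - \<rho>) \<le> s * (e \<bullet> (z - x) - e \<bullet> k)" using s0 by (intro mult_left_mono)
            then show ?thesis unfolding se[symmetric] by (simp add: right_diff_distrib)
          qed
          show ?thesis using a1 a2 a3 a4 a5 Err
            unfolding right_diff_distrib[of A] inner_diff_left[of p' p] by linarith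
        qed
        have t1: "u x + p \<bullet> (z - x) - b / 2 * (norm (z - x))\<^sup>2 \<le> u z" if z: "z \<in> cball 0 3" for z
        proof -
          have "A * norm (v + (z - x)) powr (1 + a) \<le> A * (norm v powr (1 + a) + (1 + a) * (vpow a v \<bullet> (z - x)) + (1 + a) / 2 * norm v powr (a - 1) * (norm (z - x))\<^sup>2)"
            using A norm_powr_le_quadratic[OF v a, of "z - x"] by (intro mult_left_mono) auto
          also have "\<dots> = A * norm v powr (1 + a) - p \<bullet> (z - x) + b / 2 * (norm (z - x))\<^sup>2"
            by (simp add: p_def b_def algebra_simps)
          finally have "A * norm (z - y) powr (1 + a) \<le> A * norm (x - y) powr (1 + a) - p \<bullet> (z - x) + b / 2 * (norm (z - x))\<^sup>2"
            by (simp add: v_def)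
          moreover have "u x + A * (norm (x - y) powr (1 + a) - norm (z - y) powr (1 + a)) \<le> u z"
            using Qxy z by (auto simp: Q_def)
          ultimately show ?thesis by (simp add: algebra_simps)
        qed
        have crs: "min s (norm p / C) \<le> C * E * \<rho>"
          if t2: "\<And>z. z \<in> cball x (N * \<rho>) \<Longrightarrow> u x + p \<bullet> (z - x) + s * (e \<bullet> (z - x) - 2 * \<rho>) \<le> u z"
        proof -
          have "min s (norm p / C) \<le> C * \<rho> * (b + F / pow_gamma (norm p / 2) g)"
          proof (rule crease[OF sup sub])
            show "continuous_on (cball x (N * \<rho>)) u" using uc sub' continuous_on_subset by blast
            fix z assume z: "z \<in> cball x (N * \<rho>)"
            then have z3: "z \<in> cball 0 3" using sub' by blast
            have "dist z x < r2" using z r by (simp add: dist_commute)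
            then show "f z \<le> F" using r2(2)[of z] by (simp add: dist_real_def F_def)
            show "u x + p \<bullet> (z - x) - b / 2 * (norm (z - x))\<^sup>2 \<le> u z" by (rule t1[OF z3])
            have "0 \<le> b / 2 * (norm (z - x))\<^sup>2" using b0 by simp
            then show "u x + p \<bullet> (z - x) - b / 2 * (norm (z - x))\<^sup>2 + s * (e \<bullet> (z - x) - 2 * \<rho>) \<le> u z"
              using t2[OF z] by linarith
          qed (use rho b0 s0 en fx r in \<open>auto simp: F_def\<close>)
          then show ?thesis by (simp add: E_def mult_ac)
        qed
        \<comment> \<open>If the lengths are not comparable, \<open>s\<close> is at least a fixed
          fraction of \<open>norm p\<close>. Then even the Holder error, of order
          \<open>\<rho> powr (1 + a)\<close>, fits under the crease, and the resulting bound on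
          \<open>s\<close> contradicts the choice of \<delta>.\<close>
        have near: "norm v / 2 \<le> norm v'" "norm v' \<le> 2 * norm v"
        proof -
          have "\<not> (norm v' < norm v / 2 \<or> 2 * norm v < norm v')"
          proof
            assume far: "norm v' < norm v / 2 \<or> 2 * norm v < norm v'"
            have "A * (1 + a) * ((1 - 2 powr (- a)) * norm v powr a) \<le> s"
              unfolding sV using A a norm_vpow_diff_ge[OF a(1) far] by (intro mult_left_mono) auto
            then have sk: "\<kappa> * norm p \<le> s" by (simp add: np \<kappa>_def mult_ac)
            have "min s (norm p / C) \<le> C * E * \<rho>"
            proof (rule crs)
              fix z assume z: "z \<in> cball x (N * \<rho>)"
              define Err where "Err = 6 * A * (N * \<rho>) powr (1 + a)"
              have "norm (v' + (z - x)) powr (1 + a) \<le> norm v' powr (1 + a) + (1 + a) * (vpow a v' \<bullet> (z - x)) + 6 * (N * \<rho>) powr (1 + a)"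
              proof -
                have "norm (z - x) powr (1 + a) \<le> (N * \<rho>) powr (1 + a)"
                  using z a by (intro powr_mono2) (auto simp: dist_norm norm_minus_commute)
                then show ?thesis using norm_powr_le_holder[OF a, of v' "z - x"] by linarith
              qed
              then have "A * norm (v' + (z - x)) powr (1 + a) \<le> A * (norm v' powr (1 + a) + (1 + a) * (vpow a v' \<bullet> (z - x)) + 6 * (N * \<rho>) powr (1 + a))"
                using A by (intro mult_left_mono) auto
              also have "\<dots> = A * norm v' powr (1 + a) - p' \<bullet> (z - x) + Err"
                by (simp add: p'_def Err_def algebra_simps)
              finally have "u x + p \<bullet> (z - x) + s * (e \<bullet> (z - x) - \<rho>) - b / 2 * \<rho>\<^sup>2 - Err \<le> u z"
                using z sub' by (intro main) (auto simp: v'_def)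
              moreover have "b / 2 * \<rho>\<^sup>2 + Err \<le> s * \<rho>"
              proof -
                have "Err = (6 * A * N powr (1 + a) * \<rho> powr a) * \<rho>"
                  using rho N by (simp add: Err_def powr_mult powr_add)
                then have "b / 2 * \<rho>\<^sup>2 + Err = (b / 2 * \<rho> + 6 * A * N powr (1 + a) * \<rho> powr a) * \<rho>"
                  by (simp add: power2_eq_square distrib_right)
                also have "\<dots> \<le> s * \<rho>" using r sk rho by (intro mult_right_mono) auto
                finally show ?thesis .
              qed
              ultimately show "u x + p \<bullet> (z - x) + s * (e \<bullet> (z - x) - 2 * \<rho>) \<le> u z"
                by (simp add: right_diff_distrib)
            qed
            then show False using r sk by linarith
          qed
          then show "norm v / 2 \<le> norm v'" "norm v' \<le> 2 * norm v" by auto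
        qed
        have v': "v' \<noteq> 0" using near v by auto
        \<comment> \<open>With comparable lengths the quadratic expansion of the second cusp has
          curvature of order \<open>b\<close>. Either \<open>s * \<rho>\<close> exceeds the total
          expansion error and the crease applies, or \<open>s\<close> is bounded by the curvature
          directly.\<close>
        have sM: "s \<le> M * E * \<rho>"
        proof (cases "(N\<^sup>2 + 1) * b * \<rho> \<le> s")
          case False
          have "((N\<^sup>2 + 1) * b) * \<rho> \<le> (M * E) * \<rho>" using M Eb b0 rho
            by (intro mult_right_mono mult_mono) auto
          then show ?thesis using False by linarith
        next
          case True
          have "min s (norm p / C) \<le> C * E * \<rho>"
          proof (rule crs)
            fix z assume z: "z \<in> cball x (N * \<rho>)"
            define Err where "Err = b * (N * \<rho>)\<^sup>2"
            have "(1 + a) / 2 * norm v' powr (a - 1) * (norm (z - x))\<^sup>2 \<le> (1 + a) * norm v powr (a - 1) * (N * \<rho>)\<^sup>2"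
            proof -
              have "norm v' powr (a - 1) \<le> (norm v / 2) powr (a - 1)" using near v a by (intro powr_mono2') auto
              also have "\<dots> = 2 powr (1 - a) * norm v powr (a - 1)"
                by (simp add: powr_divide powr_diff)
              also have "\<dots> \<le> 2 powr 1 * norm v powr (a - 1)" using a by (intro mult_right_mono powr_mono) auto
              finally have "(1 + a) / 2 * norm v' powr (a - 1) \<le> (1 + a) / 2 * (2 * norm v powr (a - 1))"
                using a by (intro mult_left_mono) auto
              then have "(1 + a) / 2 * norm v' powr (a - 1) \<le> (1 + a) * norm v powr (a - 1)" by simp
              moreover have "(norm (z - x))\<^sup>2 \<le> (N * \<rho>)\<^sup>2"
                using z by (intro power_mono) (auto simp: dist_norm norm_minus_commute)
              ultimately show ?thesis by (rule mult_mono) (use a in auto)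
            qed
            then have "norm (v' + (z - x)) powr (1 + a) \<le> norm v' powr (1 + a) + (1 + a) * (vpow a v' \<bullet> (z - x)) + (1 + a) * norm v powr (a - 1) * (N * \<rho>)\<^sup>2"
              using norm_powr_le_quadratic[OF v' a, of "z - x"] by linarith
            then have "A * norm (v' + (z - x)) powr (1 + a) \<le> A * (norm v' powr (1 + a) + (1 + a) * (vpow a v' \<bullet> (z - x)) + (1 + a) * norm v powr (a - 1) * (N * \<rho>)\<^sup>2)"
              using A by (intro mult_left_mono) auto
            also have "\<dots> = A * norm v' powr (1 + a) - p' \<bullet> (z - x) + Err"
              by (simp add: p'_def b_def Err_def algebra_simps)
            finally have "u x + p \<bullet> (z - x) + s * (e \<bullet> (z - x) - \<rho>) - b / 2 * \<rho>\<^sup>2 - Err \<le> u z"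
              using z sub' by (intro main) (auto simp: v'_def)
            moreover have "b / 2 * \<rho>\<^sup>2 + Err \<le> s * \<rho>"
            proof -
              have "b / 2 * \<rho>\<^sup>2 \<le> b * \<rho>\<^sup>2" using b0 by simp
              then have "b / 2 * \<rho>\<^sup>2 + Err \<le> ((N\<^sup>2 + 1) * b * \<rho>) * \<rho>"
                by (simp add: Err_def power2_eq_square algebra_simps)
              also have "\<dots> \<le> s * \<rho>" using True rho by (intro mult_right_mono) auto
              finally show ?thesis .
            qed
            ultimately show "u x + p \<bullet> (z - x) + s * (e \<bullet> (z - x) - 2 * \<rho>) \<le> u z"
              by (simp add: right_diff_distrib)
          qed
          then have "s \<le> C * E * \<rho>" using r by linarith
          also have "\<dots> \<le> M * E * \<rho>" using M E0 rho by (intro mult_right_mono) auto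
          finally show ?thesis .
        qed
        have "norm (vpow a v - vpow a v') = s / (A * (1 + a))" using sV A a by simp
        also have "\<dots> \<le> M * E * \<rho> / (A * (1 + a))" using sM A a by (intro divide_right_mono) auto
        finally have V: "norm (vpow a v - vpow a v') \<le> M * E * \<rho> / (A * (1 + a))" .
        have "norm (v - v') \<le> 2 * (1 + 1 / a) * norm v powr (1 - a) * norm (vpow a v - vpow a v')"
          by (rule norm_diff_le_vpow[OF a v near(2)])
        also have "\<dots> \<le> 2 * (1 + 1 / a) * norm v powr (1 - a) * (M * E * \<rho> / (A * (1 + a)))"
          using V a by (intro mult_left_mono) auto
        also have "\<dots> = (2 * (1 + 1 / a) * M * \<rho>) * (norm v powr (1 - a) * (E / (A * (1 + a))))"
          by simp
        also have "\<dots> \<le> (2 * (1 + 1 / a) * M * \<rho>) * (2 * (1 + f x))"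
          using EL a M rho by (intro mult_left_mono) auto
        also have "\<dots> = L * (1 + f x) * \<rho>" by (simp add: L_def algebra_simps add_divide_distrib)
        finally show "dist y' y \<le> L * (1 + f x) * \<rho>" by (simp add: v_def v'_def dist_norm)
      qed
    qed

    \<comment> \<open>Measure of the set of contact points\<close>
    let ?I = "\<integral>\<^sup>+x\<in>ball 0 3. ennreal (f x ^ ?n) \<partial>lebesgue"
    have "emeasure lebesgue (cball z0 (1/8) - G) \<le> ennreal ((20 * L) ^ ?n) * (emeasure lebesgue G + ?I)"
    proof (rule emeasure_lipschitz_relation_le[where R=R])
      fix y assume y: "y \<in> cball z0 (1/8) - G"
      then obtain x where x: "Q x y" using Qx by blast
      then have "x \<noteq> y" using QG y by blast
      then show "\<exists>x. R x y" using x by (auto simp: R_def)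
    next
      fix x y assume "R x y" then show "x \<in> G" using QG by (auto simp: R_def)
    qed (use fc f0 L0 lip G in auto)
    then have 1: "emeasure lebesgue (cball z0 (1/8) - G) \<le> ennreal K * (emeasure lebesgue G + ?I)" by (simp add: K_def)
    have "ennreal \<omega> = emeasure lebesgue (cball z0 (1/8))"
      by (subst emeasure_lebesgue_cball) (auto simp: \<omega>_def)
    also have "\<dots> \<le> emeasure lebesgue (G \<union> (cball z0 (1/8) - G))" using G by (intro emeasure_mono) auto
    also have "\<dots> \<le> emeasure lebesgue G + emeasure lebesgue (cball z0 (1/8) - G)"
      using G by (intro emeasure_subadditive) auto
    also have "\<dots> \<le> (emeasure lebesgue G + ?I) + ennreal K * (emeasure lebesgue G + ?I)"
      using 1 by (intro add_mono) (auto simp: add_increasing2)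
    also have "\<dots> = ennreal (1 + K) * (emeasure lebesgue G + ?I)"
      using K0 by (simp add: distrib_right)
    finally have 2: "ennreal \<omega> \<le> ennreal (1 + K) * (emeasure lebesgue G + ?I)" .
    have "ennreal \<omega> = ennreal (1 + K) * ennreal c"
      using om K0 by (subst ennreal_mult'[symmetric]) (simp_all add: c_def add_nonneg_eq_0_iff)
    then have "ennreal (1 + K) * ennreal c \<le> ennreal (1 + K) * (emeasure lebesgue G + ?I)" using 2 by metis
    then show "ennreal c \<le> emeasure lebesgue G + ?I"
      using K0 by (subst (asm) ennreal_mult_le_mult_iff) auto
  qed
qed

section \<open>Density of touching points at unit scale\<close>

lemma ennreal_half_le:
  assumes "ennreal c \<le> X + I" "I \<le> ennreal h" "0 \<le> h" "h \<le> c / 2" "0 < c"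
  shows "ennreal h \<le> X"
proof (cases X)
  case (real x)
  have "ennreal c \<le> X + ennreal h" using assms(1,2) by (meson add_left_mono order_trans)
  then have "c \<le> x + h" using real assms by (simp add: ennreal_plus[symmetric] del: ennreal_plus)
  then show ?thesis using real assms by (simp add: ennreal_leI)
qed (use assms in simp)

text \<open>Beyond the ball of radius 3 the old cusp at \<open>x1\<close> takes over: there
  \<open>norm (z - x) >= 2\<close>, so differences of values, slopes and centres are at most
  multiples of \<open>norm (z - x) powr (1 + a)\<close> and a larger opening absorbs them. The 7
  bounds the square of 5/2, which in turn bounds the ratio of the distances to \<open>x1\<close> and
  \<open>x\<close>.\<close>

lemma touch_beyond_ball:
  fixes u :: "'a::euclidean_space \<Rightarrow> real"
  assumes a: "0 < a" "a \<le> 1" and K: "0 \<le> K" and x: "norm x < 1" and x1: "norm x1 \<le> 2"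
    and loc: "\<And>z. z \<in> cball 0 3 \<Longrightarrow> u x + q \<bullet> (z - x) - K * norm (z - x) powr (1 + a) \<le> u z"
    and val: "u x \<le> u x1 + P \<bullet> (x - x1) + K" and qP: "norm (P - q) \<le> K" and B: "7 + 2 * K \<le> B"
    and z: "u x1 + P \<bullet> (z - x1) - norm (z - x1) powr (1 + a) \<le> u z"
  shows "u x + q \<bullet> (z - x) - B * norm (z - x) powr (1 + a) \<le> u z"
proof (cases "z \<in> cball 0 3")
  case True
  have "K * norm (z - x) powr (1 + a) \<le> B * norm (z - x) powr (1 + a)"
    using B K by (intro mult_right_mono) auto
  then show ?thesis using loc[OF True] by linarith
next
  case False
  define W where "W = norm (z - x) powr (1 + a)"
  have zx: "2 \<le> norm (z - x)" using False x norm_triangle_sub[of z x] by simp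
  have W: "norm (z - x) \<le> W" "1 \<le> W"
  proof -
    have "norm (z - x) powr 1 \<le> W" unfolding W_def using zx a by (intro powr_mono) auto
    then show "norm (z - x) \<le> W" using zx by simp
    then show "1 \<le> W" using zx by simp
  qed
  have "norm (z - x1) \<le> norm (z - x) + (norm x + norm x1)"
    using norm_triangle_ineq[of "z - x" "x - x1"] norm_triangle_ineq4[of x x1] by simp
  then have "norm (z - x1) \<le> 5/2 * norm (z - x)" using zx x x1 by simp
  then have "norm (z - x1) powr (1 + a) \<le> (5/2 * norm (z - x)) powr (1 + a)"
    using a by (intro powr_mono2) auto
  also have "\<dots> = (5/2) powr (1 + a) * W" unfolding W_def by (rule powr_mult)
  also have "\<dots> \<le> (5/2) powr 2 * W" using a W by (intro mult_right_mono powr_mono) auto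
  also have "\<dots> \<le> 7 * W" using W by (intro mult_right_mono) (auto simp: power2_eq_square)
  finally have 1: "norm (z - x1) powr (1 + a) \<le> 7 * W" .
  have "(q - P) \<bullet> (z - x) \<le> norm (q - P) * norm (z - x)" by (rule norm_cauchy_schwarz)
  also have "\<dots> \<le> K * W" using qP W K by (intro mult_mono) (auto simp: norm_minus_commute)
  finally have 2: "(q - P) \<bullet> (z - x) \<le> K * W" .
  have 3: "K * 1 \<le> K * W" using K W by (intro mult_left_mono) auto
  have 4: "(7 + 2 * K) * W \<le> B * W" using B W by (intro mult_right_mono) auto
  have 5: "q \<bullet> (z - x) = (q - P) \<bullet> (z - x) + P \<bullet> (z - x1) - P \<bullet> (x - x1)"
    by (simp add: inner_diff_left inner_diff_right)
  have "u x + q \<bullet> (z - x) - B * W \<le> u x1 + P \<bullet> (z - x1) - 7 * W"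
    using 2 3 4 5 val by (simp add: algebra_simps)
  also have "\<dots> \<le> u z" using 1 z by linarith
  finally show ?thesis by (simp add: W_def)
qed

text \<open>Three cases. If \<open>P\<close> is large, the barrier is added to it. If
  \<open>P\<close> is bounded and \<open>u\<close> takes a value not far above \<open>u x1\<close>
  in \<open>ball 0 (1/2)\<close>, cusps produce contact points. If it takes none, the barrier with
  slope 0 has no contact in the half ball, and its estimate contradicts the smallness of the
  integral. The last hypothesis speaks of all \<open>z\<close> above the old cusp because, after
  rescaling, the domain extends beyond \<open>cball 0 3\<close> to a set not named here.\<close>

lemma unit_scale_density:
  fixes lam bet g a :: real
  assumes lam: "0 < lam" and bet: "0 \<le> bet" and g: "0 \<le> g" and a_def: "a = 1 / (1 + g)"
  obtains B c :: real where "1 \<le> B" "0 < c"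
    "\<And>(u::'a::euclidean_space \<Rightarrow> real) f P x1 G.
      continuous_on (cball 0 3) u \<Longrightarrow> continuous_on (ball 0 3) f \<Longrightarrow> (\<And>x. x \<in> ball 0 3 \<Longrightarrow> 0 \<le> f x) \<Longrightarrow>
      supersol lam bet g (ball 0 3) u f \<Longrightarrow> norm x1 \<le> 2 \<Longrightarrow>
      (\<And>z. z \<in> cball 0 3 \<Longrightarrow> u x1 + P \<bullet> (z - x1) - norm (z - x1) powr (1 + a) \<le> u z) \<Longrightarrow>
      (\<integral>\<^sup>+x\<in>ball 0 3. ennreal (f x ^ DIM('a)) \<partial>lebesgue) \<le> ennreal c \<Longrightarrow>
      G \<in> sets lebesgue \<Longrightarrow> G \<subseteq> ball 0 3 \<Longrightarrow>
      (\<And>x q. x \<in> ball 0 1 \<Longrightarrow>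
        (\<And>z. u x1 + P \<bullet> (z - x1) - norm (z - x1) powr (1 + a) \<le> u z \<Longrightarrow>
            u x + q \<bullet> (z - x) - B * norm (z - x) powr (1 + a) \<le> u z) \<Longrightarrow> x \<in> G) \<Longrightarrow>
      ennreal c \<le> emeasure lebesgue G"
proof -
  have a: "0 < a" "a \<le> 1" using g by (auto simp: a_def)
  let ?n = "DIM('a)"
  obtain k1 S1 c1 where kS1: "0 < k1" "0 < S1" "0 < c1" and barr1:
    "\<And>(u::'a \<Rightarrow> real) f P x1 G.
      continuous_on (cball 0 3) u \<Longrightarrow> continuous_on (ball 0 3) f \<Longrightarrow> (\<And>x. x \<in> ball 0 3 \<Longrightarrow> 0 \<le> f x) \<Longrightarrow>
      supersol lam bet g (ball 0 3) u f \<Longrightarrow> norm x1 \<le> 2 \<Longrightarrow>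
      (\<And>z. z \<in> cball 0 3 \<Longrightarrow> u x1 + P \<bullet> (z - x1) - 25 \<le> u z) \<Longrightarrow>
      6 * k1 * S1 + 2 \<le> norm P \<or> P = 0 \<and> (\<forall>x\<in>ball 0 (1/2). u x1 + S1 + 5 < u x) \<Longrightarrow>
      G \<in> sets lebesgue \<Longrightarrow> G \<subseteq> ball 0 3 \<Longrightarrow>
      (\<And>x y. x \<in> ball 0 (1/2) \<Longrightarrow> norm y \<le> 1 \<Longrightarrow>
        (\<And>z. z \<in> cball 0 3 \<Longrightarrow>
          u x + (P + y - (2 * k1 * S1 * gauss k1 x) *\<^sub>R x) \<bullet> (z - x) - k1 * S1 * (norm (z - x))\<^sup>2 \<le> u z) \<Longrightarrow>
        u x \<le> u x1 + P \<bullet> (x - x1) + S1 + 5 \<Longrightarrow> x \<in> G) \<Longrightarrow>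
      ennreal c1 \<le> emeasure lebesgue G + (\<integral>\<^sup>+x\<in>ball 0 3. ennreal (f x ^ ?n) \<partial>lebesgue)"
    by (rule barrier_estimate[OF lam bet g, of 25, where 'a='a]) (simp, blast)
  define P0 where "P0 = 6 * k1 * S1 + 2"
  have P0: "0 < P0" using kS1 by (simp add: P0_def add_pos_pos)
  \<comment> \<open>25 bounds \<open>norm (z - x1) powr (1 + a)\<close> for distances up to 5, and
    \<open>5 * P0\<close> the change of a linear function of slope below \<open>P0\<close> over that
    distance.\<close>
  define D1 where "D1 = 25 + 5 * P0"
  have D1: "0 \<le> D1" using P0 by (simp add: D1_def)
  obtain k2 S2 c2 where kS2: "0 < k2" "0 < S2" "0 < c2" and barr2:
    "\<And>(u::'a \<Rightarrow> real) f P x1 G.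
      continuous_on (cball 0 3) u \<Longrightarrow> continuous_on (ball 0 3) f \<Longrightarrow> (\<And>x. x \<in> ball 0 3 \<Longrightarrow> 0 \<le> f x) \<Longrightarrow>
      supersol lam bet g (ball 0 3) u f \<Longrightarrow> norm x1 \<le> 2 \<Longrightarrow>
      (\<And>z. z \<in> cball 0 3 \<Longrightarrow> u x1 + P \<bullet> (z - x1) - D1 \<le> u z) \<Longrightarrow>
      6 * k2 * S2 + 2 \<le> norm P \<or> P = 0 \<and> (\<forall>x\<in>ball 0 (1/2). u x1 + S2 + 5 < u x) \<Longrightarrow>
      G \<in> sets lebesgue \<Longrightarrow> G \<subseteq> ball 0 3 \<Longrightarrow>
      (\<And>x y. x \<in> ball 0 (1/2) \<Longrightarrow> norm y \<le> 1 \<Longrightarrow>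
        (\<And>z. z \<in> cball 0 3 \<Longrightarrow>
          u x + (P + y - (2 * k2 * S2 * gauss k2 x) *\<^sub>R x) \<bullet> (z - x) - k2 * S2 * (norm (z - x))\<^sup>2 \<le> u z) \<Longrightarrow>
        u x \<le> u x1 + P \<bullet> (x - x1) + S2 + 5 \<Longrightarrow> x \<in> G) \<Longrightarrow>
      ennreal c2 \<le> emeasure lebesgue G + (\<integral>\<^sup>+x\<in>ball 0 3. ennreal (f x ^ ?n) \<partial>lebesgue)"
    by (rule barrier_estimate[OF lam bet g D1, where 'a='a]) blast
  have D2: "0 \<le> S2 + 5" using kS2 by simp
  obtain A c3 where A: "1 \<le> A" "0 < c3" and vert:
    "\<And>(u::'a::euclidean_space \<Rightarrow> real) f m0 z0 G.
      continuous_on (cball 0 3) u \<Longrightarrow> continuous_on (ball 0 3) f \<Longrightarrow> (\<And>x. x \<in> ball 0 3 \<Longrightarrow> 0 \<le> f x) \<Longrightarrow>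
      supersol lam bet g (ball 0 3) u f \<Longrightarrow> norm z0 < 1/2 \<Longrightarrow> u z0 \<le> m0 + (S2 + 5) \<Longrightarrow>
      (\<And>z. z \<in> cball 0 3 \<Longrightarrow> m0 - D1 \<le> u z) \<Longrightarrow>
      G \<in> sets lebesgue \<Longrightarrow> G \<subseteq> ball 0 3 \<Longrightarrow>
      (\<And>x q. x \<in> ball 0 1 \<Longrightarrow> norm q \<le> 2 * A \<Longrightarrow>
        (\<And>z. z \<in> cball 0 3 \<Longrightarrow> u x + q \<bullet> (z - x) - 6 * A * norm (z - x) powr (1 + a) \<le> u z) \<Longrightarrow>
        u x \<le> m0 + (S2 + 5) + A \<Longrightarrow> x \<in> G) \<Longrightarrow>
      ennreal c3 \<le> emeasure lebesgue G + (\<integral>\<^sup>+x\<in>ball 0 3. ennreal (f x ^ ?n) \<partial>lebesgue)"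
    using vertex_estimate[OF lam bet g a_def D1 D2, where 'a='a] by blast
  define K1 where "K1 = 6 * k1 * S1 + S1 + 6"
  define K2 where "K2 = 6 * A + (S2 + 5) + 4 * P0"
  have K: "0 \<le> K1" "0 \<le> K2" using kS1 kS2 P0 A by (auto simp: K1_def K2_def)
  define B where "B = 7 + 2 * (K1 + K2)"
  \<comment> \<open>The factor 1/4 leaves room for \<open>ennreal_half_le\<close> and for the strict
    \<open>c < c2\<close> that yields the contradiction in the third case.\<close>
  define c where "c = min c1 (min c2 c3) / 4"
  have c: "0 < c" "c \<le> c1 / 2" "c < c2" "c \<le> c3 / 2" using kS1 kS2 A by (auto simp: c_def)
  show ?thesis
  proof (rule that[OF _ c(1)])
    show "1 \<le> B" using K by (simp add: B_def)
    fix u f :: "'a \<Rightarrow> real" and P x1 G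
    assume uc: "continuous_on (cball 0 3) u" and fc: "continuous_on (ball 0 3) f"
      and f0: "\<And>x. x \<in> ball 0 3 \<Longrightarrow> 0 \<le> f x"
      and sup: "supersol lam bet g (ball 0 3) u f" and x1: "norm x1 \<le> 2"
      and low: "\<And>z. z \<in> cball 0 3 \<Longrightarrow> u x1 + P \<bullet> (z - x1) - norm (z - x1) powr (1 + a) \<le> u z"
      and I: "(\<integral>\<^sup>+x\<in>ball 0 3. ennreal (f x ^ ?n) \<partial>lebesgue) \<le> ennreal c"
      and G: "G \<in> sets lebesgue" "G \<subseteq> ball 0 3"
      and inG: "\<And>x q. x \<in> ball 0 1 \<Longrightarrow>
        (\<And>z. u x1 + P \<bullet> (z - x1) - norm (z - x1) powr (1 + a) \<le> u z \<Longrightarrow>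
            u x + q \<bullet> (z - x) - B * norm (z - x) powr (1 + a) \<le> u z) \<Longrightarrow> x \<in> G"
    have low25: "u x1 + P \<bullet> (z - x1) - 25 \<le> u z" if z: "z \<in> cball 0 3" for z
    proof -
      have "norm (z - x1) \<le> 5" using z x1 norm_triangle_ineq4[of z x1] by simp
      then have "norm (z - x1) powr (1 + a) \<le> 5 powr (1 + a)" using a by (intro powr_mono2) auto
      also have "\<dots> \<le> 5 powr 2" using a by (intro powr_mono) auto
      finally show ?thesis using low[OF z] by simp
    qed
    show "ennreal c \<le> emeasure lebesgue G"
    proof (cases "P0 \<le> norm P")
      case True
      have "ennreal c1 \<le> emeasure lebesgue G + (\<integral>\<^sup>+x\<in>ball 0 3. ennreal (f x ^ ?n) \<partial>lebesgue)"
      proof (rule barr1[OF uc fc f0 sup x1 low25])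
        show "6 * k1 * S1 + 2 \<le> norm P \<or> P = 0 \<and> (\<forall>x\<in>ball 0 (1/2). u x1 + S1 + 5 < u x)"
          using True by (simp add: P0_def)
        fix x y assume x: "x \<in> ball (0::'a) (1/2)" and y: "norm y \<le> 1"
          and tou: "\<And>z. z \<in> cball 0 3 \<Longrightarrow>
            u x + (P + y - (2 * k1 * S1 * gauss k1 x) *\<^sub>R x) \<bullet> (z - x) - k1 * S1 * (norm (z - x))\<^sup>2 \<le> u z"
          and val: "u x \<le> u x1 + P \<bullet> (x - x1) + S1 + 5"
        show "x \<in> G"
        proof (rule inG[of _ "P + y - (2 * k1 * S1 * gauss k1 x) *\<^sub>R x"])
          fix z assume z: "u x1 + P \<bullet> (z - x1) - norm (z - x1) powr (1 + a) \<le> u z"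
          show "u x + (P + y - (2 * k1 * S1 * gauss k1 x) *\<^sub>R x) \<bullet> (z - x) - B * norm (z - x) powr (1 + a) \<le> u z"
          proof (rule touch_beyond_ball[OF a K(1) _ x1 _ _ _ _ z])
            fix z :: 'a assume z: "z \<in> cball 0 3"
            have "norm (z - x) \<le> 4" using z x norm_triangle_ineq4[of z x] by simp
            then have "norm (z - x) powr (1 - a) \<le> 4 powr (1 - a)" using a by (intro powr_mono2) auto
            also have "\<dots> \<le> 4 powr 1" using a by (intro powr_mono) auto
            finally have "norm (z - x) powr (1 + a) * norm (z - x) powr (1 - a) \<le> norm (z - x) powr (1 + a) * 4"
              by (intro mult_left_mono) auto
            moreover have "norm (z - x) powr (1 + a) * norm (z - x) powr (1 - a) = (norm (z - x))\<^sup>2"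
              by (cases "z = x") (auto simp flip: powr_add)
            ultimately have "(k1 * S1) * (norm (z - x))\<^sup>2 \<le> (k1 * S1) * (norm (z - x) powr (1 + a) * 4)"
              using kS1 by (intro mult_left_mono) auto
            also have "\<dots> = (4 * k1 * S1) * norm (z - x) powr (1 + a)" by simp
            also have "\<dots> \<le> K1 * norm (z - x) powr (1 + a)"
              using kS1 by (intro mult_right_mono) (auto simp: K1_def)
            finally show "u x + (P + y - (2 * k1 * S1 * gauss k1 x) *\<^sub>R x) \<bullet> (z - x) - K1 * norm (z - x) powr (1 + a) \<le> u z"
              using tou[OF z] by linarith
          next
            have "0 < 6 * k1 * S1" using kS1 by simp
            then show "u x \<le> u x1 + P \<bullet> (x - x1) + K1" using val unfolding K1_def by linarith
            have "norm (P - (P + y - (2 * k1 * S1 * gauss k1 x) *\<^sub>R x)) \<le> norm ((2 * k1 * S1 * gauss k1 x) *\<^sub>R x) + norm y"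
              using norm_triangle_ineq4[of "(2 * k1 * S1 * gauss k1 x) *\<^sub>R x" y] by simp
            also have "norm ((2 * k1 * S1 * gauss k1 x) *\<^sub>R x) \<le> 2 * k1 * S1 * 1 * 1"
              using kS1 x gauss_bounds[of k1 x] unfolding norm_scaleR by (intro mult_mono) auto
            finally show "norm (P - (P + y - (2 * k1 * S1 * gauss k1 x) *\<^sub>R x)) \<le> K1"
              using \<open>0 < 6 * k1 * S1\<close> kS1(2) y unfolding K1_def by linarith
            show "norm x < 1" using x by simp
            show "7 + 2 * K1 \<le> B" using K by (simp add: B_def)
          qed
        next
          show "x \<in> ball 0 1" using x by simp
        qed
      qed (assumption | rule G)+
      then show ?thesis by (rule ennreal_half_le[OF _ I less_imp_le[OF c(1)] c(2) kS1(3)])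
    next
      case False
      then have nP: "norm P \<le> P0" by simp
      have Pb: "\<bar>P \<bullet> w\<bar> \<le> P0 * norm w" for w
      proof -
        have "\<bar>P \<bullet> w\<bar> \<le> norm P * norm w" by (rule Cauchy_Schwarz_ineq2)
        also have "\<dots> \<le> P0 * norm w" using nP by (intro mult_right_mono) auto
        finally show ?thesis .
      qed
      have lowD: "u x1 - D1 \<le> u z" if z: "z \<in> cball 0 3" for z
      proof -
        have "norm (z - x1) \<le> 5" using z x1 norm_triangle_ineq4[of z x1] by simp
        then have "P0 * norm (z - x1) \<le> P0 * 5" using P0 by (intro mult_left_mono) auto
        then show ?thesis using low25[OF z] Pb[of "z - x1"] by (simp add: D1_def)
      qed
      show ?thesis
      proof (cases "\<exists>z0. norm z0 < 1/2 \<and> u z0 \<le> u x1 + (S2 + 5)")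
        case True
        then obtain z0 where z0: "norm z0 < 1/2" "u z0 \<le> u x1 + (S2 + 5)" by blast
        have "ennreal c3 \<le> emeasure lebesgue G + (\<integral>\<^sup>+x\<in>ball 0 3. ennreal (f x ^ ?n) \<partial>lebesgue)"
        proof (rule vert[OF uc fc f0 sup z0 lowD G])
          fix x q assume x: "x \<in> ball (0::'a) 1" and q: "norm q \<le> 2 * A"
            and tou: "\<And>z. z \<in> cball 0 3 \<Longrightarrow> u x + q \<bullet> (z - x) - 6 * A * norm (z - x) powr (1 + a) \<le> u z"
            and val: "u x \<le> u x1 + (S2 + 5) + A"
          show "x \<in> G"
          proof (rule inG[OF x, of q])
            fix z assume z: "u x1 + P \<bullet> (z - x1) - norm (z - x1) powr (1 + a) \<le> u z"
            show "u x + q \<bullet> (z - x) - B * norm (z - x) powr (1 + a) \<le> u z"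
            proof (rule touch_beyond_ball[OF a K(2) _ x1 _ _ _ _ z])
              fix z :: 'a assume z: "z \<in> cball 0 3"
              have "6 * A * norm (z - x) powr (1 + a) \<le> K2 * norm (z - x) powr (1 + a)"
                using D2 P0 A by (intro mult_right_mono) (auto simp: K2_def)
              then show "u x + q \<bullet> (z - x) - K2 * norm (z - x) powr (1 + a) \<le> u z" using tou[OF z] by linarith
            next
              have "norm (x - x1) \<le> 3" using x x1 norm_triangle_ineq4[of x x1] by simp
              then have "P0 * norm (x - x1) \<le> P0 * 3" using P0 by (intro mult_left_mono) auto
              then show "u x \<le> u x1 + P \<bullet> (x - x1) + K2"
                using val Pb[of "x - x1"] A P0 unfolding K2_def by linarith
              show "norm (P - q) \<le> K2" using norm_triangle_ineq4[of P q] nP q A P0 D2 by (simp add: K2_def)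
              show "norm x < 1" using x by simp
              show "7 + 2 * K2 \<le> B" using K by (simp add: B_def)
            qed
          qed
        qed
        then show ?thesis by (rule ennreal_half_le[OF _ I less_imp_le[OF c(1)] c(4) A(2)])
      next
        case False
        \<comment> \<open>\<open>G\<close> can be empty because the upper bound on \<open>u\<close>
          at contact points in the half ball is incompatible with \<open>big\<close>.\<close>
        have "ennreal c2 \<le> emeasure lebesgue ({} :: 'a set) + (\<integral>\<^sup>+x\<in>ball 0 3. ennreal (f x ^ ?n) \<partial>lebesgue)"
        proof (rule barr2[where P=0 and G="{}", OF uc fc f0 sup x1])
          have big: "u x1 + S2 + 5 < u x" if "x \<in> ball 0 (1/2)" for x
          proof -
            have "\<not> u x \<le> u x1 + (S2 + 5)" using False that by auto
            then show ?thesis by linarith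
          qed
          then show "6 * k2 * S2 + 2 \<le> norm (0::'a) \<or> (0::'a) = 0 \<and> (\<forall>x\<in>ball 0 (1/2). u x1 + S2 + 5 < u x)"
            by blast
          show "x \<in> {}" if x: "x \<in> ball (0::'a) (1/2)" and val: "u x \<le> u x1 + 0 \<bullet> (x - x1) + S2 + 5" for x
            using big[OF x] val by simp
          show "u x1 + 0 \<bullet> (z - x1) - D1 \<le> u z" if "z \<in> cball 0 3" for z
            using lowD[OF that] by simp
        qed (assumption | rule sets.empty_sets | rule empty_subsetI)+
        also have "\<dots> \<le> ennreal c" using I by simp
        finally show ?thesis using c by (simp add: ennreal_le_iff)
      qed
    qed
  qed
qed

section \<open>Rescaling\<close>

definition touch :: "real \<Rightarrow> real \<Rightarrow> ('a::euclidean_space \<Rightarrow> real) \<Rightarrow> 'a set" where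
  "touch a t u = {x \<in> ball 0 1. \<exists>p. \<forall>z\<in>ball 0 1. u x + p \<bullet> (z - x) - t * norm (z - x) powr (1 + a) \<le> u z}"

lemma touch_mono: "s \<le> t \<Longrightarrow> touch a s u \<subseteq> touch a t u"
proof
  fix x assume st: "s \<le> t" and "x \<in> touch a s u"
  then obtain p where x: "x \<in> ball 0 1"
    and p: "\<And>z. z \<in> ball 0 1 \<Longrightarrow> u x + p \<bullet> (z - x) - s * norm (z - x) powr (1 + a) \<le> u z"
    unfolding touch_def by blast
  have "u x + p \<bullet> (z - x) - t * norm (z - x) powr (1 + a) \<le> u z" if "z \<in> ball 0 1" for z
    using p[OF that] mult_right_mono[OF st, of "norm (z - x) powr (1 + a)"] by simp
  then show "x \<in> touch a t u" using x unfolding touch_def by blast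
qed

text \<open>On smaller balls the slopes \<open>p\<close> are bounded, so this is a projection along a compact set.\<close>
lemma open_ball_diff_touch:
  fixes u :: "'a::euclidean_space \<Rightarrow> real"
  assumes a: "0 < a" and uc: "continuous_on (ball 0 1) u"
    and M: "\<And>x. x \<in> ball 0 1 \<Longrightarrow> \<bar>u x\<bar> \<le> M"
  shows "open (ball 0 1 - touch a t u)"
proof (subst open_subopen, intro ballI)
  fix x assume x: "x \<in> ball 0 1 - touch a t u"
  define \<rho> where "\<rho> = (1 + norm x) / 2"
  have rho: "norm x < \<rho>" "\<rho> < 1" using x by (auto simp: \<rho>_def)
  define s where "s = (1 - \<rho>) / 2"
  have s: "0 < s" "\<rho> + s < 1" using rho by (auto simp: s_def field_simps)
  \<comment> \<open>A step of length \<open>s\<close> from a point of \<open>ball 0 \<rho>\<close>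
    in the direction of its slope stays in the unit ball, and the oscillation \<open>2 * M\<close>
    of \<open>u\<close> along it bounds the slope.\<close>
  define N where "N = (2 * M + t * s powr (1 + a)) / s"
  define S where "S = cball (0::'a) N \<times> ball (0::'a) 1"
  define T where "T = {y. \<exists>p. p \<in> cball 0 N \<and> (p, y) \<in> (\<Inter>z\<in>ball 0 1.
      {w \<in> S. u (snd w) + fst w \<bullet> (z - snd w) - t * norm (z - snd w) powr (1 + a) \<le> u z})}"
  have "closedin (top_of_set S) (\<Inter>z\<in>ball 0 1.
      {w \<in> S. u (snd w) + fst w \<bullet> (z - snd w) - t * norm (z - snd w) powr (1 + a) \<le> u z})"
  proof (rule closedin_INT)
    show "ball (0::'a) 1 \<noteq> {}" by simp
    fix z :: 'a
    have "continuous_on S (\<lambda>w. u (snd w))"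
      by (rule continuous_on_compose2[OF uc]) (auto simp: S_def intro: continuous_intros)
    then have "continuous_on S (\<lambda>w. u (snd w) + fst w \<bullet> (z - snd w) - t * norm (z - snd w) powr (1 + a))"
      using a by (intro continuous_intros continuous_on_powr') auto
    then have "closedin (top_of_set S) (S \<inter> (\<lambda>w. u (snd w) + fst w \<bullet> (z - snd w) - t * norm (z - snd w) powr (1 + a)) -` {..u z})"
      by (intro continuous_closedin_preimage) auto
    then show "closedin (top_of_set S) {w \<in> S. u (snd w) + fst w \<bullet> (z - snd w) - t * norm (z - snd w) powr (1 + a) \<le> u z}"
      by (simp add: Int_def vimage_def)
  qed
  then have clo: "closedin (top_of_set (ball 0 1)) T"
    unfolding T_def S_def by (intro closedin_compact_projection) auto
  have "openin (top_of_set (ball 0 1)) (ball 0 1 - T)"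
    using clo by (simp add: closedin_def)
  then have o: "open (ball 0 1 - T)" by (rule openin_open_trans) simp
  \<comment> \<open>\<open>T\<close> collects the touching points with a slope of norm at most
    \<open>N\<close>; its agreement with \<open>touch a t u\<close> on \<open>ball 0 \<rho>\<close>
    is enough for openness near \<open>x\<close>.\<close>
  have T1: "T \<inter> ball 0 1 \<subseteq> touch a t u"
    by (force simp: T_def S_def touch_def)
  have T2: "touch a t u \<inter> ball 0 \<rho> \<subseteq> T"
  proof
    fix y assume y: "y \<in> touch a t u \<inter> ball 0 \<rho>"
    then obtain p where y1: "y \<in> ball 0 1"
      and p: "\<And>z. z \<in> ball 0 1 \<Longrightarrow> u y + p \<bullet> (z - y) - t * norm (z - y) powr (1 + a) \<le> u z"
      unfolding touch_def by blast
    have "norm p \<le> N"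
    proof (cases "p = 0")
      case True
      obtain e :: 'a where e: "norm e = s" using vector_choose_size[of s] s by auto
      have "y + e \<in> ball 0 1" using y s e norm_triangle_ineq[of y e] by simp
      then have "u y - t * s powr (1 + a) \<le> u (y + e)" using p[of "y + e"] True e by simp
      then have "0 \<le> 2 * M + t * s powr (1 + a)" using M[OF y1] M[OF \<open>y + e \<in> ball 0 1\<close>] by linarith
      then show ?thesis using True s by (simp add: N_def)
    next
      case False
      define e where "e = (s / norm p) *\<^sub>R p"
      have e: "norm e = s" "p \<bullet> e = s * norm p"
        using False s by (auto simp: e_def dot_square_norm power2_eq_square)
      have ye: "y + e \<in> ball 0 1" using y s e norm_triangle_ineq[of y e] by simp
      then have "u y + s * norm p - t * s powr (1 + a) \<le> u (y + e)" using p[of "y + e"] e by simp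
      then have "s * norm p \<le> 2 * M + t * s powr (1 + a)" using M[OF y1] M[OF ye] by linarith
      then show ?thesis using s by (simp add: N_def pos_le_divide_eq mult.commute)
    qed
    then show "y \<in> T" using p y1 unfolding T_def S_def by auto
  qed
  show "\<exists>T. open T \<and> x \<in> T \<and> T \<subseteq> ball 0 1 - touch a t u"
  proof (intro exI[of _ "(ball 0 1 - T) \<inter> ball 0 \<rho>"] conjI)
    show "open ((ball 0 1 - T) \<inter> ball 0 \<rho>)" using o by (intro open_Int) auto
    show "x \<in> (ball 0 1 - T) \<inter> ball 0 \<rho>" using x rho T1 by auto
    show "(ball 0 1 - T) \<inter> ball 0 \<rho> \<subseteq> ball 0 1 - touch a t u" using T2 by auto
  qed
qed

lemma borel_touch:
  fixes u :: "'a::euclidean_space \<Rightarrow> real"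
  assumes "open (ball 0 1 - touch a t u)"
  shows "touch a t u \<in> sets borel"
proof -
  have "touch a t u = ball 0 1 - (ball 0 1 - touch a t u)" by (auto simp: touch_def)
  also have "\<dots> \<in> sets borel" by (rule sets.Diff[OF _ borel_open[OF assms]]) (simp add: borel_open)
  finally show ?thesis .
qed

lemma pow_gamma_mult: "0 \<le> s \<Longrightarrow> 0 \<le> t \<Longrightarrow> pow_gamma (s * t) g = pow_gamma s g * pow_gamma t g"
  by (simp add: pow_gamma_def powr_mult)

text \<open>Gradients scale by \<open>k = t * r powr a\<close>, Hessians by
  \<open>m = t * r powr (a - 1)\<close>, and the radius cancels in
  \<open>pow_gamma k g * m = t powr (1 + g)\<close> since \<open>a * (1 + g) = 1\<close>.\<close>

lemma supersol_rescale:
  fixes u f :: "'a::euclidean_space \<Rightarrow> real"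
  assumes sup: "supersol lam bet g D u f" and g: "0 \<le> g" and a_def: "a = 1 / (1 + g)"
    and r: "0 < r" and t: "0 < t" and D': "\<And>y. y \<in> D' \<Longrightarrow> x0 + r *\<^sub>R y \<in> D"
  shows "supersol lam bet g D' (\<lambda>y. u (x0 + r *\<^sub>R y) / (t * r powr (1 + a))) (\<lambda>y. f (x0 + r *\<^sub>R y) / t powr (1 + g))"
  unfolding supersol_def
proof (intro ballI allI impI)
  fix y p e :: 'a and b c :: real
  define U where "U y = u (x0 + r *\<^sub>R y) / (t * r powr (1 + a))" for y
  define k where "k = t * r powr a"
  define m where "m = t * r powr (a - 1)"
  have k: "0 < k" "0 < m" "t * r powr (1 + a) = k * r" "k = m * r"
    using r t by (auto simp: k_def m_def powr_add powr_diff)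
  have km: "pow_gamma k g * m = t powr (1 + g)"
  proof (cases "g = 0")
    case True
    then show ?thesis using r t by (simp add: pow_gamma_def m_def a_def)
  next
    case False
    have "a * g + (a - 1) = 0" using g by (simp add: a_def field_simps)
    then have "r powr (a * g) * r powr (a - 1) = 1" using r by (simp flip: powr_add)
    moreover have "t powr g * t = t powr (1 + g)" using t by (simp add: powr_add)
    ultimately show ?thesis using False r t
      by (simp add: pow_gamma_def k_def m_def powr_mult powr_powr mult_ac)
  qed
  assume y: "y \<in> D'" and e: "norm e = 1" and b: "0 \<le> b" "b \<le> c"
    and ev: "\<forall>\<^sub>F z in nhds y. u (x0 + r *\<^sub>R y) / (t * r powr (1 + a)) + p \<bullet> (z - y) + c / 2 * (e \<bullet> (z - y))\<^sup>2 - b / 2 * (norm (z - y))\<^sup>2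
       \<le> u (x0 + r *\<^sub>R z) / (t * r powr (1 + a))"
  define x where "x = x0 + r *\<^sub>R y"
  have "((\<lambda>z. (z - x0) /\<^sub>R r) \<longlongrightarrow> (x - x0) /\<^sub>R r) (nhds x)" by (intro tendsto_intros filterlim_ident)
  then have "filterlim (\<lambda>z. (z - x0) /\<^sub>R r) (nhds y) (nhds x)" using r by (simp add: x_def)
  from eventually_compose_filterlim[OF ev this]
  have "\<forall>\<^sub>F z in nhds x. u x + (k *\<^sub>R p) \<bullet> (z - x) + (m * c) / 2 * (e \<bullet> (z - x))\<^sup>2 - (m * b) / 2 * (norm (z - x))\<^sup>2 \<le> u z"
  proof eventually_elim
    case (elim z)
    define w where "w = (z - x0) /\<^sub>R r"
    have z: "z = x0 + r *\<^sub>R w" using r by (simp add: w_def)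
    have zx: "z - x = r *\<^sub>R (w - y)" by (simp add: z x_def algebra_simps)
    have kr: "0 < k * r" using k r by simp
    have "u x / (k * r) + p \<bullet> (w - y) + c / 2 * (e \<bullet> (w - y))\<^sup>2 - b / 2 * (norm (w - y))\<^sup>2 \<le> u z / (k * r)"
      using elim unfolding w_def[symmetric] k(3) x_def[symmetric] z[symmetric] .
    then have "(k * r) * (u x / (k * r) + p \<bullet> (w - y) + c / 2 * (e \<bullet> (w - y))\<^sup>2 - b / 2 * (norm (w - y))\<^sup>2) \<le> (k * r) * (u z / (k * r))"
      using kr by (intro mult_left_mono) auto
    moreover have "(k * r) * (u z / (k * r)) = u z" "(k * r) * (u x / (k * r)) = u x" using kr by auto
    moreover have "(k *\<^sub>R p) \<bullet> (z - x) = (k * r) * (p \<bullet> (w - y))" by (simp add: zx)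
    moreover have "(m * c) / 2 * (e \<bullet> (z - x))\<^sup>2 = (k * r) * (c / 2 * (e \<bullet> (w - y))\<^sup>2)"
      "(m * b) / 2 * (norm (z - x))\<^sup>2 = (k * r) * (b / 2 * (norm (w - y))\<^sup>2)"
      using r by (auto simp: zx k(4) power2_eq_square)
    ultimately show ?case by (simp only: right_diff_distrib distrib_left)
  qed
  moreover have "x \<in> D" using D' y by (simp add: x_def)
  moreover have "0 \<le> m * b" "m * b \<le> m * c" using b k by auto
  ultimately have "pow_gamma (norm (k *\<^sub>R p)) g * (lam * (m * c - m * b) - bet * (m * b)) \<le> f x"
    using sup e unfolding supersol_def by blast
  moreover have "pow_gamma (norm (k *\<^sub>R p)) g = pow_gamma k g * pow_gamma (norm p) g"
    using k by (simp add: pow_gamma_mult)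
  moreover have "lam * (m * c - m * b) - bet * (m * b) = m * (lam * (c - b) - bet * b)"
    by (simp add: algebra_simps)
  ultimately have "(pow_gamma k g * m) * (pow_gamma (norm p) g * (lam * (c - b) - bet * b)) \<le> f x"
    by (simp only: mult_ac)
  then have "t powr (1 + g) * (pow_gamma (norm p) g * (lam * (c - b) - bet * b)) \<le> f x" unfolding km .
  then show "pow_gamma (norm p) g * (lam * (c - b) - bet * b) \<le> f (x0 + r *\<^sub>R y) / t powr (1 + g)"
    using t by (simp add: x_def pos_le_divide_eq mult.commute)
qed

lemma nn_integral_lebesgue_scale_ball:
  fixes f :: "'a::euclidean_space \<Rightarrow> real"
  assumes r: "0 < r" and fc: "continuous_on (ball x0 (r * R)) f"
  shows "(\<integral>\<^sup>+x\<in>ball x0 (r * R). ennreal (f x) \<partial>lebesgue)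
     = ennreal (r ^ DIM('a)) * (\<integral>\<^sup>+y\<in>ball 0 R. ennreal (f (x0 + r *\<^sub>R y)) \<partial>lebesgue)"
proof -
  define h where "h x = ennreal (f x) * indicator (ball x0 (r * R)) x" for x
  have "(\<lambda>x. indicator (ball x0 (r * R)) x *\<^sub>R f x) \<in> borel_measurable borel"
    by (intro borel_measurable_continuous_on_indicator fc) (simp add: borel_open)
  then have "(\<lambda>x. ennreal (indicator (ball x0 (r * R)) x *\<^sub>R f x)) \<in> borel_measurable borel" by simp
  then have hm: "h \<in> borel_measurable borel"
    by (rule measurable_cong[THEN iffD1, rotated]) (auto simp: h_def indicator_def)
  have T: "(\<lambda>y. x0 + r *\<^sub>R y) \<in> borel_measurable borel" by simp
  have "(\<integral>\<^sup>+x\<in>ball x0 (r * R). ennreal (f x) \<partial>lebesgue) = integral\<^sup>N lborel h"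
    by (simp add: nn_integral_completion h_def[abs_def])
  also have "\<dots> = (\<integral>\<^sup>+x. \<bar>r\<bar> ^ DIM('a) * h x \<partial>distr lborel borel (\<lambda>y. x0 + r *\<^sub>R y))"
    using r hm by (subst lborel_affine[of r x0]) (auto simp: nn_integral_density)
  also have "\<dots> = (\<integral>\<^sup>+y. \<bar>r\<bar> ^ DIM('a) * h (x0 + r *\<^sub>R y) \<partial>lborel)"
    using hm by (subst nn_integral_distr) auto
  also have "\<dots> = ennreal (r ^ DIM('a)) * (\<integral>\<^sup>+y. h (x0 + r *\<^sub>R y) \<partial>lborel)"
    using r hm by (subst nn_integral_cmult) (auto simp: ennreal_power)
  also have "(\<integral>\<^sup>+y. h (x0 + r *\<^sub>R y) \<partial>lborel) = (\<integral>\<^sup>+y\<in>ball 0 R. ennreal (f (x0 + r *\<^sub>R y)) \<partial>lborel)"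
    using r by (intro nn_integral_cong) (auto simp: h_def indicator_def dist_norm)
  finally show ?thesis by (simp add: nn_integral_completion)
qed

text \<open>Instead of assuming \<open>f\<close> small, the second alternative records its failure
  to be small on one ball as a lower bound for the integral there, in a form that can be summed over
  disjoint balls.\<close>

lemma touch_density:
  fixes lam bet g a :: real
  assumes lam: "0 < lam" and bet: "0 \<le> bet" and g: "0 \<le> g" and a_def: "a = 1 / (1 + g)"
  obtains B c :: real where "1 \<le> B" "0 < c"
    "\<And>(u::'a::euclidean_space \<Rightarrow> real) f M x0 x1 r t.
      continuous_on (ball 0 1) u \<Longrightarrow> (\<And>x. x \<in> ball 0 1 \<Longrightarrow> \<bar>u x\<bar> \<le> M) \<Longrightarrow>
      continuous_on (ball 0 1) f \<Longrightarrow> (\<And>x. x \<in> ball 0 1 \<Longrightarrow> 0 \<le> f x) \<Longrightarrow>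
      supersol lam bet g (ball 0 1) u f \<Longrightarrow> 0 < r \<Longrightarrow> 0 < t \<Longrightarrow> cball x0 (r * 3) \<subseteq> ball 0 1 \<Longrightarrow>
      x1 \<in> touch a t u \<Longrightarrow> dist x0 x1 \<le> 2 * r \<Longrightarrow>
      ennreal (c * r ^ DIM('a)) \<le> emeasure lebesgue (touch a (B * t) u \<inter> ball x0 r) \<or>
      ennreal (c * r ^ DIM('a) * (t powr (1 + g)) ^ DIM('a)) \<le> (\<integral>\<^sup>+x\<in>ball x0 (r * 3). ennreal (f x ^ DIM('a)) \<partial>lebesgue)"
proof -
  let ?n = "DIM('a)"
  have a: "0 < a" "a \<le> 1" using g by (auto simp: a_def)
  obtain B c where B: "1 \<le> B" "0 < c" and unit:
    "\<And>(u::'a::euclidean_space \<Rightarrow> real) f P x1 G.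
      continuous_on (cball 0 3) u \<Longrightarrow> continuous_on (ball 0 3) f \<Longrightarrow> (\<And>x. x \<in> ball 0 3 \<Longrightarrow> 0 \<le> f x) \<Longrightarrow>
      supersol lam bet g (ball 0 3) u f \<Longrightarrow> norm x1 \<le> 2 \<Longrightarrow>
      (\<And>z. z \<in> cball 0 3 \<Longrightarrow> u x1 + P \<bullet> (z - x1) - norm (z - x1) powr (1 + a) \<le> u z) \<Longrightarrow>
      (\<integral>\<^sup>+x\<in>ball 0 3. ennreal (f x ^ DIM('a)) \<partial>lebesgue) \<le> ennreal c \<Longrightarrow>
      G \<in> sets lebesgue \<Longrightarrow> G \<subseteq> ball 0 3 \<Longrightarrow>
      (\<And>x q. x \<in> ball 0 1 \<Longrightarrow>
        (\<And>z. u x1 + P \<bullet> (z - x1) - norm (z - x1) powr (1 + a) \<le> u z \<Longrightarrow>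
            u x + q \<bullet> (z - x) - B * norm (z - x) powr (1 + a) \<le> u z) \<Longrightarrow> x \<in> G) \<Longrightarrow>
      ennreal c \<le> emeasure lebesgue G"
    by (rule unit_scale_density[OF lam bet g a_def, where 'a='a]) blast
  show ?thesis
  proof (rule that[OF B])
    fix u f :: "'a \<Rightarrow> real" and M x0 x1 r t
    assume uc: "continuous_on (ball 0 1) u" and M: "\<And>x. x \<in> ball 0 1 \<Longrightarrow> \<bar>u x\<bar> \<le> M"
      and fc: "continuous_on (ball 0 1) f" and f0: "\<And>x. x \<in> ball 0 1 \<Longrightarrow> 0 \<le> f x"
      and sup: "supersol lam bet g (ball 0 1) u f" and r: "0 < r" and t: "0 < t"
      and sub: "cball x0 (r * 3) \<subseteq> ball 0 1" and x1: "x1 \<in> touch a t u" and dx: "dist x0 x1 \<le> 2 * r"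
    define T where "T y = x0 + r *\<^sub>R y" for y
    define k where "k = t * r powr (1 + a)"
    have k: "0 < k" using r t by (simp add: k_def)
    define U where "U y = u (T y) / k" for y
    define F where "F y = f (T y) / t powr (1 + g)" for y
    have T3: "T y \<in> ball 0 1" if "y \<in> cball 0 3" for y
    proof -
      have "dist x0 (T y) = r * norm y" using r by (simp add: T_def dist_norm)
      also have "\<dots> \<le> r * 3" using that r by (intro mult_left_mono) auto
      finally show ?thesis using sub by auto
    qed
    have Tc: "continuous_on S T" for S unfolding T_def by (intro continuous_intros)
    have Td: "T z - T y = r *\<^sub>R (z - y)" for z y by (simp add: T_def algebra_simps)
    define y1 where "y1 = (x1 - x0) /\<^sub>R r"
    have y1: "T y1 = x1" using r by (simp add: T_def y1_def)
    have nd: "norm ((x - x0) /\<^sub>R r) = dist x0 x / r" for x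
      using r by (simp add: dist_norm norm_minus_commute divide_inverse mult.commute)
    have ny1: "norm y1 \<le> 2"
      using dx r by (simp add: y1_def nd pos_divide_le_eq del: norm_scaleR)
    obtain p where p: "\<And>z. z \<in> ball 0 1 \<Longrightarrow> u x1 + p \<bullet> (z - x1) - t * norm (z - x1) powr (1 + a) \<le> u z"
      using x1 unfolding touch_def by blast
    define P where "P = (r / k) *\<^sub>R p"
    have scale: "u x + w \<bullet> (T z - x) - s * t * norm (T z - x) powr (1 + a)
        = k * (U y + ((r / k) *\<^sub>R w) \<bullet> (z - y) - s * norm (z - y) powr (1 + a))"
      if "x = T y" for x y w z s
    proof -
      have "t * norm (T z - x) powr (1 + a) = k * norm (z - y) powr (1 + a)"
        using r by (simp add: that Td powr_mult k_def)
      moreover have "w \<bullet> (T z - x) = k * (((r / k) *\<^sub>R w) \<bullet> (z - y))" using k by (simp add: that Td)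
      moreover have "u x = k * U y" using k by (simp add: U_def that)
      ultimately show ?thesis by (simp only: mult.assoc right_diff_distrib distrib_left mult.left_commute[of s k])
    qed
    have Ulow: "U y1 + P \<bullet> (z - y1) - norm (z - y1) powr (1 + a) \<le> U z" if "T z \<in> ball 0 1" for z
    proof -
      have "k * (U y1 + P \<bullet> (z - y1) - 1 * norm (z - y1) powr (1 + a)) \<le> u (T z)"
        using p[OF that] scale[OF y1[symmetric], of p z 1] by (simp add: P_def)
      then show ?thesis using k by (simp add: U_def pos_le_divide_eq mult.commute)
    qed
    define G where "G = T -` touch a (B * t) u \<inter> ball 0 1"
    have tb: "touch a (B * t) u \<in> sets borel"
      by (rule borel_touch[OF open_ball_diff_touch[OF a(1) uc M]])
    have G: "G \<in> sets borel"
    proof -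
      have "T \<in> borel_measurable borel" by (rule borel_measurable_continuous_onI[OF Tc])
      from measurable_sets[OF this tb] have "T -` touch a (B * t) u \<in> sets borel" by simp
      then show ?thesis unfolding G_def by (intro sets.Int) (auto simp: borel_open)
    qed
    have TG: "touch a (B * t) u \<inter> ball x0 r = (\<lambda>y. r *\<^sub>R y + x0) ` G"
    proof (intro set_eqI iffI)
      fix x assume x: "x \<in> touch a (B * t) u \<inter> ball x0 r"
      define y where "y = (x - x0) /\<^sub>R r"
      have "T y = x" using r by (simp add: T_def y_def)
      moreover have "norm y < 1" using x r by (simp add: y_def nd del: norm_scaleR)
      ultimately show "x \<in> (\<lambda>y. r *\<^sub>R y + x0) ` G"
        using x by (intro image_eqI[of _ _ y]) (auto simp: G_def T_def add.commute)
    qed (use r in \<open>auto simp: G_def T_def dist_norm add.commute\<close>)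
    have Ic: "(\<integral>\<^sup>+x\<in>ball x0 (r * 3). ennreal (f x ^ ?n) \<partial>lebesgue)
       = ennreal (r ^ ?n) * (\<integral>\<^sup>+y\<in>ball 0 3. ennreal (f (T y) ^ ?n) \<partial>lebesgue)"
      unfolding T_def
      by (intro nn_integral_lebesgue_scale_ball r continuous_intros continuous_on_subset[OF fc])
        (use sub ball_subset_cball in blast)
    have FT: "(\<integral>\<^sup>+y\<in>ball 0 3. ennreal (f (T y) ^ ?n) \<partial>lebesgue)
        = ennreal ((t powr (1 + g)) ^ ?n) * (\<integral>\<^sup>+y\<in>ball 0 3. ennreal (F y ^ ?n) \<partial>lebesgue)"
    proof -
      have Fc: "continuous_on (ball 0 3) (\<lambda>y. F y ^ ?n)"
        unfolding F_def using T3 t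
        by (intro continuous_intros continuous_on_compose2[OF fc Tc]) auto
      have "(\<lambda>y. indicator (ball 0 3) y *\<^sub>R F y ^ ?n) \<in> borel_measurable borel"
        by (intro borel_measurable_continuous_on_indicator Fc) (simp add: borel_open)
      then have "(\<lambda>y. ennreal (indicator (ball 0 3) y *\<^sub>R F y ^ ?n)) \<in> borel_measurable borel" by simp
      then have m: "(\<lambda>y. ennreal (F y ^ ?n) * indicator (ball 0 3) y) \<in> borel_measurable borel"
        by (rule measurable_cong[THEN iffD1, rotated]) (auto simp: indicator_def)
      have "f (T y) ^ ?n = (t powr (1 + g)) ^ ?n * F y ^ ?n" for y
        using t by (simp add: F_def power_divide)
      then have "ennreal (f (T y) ^ ?n) = ennreal ((t powr (1 + g)) ^ ?n) * ennreal (F y ^ ?n)" for y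
        by (simp add: ennreal_mult')
      then show ?thesis using m
        by (simp add: nn_integral_completion nn_integral_cmult mult.assoc)
    qed
    let ?I = "\<integral>\<^sup>+y\<in>ball 0 3. ennreal (F y ^ ?n) \<partial>lebesgue"
    show "ennreal (c * r ^ ?n) \<le> emeasure lebesgue (touch a (B * t) u \<inter> ball x0 r) \<or>
      ennreal (c * r ^ ?n * (t powr (1 + g)) ^ ?n) \<le> (\<integral>\<^sup>+x\<in>ball x0 (r * 3). ennreal (f x ^ ?n) \<partial>lebesgue)"
    proof (cases "?I \<le> ennreal c")
      case True
      have "ennreal c \<le> emeasure lebesgue G"
      proof (rule unit[OF _ _ _ _ ny1 _ True])
        show "continuous_on (cball 0 3) U" unfolding U_def using T3 k
          by (intro continuous_intros continuous_on_compose2[OF uc Tc]) auto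
        show "continuous_on (ball 0 3) F" unfolding F_def using T3 t
          by (intro continuous_intros continuous_on_compose2[OF fc Tc]) auto
        show "0 \<le> F y" if "y \<in> ball 0 3" for y using f0[of "T y"] T3[of y] that by (simp add: F_def)
        show "supersol lam bet g (ball 0 3) U F"
          unfolding U_def F_def T_def k_def
          using T3 by (intro supersol_rescale[OF sup g a_def r t]) (auto simp: T_def)
        show "U y1 + P \<bullet> (z - y1) - norm (z - y1) powr (1 + a) \<le> U z" if "z \<in> cball 0 3" for z
          by (rule Ulow[OF T3[OF that]])
        show "G \<in> sets lebesgue" using G by simp
        show "G \<subseteq> ball 0 3" by (auto simp: G_def)
        fix y q assume y: "y \<in> ball (0::'a) 1"
          and q: "\<And>z. U y1 + P \<bullet> (z - y1) - norm (z - y1) powr (1 + a) \<le> U z \<Longrightarrow>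
            U y + q \<bullet> (z - y) - B * norm (z - y) powr (1 + a) \<le> U z"
        have "u (T y) + ((k / r) *\<^sub>R q) \<bullet> (x - T y) - (B * t) * norm (x - T y) powr (1 + a) \<le> u x"
          if x: "x \<in> ball 0 1" for x
        proof -
          define z where "z = (x - x0) /\<^sub>R r"
          have z: "x = T z" using r by (simp add: T_def z_def)
          have "U y + q \<bullet> (z - y) - B * norm (z - y) powr (1 + a) \<le> U z"
            using q[OF Ulow] x z by simp
          then have "k * (U y + ((r / k) *\<^sub>R ((k / r) *\<^sub>R q)) \<bullet> (z - y) - B * norm (z - y) powr (1 + a)) \<le> k * U z"
            using k r by simp
          also have "k * U z = u x" using k by (simp add: U_def z)
          finally show ?thesis unfolding z scale[OF refl, of y "(k / r) *\<^sub>R q" z B, symmetric] .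
        qed
        moreover have "T y \<in> ball 0 1" using T3[of y] y by simp
        ultimately have "T y \<in> touch a (B * t) u" unfolding touch_def by blast
        then show "y \<in> G" using y by (simp add: G_def)
      qed
      then have "ennreal (r ^ ?n) * ennreal c \<le> ennreal (r ^ ?n) * emeasure lebesgue G"
        by (rule mult_left_mono) simp
      also have "\<dots> = emeasure lebesgue ((\<lambda>y. r *\<^sub>R y + x0) ` G)"
        unfolding emeasure_lebesgue_affine using r by (simp add: ennreal_power)
      finally show ?thesis using r B by (simp add: TG ennreal_mult' mult.commute)
    next
      case False
      then have "ennreal (r ^ ?n) * (ennreal ((t powr (1 + g)) ^ ?n) * ennreal c)
        \<le> ennreal (r ^ ?n) * (ennreal ((t powr (1 + g)) ^ ?n) * ?I)"
        by (intro mult_left_mono) auto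
      then have "ennreal (r ^ ?n) * (ennreal ((t powr (1 + g)) ^ ?n) * ennreal c) \<le> (\<integral>\<^sup>+x\<in>ball x0 (r * 3). ennreal (f x ^ ?n) \<partial>lebesgue)"
        unfolding Ic FT .
      moreover have "ennreal (r ^ ?n) * (ennreal ((t powr (1 + g)) ^ ?n) * ennreal c) = ennreal (c * r ^ ?n * (t powr (1 + g)) ^ ?n)"
        using r t B by (simp add: ennreal_mult'[symmetric] mult_ac)
      ultimately show ?thesis by simp
    qed
  qed
qed

section \<open>Geometric decay\<close>

text \<open>The recursion reads \<open>E (Suc k) <= (1 - 1 / K) * E k + (D0 / K) * q ^ k\<close>.
  Any \<mu> above \<open>1 - 1 / K\<close> and not below \<open>q\<close> leaves room for the
  forcing term; in the proof \<open>m\<close> measures this room and fixes the size of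
  \<open>D\<close>.\<close>

lemma geometric_decay:
  fixes E :: "nat \<Rightarrow> real"
  assumes rec: "\<And>k. E k \<le> K * (E k - E (Suc k)) + D0 * q ^ k"
    and K: "1 \<le> K" and D0: "0 \<le> D0" and q: "0 \<le> q" "q \<le> \<mu>" and mu: "1 - 1 / K < \<mu>" and E0: "0 \<le> E 0"
  shows "\<exists>D\<ge>0. \<forall>k. E k \<le> D * \<mu> ^ k"
proof -
  define m where "m = K * \<mu> - (K - 1)"
  have "K * (1 - 1 / K) < K * \<mu>" using mu K by (intro mult_strict_left_mono) auto
  then have m: "0 < m" using K by (simp add: m_def right_diff_distrib)
  define D where "D = E 0 + D0 / m"
  have D: "0 \<le> D" "E 0 \<le> D" "D0 \<le> D * m"
    using E0 D0 m by (auto simp: D_def distrib_right)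
  have mu0: "0 \<le> \<mu>" using q by linarith
  have "E k \<le> D * \<mu> ^ k" for k
  proof (induction k)
    case (Suc k)
    have "K * E (Suc k) \<le> (K - 1) * E k + D0 * q ^ k" using rec[of k] by (simp add: algebra_simps)
    also have "(K - 1) * E k \<le> (K - 1) * (D * \<mu> ^ k)" using Suc K by (intro mult_left_mono) auto
    also have "D0 * q ^ k \<le> (D * m) * \<mu> ^ k"
      using power_mono[OF q(2,1), of k] D D0 q by (intro mult_mono[OF D(3)]) auto
    also have "(K - 1) * (D * \<mu> ^ k) + (D * m) * \<mu> ^ k = K * (D * \<mu> ^ Suc k)"
      by (simp add: m_def algebra_simps)
    finally have "K * E (Suc k) \<le> K * (D * \<mu> ^ Suc k)" by simp
    then show ?case using K by (simp only: mult_le_cancel_left_pos)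
  qed (use D in simp)
  then show ?thesis using D by blast
qed

text \<open>A cusp of opening \<open>t / 6\<close> with vertex \<open>x\<close> touches
  \<open>u\<close> within distance \<open>R\<close>, by comparison with the oscillation
  \<open>2 * M\<close>. The factor 6 of \<open>norm_powr_le_holder\<close> turns it into a cusp of
  opening \<open>t\<close> centred at the contact point.\<close>

lemma exists_touch_near:
  fixes u :: "'a::euclidean_space \<Rightarrow> real"
  assumes a: "0 < a" "a \<le> 1" and uc: "continuous_on (cball 0 1) u"
    and M: "\<And>x. x \<in> cball 0 1 \<Longrightarrow> \<bar>u x\<bar> \<le> M" and t: "0 < t"
    and R: "R = (12 * M / t) powr (1 / (1 + a))" and x: "norm x + R < 1"
  shows "\<exists>x1 \<in> touch a t u. dist x x1 \<le> R"
proof -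
  define s where "s = t / 6"
  have s: "0 < s" using t by (simp add: s_def)
  have R0: "0 \<le> R" by (simp add: R)
  have xb: "x \<in> cball 0 1" using x R0 by simp
  define w where "w z = u z + s * norm (z - x) powr (1 + a)" for z
  have "continuous_on (cball 0 1) w" unfolding w_def using a
    by (intro continuous_intros uc continuous_on_powr') auto
  then obtain x1 where x1: "x1 \<in> cball 0 1" and xmin: "\<And>z. z \<in> cball 0 1 \<Longrightarrow> w x1 \<le> w z"
    using continuous_attains_inf[OF compact_cball, of 0 1 w] xb by blast
  have "w x1 \<le> w x" by (rule xmin[OF xb])
  then have "s * norm (x1 - x) powr (1 + a) \<le> 2 * M"
    using M[OF xb] M[OF x1] a by (simp add: w_def)
  then have "norm (x1 - x) powr (1 + a) \<le> 12 * M / t"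
    using t pos_le_divide_eq[OF t, of "norm (x1 - x) powr (1 + a)" "12 * M"] by (simp add: s_def mult.commute)
  then have "(norm (x1 - x) powr (1 + a)) powr (1 / (1 + a)) \<le> R"
    unfolding R using a by (intro powr_mono2) auto
  then have d: "norm (x1 - x) \<le> R" using a by (simp add: powr_powr)
  have "x1 \<in> ball 0 1" using d x norm_triangle_sub[of x1 x] by simp
  moreover have "u x1 + (- (s * (1 + a)) *\<^sub>R vpow a (x1 - x)) \<bullet> (z - x1) - t * norm (z - x1) powr (1 + a) \<le> u z"
    if z: "z \<in> ball 0 1" for z
  proof -
    have "norm (z - x) powr (1 + a) \<le> norm (x1 - x) powr (1 + a) + (1 + a) * (vpow a (x1 - x) \<bullet> (z - x1)) + 6 * norm (z - x1) powr (1 + a)"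
      using norm_powr_le_holder[OF a, of "x1 - x" "z - x1"] by simp
    then have "s * norm (z - x) powr (1 + a) \<le> s * (norm (x1 - x) powr (1 + a) + (1 + a) * (vpow a (x1 - x) \<bullet> (z - x1)) + 6 * norm (z - x1) powr (1 + a))"
      using s by (intro mult_left_mono) auto
    also have "\<dots> = s * norm (x1 - x) powr (1 + a) - (- (s * (1 + a)) *\<^sub>R vpow a (x1 - x)) \<bullet> (z - x1) + t * norm (z - x1) powr (1 + a)"
      by (simp add: s_def algebra_simps add_divide_distrib)
    finally show ?thesis using xmin[of z] z unfolding w_def by simp
  qed
  ultimately have "x1 \<in> touch a t u" unfolding touch_def by blast
  then show ?thesis using d by (auto simp: dist_norm norm_minus_commute)
qed

text \<open>Vitali covering by balls of radius \<open>3 r\<close>, where \<open>r\<close> is the distance to \<open>touch a t u\<close>: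
  the touching points of opening \<open>B t\<close> found in the ball of radius \<open>r\<close> are new.\<close>
lemma touch_decay_step:
  fixes lam bet g a :: real
  assumes lam: "0 < lam" and bet: "0 \<le> bet" and g: "0 \<le> g" and a_def: "a = 1 / (1 + g)"
  obtains B K :: real where "1 \<le> B" "0 < K"
    "\<And>(u::'a::euclidean_space \<Rightarrow> real) f M t R.
      continuous_on (cball 0 1) u \<Longrightarrow> (\<And>x. x \<in> cball 0 1 \<Longrightarrow> \<bar>u x\<bar> \<le> M) \<Longrightarrow>
      continuous_on (ball 0 1) f \<Longrightarrow> (\<And>x. x \<in> ball 0 1 \<Longrightarrow> 0 \<le> f x) \<Longrightarrow>
      supersol lam bet g (ball 0 1) u f \<Longrightarrow> 0 < t \<Longrightarrow> R = (12 * M / t) powr (1 / (1 + a)) \<Longrightarrow>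
      emeasure lebesgue (ball 0 (1 - 10 * R) - touch a t u) \<le>
        ennreal K * (emeasure lebesgue (touch a (B * t) u - touch a t u) +
          ennreal (1 / (t powr (1 + g)) ^ DIM('a)) * (\<integral>\<^sup>+x\<in>ball 0 1. ennreal (f x ^ DIM('a)) \<partial>lebesgue))"
proof -
  let ?n = "DIM('a)"
  have a: "0 < a" "a \<le> 1" using g by (auto simp: a_def)
  obtain B c :: real where B: "1 \<le> B" "0 < c" and dens:
    "\<And>(u::'a::euclidean_space \<Rightarrow> real) f M x0 x1 r t.
      continuous_on (ball 0 1) u \<Longrightarrow> (\<And>x. x \<in> ball 0 1 \<Longrightarrow> \<bar>u x\<bar> \<le> M) \<Longrightarrow>
      continuous_on (ball 0 1) f \<Longrightarrow> (\<And>x. x \<in> ball 0 1 \<Longrightarrow> 0 \<le> f x) \<Longrightarrow>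
      supersol lam bet g (ball 0 1) u f \<Longrightarrow> 0 < r \<Longrightarrow> 0 < t \<Longrightarrow> cball x0 (r * 3) \<subseteq> ball 0 1 \<Longrightarrow>
      x1 \<in> touch a t u \<Longrightarrow> dist x0 x1 \<le> 2 * r \<Longrightarrow>
      ennreal (c * r ^ DIM('a)) \<le> emeasure lebesgue (touch a (B * t) u \<inter> ball x0 r) \<or>
      ennreal (c * r ^ DIM('a) * (t powr (1 + g)) ^ DIM('a)) \<le> (\<integral>\<^sup>+x\<in>ball x0 (r * 3). ennreal (f x ^ DIM('a)) \<partial>lebesgue)"
    by (rule touch_density[OF lam bet g a_def, where 'a='a]) blast
  \<comment> \<open>15 is the Vitali factor 5 times the 3 in the radius \<open>3 * r\<close> of the
    balls on which \<open>f\<close> is integrated.\<close>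
  define K where "K = unit_ball_vol (real ?n) * 15 ^ ?n / c"
  have K: "0 < K" using B by (simp add: K_def)
  show ?thesis
  proof (rule that[OF B(1) K])
    fix u f :: "'a \<Rightarrow> real" and M t R
    assume uc: "continuous_on (cball 0 1) u" and M: "\<And>x. x \<in> cball 0 1 \<Longrightarrow> \<bar>u x\<bar> \<le> M"
      and fc: "continuous_on (ball 0 1) f" and f0: "\<And>x. x \<in> ball 0 1 \<Longrightarrow> 0 \<le> f x"
      and sup: "supersol lam bet g (ball 0 1) u f" and t: "0 < t"
      and R: "R = (12 * M / t) powr (1 / (1 + a))"
    have uc': "continuous_on (ball 0 1) u" using uc by (rule continuous_on_subset) auto
    have M': "\<bar>u x\<bar> \<le> M" if "x \<in> ball 0 1" for x using M that by simp
    have tm: "touch a s u \<in> sets borel" for s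
      by (rule borel_touch[OF open_ball_diff_touch[OF a(1) uc' M']])
    define \<tau> where "\<tau> = (t powr (1 + g)) ^ ?n"
    have tau: "0 < \<tau>" using t by (simp add: \<tau>_def)
    \<comment> \<open>The removed strip leaves room for the balls of radius \<open>3 * r\<close>
      with \<open>r <= R\<close> and for the contact point of
      \<open>exists_touch_near\<close>.\<close>
    define S where "S = ball 0 (1 - 10 * R) - touch a t u"
    define N where "N = touch a (B * t) u - touch a t u"
    have Nm: "N \<in> sets lebesgue" using tm by (simp add: N_def)
    define h where "h z = ennreal (f z ^ ?n) * indicator (ball 0 1) z" for z
    have hm: "h \<in> borel_measurable lebesgue"
    proof -
      have "(\<lambda>x. indicator (ball 0 1) x *\<^sub>R f x ^ ?n) \<in> borel_measurable borel"
        by (intro borel_measurable_continuous_on_indicator continuous_intros fc) (simp add: borel_open)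
      then have "(\<lambda>x. ennreal (indicator (ball 0 1) x *\<^sub>R f x ^ ?n)) \<in> borel_measurable borel" by simp
      then have "h \<in> borel_measurable borel"
        by (rule measurable_cong[THEN iffD1, rotated]) (auto simp: h_def indicator_def)
      then show ?thesis by (simp add: measurable_completion)
    qed
    \<comment> \<open>Each disjoint ball pays with the part of this density that it carries: new
      touching points, or the integral of \<open>f^n\<close> divided by the power \<tau> of
      \<open>t\<close>.\<close>
    define H where "H z = ennreal K * (indicator N z + ennreal (1 / \<tau>) * h z)" for z
    have Hm: "H \<in> borel_measurable lebesgue" unfolding H_def using Nm hm by measurable
    define \<nu> where "\<nu> = density lebesgue H"
    have R0: "0 \<le> R" by (simp add: R)
    have "\<exists>r. 0 < r \<and> r \<le> R \<and> cball x (r * 3) \<subseteq> ball 0 1 \<and> ball x r \<inter> touch a t u = {} \<and>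
        (\<exists>x1\<in>touch a t u. dist x x1 \<le> 2 * r)" if x: "x \<in> S" for x
    proof -
      have nx: "norm x < 1 - 10 * R" using x by (simp add: S_def)
      obtain x1 where x1: "x1 \<in> touch a t u" "dist x x1 \<le> R"
        using exists_touch_near[OF a uc M t R, of x] nx R0 by auto
      then have ne: "touch a t u \<noteq> {}" by auto
      define r where "r = infdist x (touch a t u)"
      have "x \<in> ball 0 1 - touch a t u" using x nx R0 by (auto simp: S_def)
      \<comment> \<open>The set of touching points is closed only relative to the unit ball;
        openness of its complement there gives the positive distance.\<close>
      then obtain e where e: "0 < e" "ball x e \<subseteq> ball 0 1 - touch a t u"
        using open_ball_diff_touch[OF a(1) uc' M', of t] open_contains_ball by blast
      have "e \<le> r"
        unfolding r_def infdist_notempty[OF ne] using e(2) by (intro cINF_greatest ne) (force simp: not_less[symmetric])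
      then have r0: "0 < r" using e by simp
      have rR: "r \<le> R" using infdist_le[OF x1(1), of x] x1(2) by (simp add: r_def)
      \<comment> \<open>The infimum may not be attained, hence the factor 2 in the distance to
        \<open>x1\<close>.\<close>
      have "bdd_below (dist x ` touch a t u)" by (auto intro: bdd_belowI[of _ 0])
      moreover have "(INF x1\<in>touch a t u. dist x x1) < 2 * r"
        using r0 by (simp add: r_def infdist_notempty[OF ne])
      ultimately have "\<exists>x1\<in>touch a t u. dist x x1 < 2 * r"
        using cINF_less_iff[OF ne] by blast
      moreover have "cball x (r * 3) \<subseteq> ball 0 1"
      proof
        fix z assume "z \<in> cball x (r * 3)"
        then have "norm (z - x) \<le> r * 3" by (simp add: dist_norm norm_minus_commute)
        then show "z \<in> ball 0 1" using nx rR R0 norm_triangle_sub[of z x] by simp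
      qed
      moreover have "ball x r \<inter> touch a t u = {}"
        using infdist_le[of _ "touch a t u" x] by (force simp: r_def)
      ultimately show ?thesis using r0 rR by (intro exI[of _ r]) (auto intro: less_imp_le)
    qed
    then have "\<forall>x\<in>S. \<exists>r. 0 < r \<and> r \<le> R \<and> cball x (r * 3) \<subseteq> ball 0 1 \<and> ball x r \<inter> touch a t u = {} \<and>
        (\<exists>x1\<in>touch a t u. dist x x1 \<le> 2 * r)" by blast
    from bchoice[OF this] obtain r where r: "\<And>x. x \<in> S \<Longrightarrow> 0 < r x \<and> r x \<le> R"
      and rb: "\<And>x. x \<in> S \<Longrightarrow> cball x (r x * 3) \<subseteq> ball 0 1" "\<And>x. x \<in> S \<Longrightarrow> ball x (r x) \<inter> touch a t u = {}"
      and rx: "\<And>x. x \<in> S \<Longrightarrow> \<exists>x1\<in>touch a t u. dist x x1 \<le> 2 * r x"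
      by blast
    have "emeasure lebesgue S \<le> emeasure \<nu> (ball 0 1)"
    proof (rule vitali_emeasure_le[where r="\<lambda>x. r x * 3" and R="R * 3" and S=S and Q="\<lambda>x. cball x (5 * (r x * 3))"])
      fix x assume x: "x \<in> S"
      have r0: "0 < r x" using r[OF x] by simp
      obtain x1 where x1: "x1 \<in> touch a t u" "dist x x1 \<le> 2 * r x" using rx[OF x] by blast
      have m1: "(\<lambda>z. indicator (N \<inter> cball x (r x * 3)) z :: ennreal) \<in> borel_measurable lebesgue"
        using Nm by (intro borel_measurable_indicator) auto
      have m2: "(\<lambda>z. h z * indicator (cball x (r x * 3)) z) \<in> borel_measurable lebesgue"
        by (intro borel_measurable_times_ennreal hm borel_measurable_indicator) simp
      note m3 = borel_measurable_times_ennreal[OF borel_measurable_const[of "ennreal (1 / \<tau>)"] m2]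
      have one: "emeasure \<nu> (cball x (r x * 3)) = ennreal K *
          (emeasure lebesgue (N \<inter> cball x (r x * 3)) + ennreal (1 / \<tau>) * (\<integral>\<^sup>+z. h z * indicator (cball x (r x * 3)) z \<partial>lebesgue))"
      proof -
        have "emeasure \<nu> (cball x (r x * 3)) = (\<integral>\<^sup>+z. H z * indicator (cball x (r x * 3)) z \<partial>lebesgue)"
          unfolding \<nu>_def by (intro emeasure_density Hm) simp
        also have "\<dots> = (\<integral>\<^sup>+z. ennreal K * (indicator (N \<inter> cball x (r x * 3)) z + ennreal (1 / \<tau>) * (h z * indicator (cball x (r x * 3)) z)) \<partial>lebesgue)"
          by (intro nn_integral_cong) (auto simp: H_def indicator_def)
        also have "\<dots> = ennreal K * (\<integral>\<^sup>+z. (indicator (N \<inter> cball x (r x * 3)) z + ennreal (1 / \<tau>) * (h z * indicator (cball x (r x * 3)) z)) \<partial>lebesgue)"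
          by (rule nn_integral_cmult[OF borel_measurable_add[OF m1 m3]])
        also have "(\<integral>\<^sup>+z. (indicator (N \<inter> cball x (r x * 3)) z + ennreal (1 / \<tau>) * (h z * indicator (cball x (r x * 3)) z)) \<partial>lebesgue)
          = (\<integral>\<^sup>+z. indicator (N \<inter> cball x (r x * 3)) z \<partial>lebesgue) + (\<integral>\<^sup>+z. ennreal (1 / \<tau>) * (h z * indicator (cball x (r x * 3)) z) \<partial>lebesgue)"
          by (rule nn_integral_add[OF m1 m3])
        also have "(\<integral>\<^sup>+z. ennreal (1 / \<tau>) * (h z * indicator (cball x (r x * 3)) z) \<partial>lebesgue) = ennreal (1 / \<tau>) * (\<integral>\<^sup>+z. h z * indicator (cball x (r x * 3)) z \<partial>lebesgue)"
          by (rule nn_integral_cmult[OF m2])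
        also have "(\<integral>\<^sup>+z. indicator (N \<inter> cball x (r x * 3)) z \<partial>lebesgue) = emeasure lebesgue (N \<inter> cball x (r x * 3))"
          by (intro nn_integral_indicator sets.Int Nm) simp
        finally show ?thesis .
      qed
      have "emeasure lebesgue (cball x (5 * (r x * 3))) = ennreal K * ennreal (c * r x ^ ?n)"
        using r0 B by (subst emeasure_lebesgue_cball)
          (auto simp: K_def ennreal_mult'[symmetric] power_mult_distrib mult_ac)
      also have "ennreal (c * r x ^ ?n) \<le> emeasure lebesgue (N \<inter> cball x (r x * 3)) + ennreal (1 / \<tau>) * (\<integral>\<^sup>+z. h z * indicator (cball x (r x * 3)) z \<partial>lebesgue)"
        using dens[OF uc' M' fc f0 sup r0 t rb(1)[OF x] x1]
      proof
        assume "ennreal (c * r x ^ ?n) \<le> emeasure lebesgue (touch a (B * t) u \<inter> ball x (r x))"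
        also have "\<dots> \<le> emeasure lebesgue (N \<inter> cball x (r x * 3))"
        proof (rule emeasure_mono)
          show "touch a (B * t) u \<inter> ball x (r x) \<subseteq> N \<inter> cball x (r x * 3)"
            using rb(2)[OF x] r0 by (auto simp: N_def)
        qed (use Nm in auto)
        finally show ?thesis by (meson add_increasing2 zero_le)
      next
        assume "ennreal (c * r x ^ ?n * (t powr (1 + g)) ^ ?n) \<le> (\<integral>\<^sup>+z\<in>ball x (r x * 3). ennreal (f z ^ ?n) \<partial>lebesgue)"
        also have "\<dots> \<le> (\<integral>\<^sup>+z. h z * indicator (cball x (r x * 3)) z \<partial>lebesgue)"
        proof (rule nn_integral_mono)
          fix z
          show "ennreal (f z ^ ?n) * indicator (ball x (r x * 3)) z \<le> h z * indicator (cball x (r x * 3)) z"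
          proof (cases "z \<in> ball x (r x * 3)")
            case True
            then have "z \<in> cball x (r x * 3)" by simp
            moreover from this have "z \<in> ball 0 1" using rb(1)[OF x] by blast
            ultimately show ?thesis using True by (simp add: h_def del: mem_ball mem_cball)
          qed simp
        qed
        finally have "ennreal (1 / \<tau>) * ennreal (c * r x ^ ?n * \<tau>) \<le> ennreal (1 / \<tau>) * (\<integral>\<^sup>+z. h z * indicator (cball x (r x * 3)) z \<partial>lebesgue)"
          unfolding \<tau>_def[symmetric] by (intro mult_left_mono) auto
        moreover have "ennreal (1 / \<tau>) * ennreal (c * r x ^ ?n * \<tau>) = ennreal (c * r x ^ ?n)"
          using tau by (simp add: ennreal_mult'[symmetric])
        ultimately have "ennreal (c * r x ^ ?n) \<le> ennreal (1 / \<tau>) * (\<integral>\<^sup>+z. h z * indicator (cball x (r x * 3)) z \<partial>lebesgue)"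
          by simp
        then show ?thesis by (rule add_increasing[OF zero_le])
      qed
      finally show "emeasure lebesgue (cball x (5 * (r x * 3))) \<le> emeasure \<nu> (cball x (r x * 3))"
        unfolding one by (simp add: mult_left_mono)
    next
      show "sets \<nu> = sets lebesgue" by (simp add: \<nu>_def)
    next
      fix x assume x: "x \<in> S"
      show "0 < r x * 3 \<and> r x * 3 \<le> R * 3" using r[OF x] by simp
      show "cball x (r x * 3) \<subseteq> ball 0 1" by (rule rb(1)[OF x])
    qed auto
    also have "emeasure \<nu> (ball 0 1) \<le> ennreal K * (emeasure lebesgue N + ennreal (1 / \<tau>) * integral\<^sup>N lebesgue h)"
    proof -
      have m1: "(\<lambda>z. indicator N z :: ennreal) \<in> borel_measurable lebesgue"
        using Nm by (intro borel_measurable_indicator)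
      note m3 = borel_measurable_times_ennreal[OF borel_measurable_const[of "ennreal (1 / \<tau>)"] hm]
      have "emeasure \<nu> (ball 0 1) = (\<integral>\<^sup>+z. H z * indicator (ball 0 1) z \<partial>lebesgue)"
        unfolding \<nu>_def by (intro emeasure_density Hm) (simp add: borel_open)
      also have "\<dots> \<le> (\<integral>\<^sup>+z. ennreal K * (indicator N z + ennreal (1 / \<tau>) * h z) \<partial>lebesgue)"
        by (intro nn_integral_mono) (auto simp: H_def indicator_def)
      also have "\<dots> = ennreal K * (\<integral>\<^sup>+z. (indicator N z + ennreal (1 / \<tau>) * h z) \<partial>lebesgue)"
        by (rule nn_integral_cmult[OF borel_measurable_add[OF m1 m3]])
      also have "(\<integral>\<^sup>+z. (indicator N z + ennreal (1 / \<tau>) * h z) \<partial>lebesgue) = (\<integral>\<^sup>+z. indicator N z \<partial>lebesgue) + (\<integral>\<^sup>+z. ennreal (1 / \<tau>) * h z \<partial>lebesgue)"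
        by (rule nn_integral_add[OF m1 m3])
      also have "(\<integral>\<^sup>+z. ennreal (1 / \<tau>) * h z \<partial>lebesgue) = ennreal (1 / \<tau>) * integral\<^sup>N lebesgue h"
        by (rule nn_integral_cmult[OF hm])
      finally show ?thesis using Nm by simp
    qed
    finally show "emeasure lebesgue (ball 0 (1 - 10 * R) - touch a t u) \<le>
        ennreal K * (emeasure lebesgue (touch a (B * t) u - touch a t u) +
          ennreal (1 / (t powr (1 + g)) ^ ?n) * (\<integral>\<^sup>+x\<in>ball 0 1. ennreal (f x ^ ?n) \<partial>lebesgue))"
      by (simp add: S_def N_def \<tau>_def h_def[abs_def])
  qed
qed

text \<open>At opening \<open>t * B ^ k\<close> the strip near the boundary has width of order
  \<open>R\<close> and the term with \<open>f\<close> carries a negative power of the opening; both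
  are at most multiples of \<open>(1 / sqrt B) ^ k\<close>, the strip because
  \<open>1 / (1 + a) >= 1/2\<close>. \<open>T\<close> may depend on \<open>u\<close>, while
  \<open>B\<close> and \<mu> are fixed before it.\<close>

lemma touch_decay:
  fixes lam bet g a :: real
  assumes lam: "0 < lam" and bet: "0 \<le> bet" and g: "0 \<le> g" and a_def: "a = 1 / (1 + g)"
  obtains B \<mu> :: real where "2 \<le> B" "0 < \<mu>" "\<mu> < 1"
    "\<And>(u::'a::euclidean_space \<Rightarrow> real) f.
      continuous_on (cball 0 1) u \<Longrightarrow>
      continuous_on (ball 0 1) f \<Longrightarrow> (\<And>x. x \<in> ball 0 1 \<Longrightarrow> 0 \<le> f x) \<Longrightarrow>
      (\<integral>\<^sup>+x\<in>ball 0 1. ennreal (f x ^ DIM('a)) \<partial>lebesgue) < \<infinity> \<Longrightarrow>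
      supersol lam bet g (ball 0 1) u f \<Longrightarrow>
      \<exists>T. \<forall>t\<ge>T. \<exists>D\<ge>0. \<forall>k. measure lebesgue (ball 0 1 - touch a (t * B ^ k) u) \<le> D * \<mu> ^ k"
proof -
  let ?n = "DIM('a)"
  have a: "0 < a" "a \<le> 1" using g by (auto simp: a_def)
  obtain B0 K0 :: real where B0: "1 \<le> B0" and K0: "0 < K0" and step:
    "\<And>(u::'a::euclidean_space \<Rightarrow> real) f M t R.
      continuous_on (cball 0 1) u \<Longrightarrow> (\<And>x. x \<in> cball 0 1 \<Longrightarrow> \<bar>u x\<bar> \<le> M) \<Longrightarrow>
      continuous_on (ball 0 1) f \<Longrightarrow> (\<And>x. x \<in> ball 0 1 \<Longrightarrow> 0 \<le> f x) \<Longrightarrow>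
      supersol lam bet g (ball 0 1) u f \<Longrightarrow> 0 < t \<Longrightarrow> R = (12 * M / t) powr (1 / (1 + a)) \<Longrightarrow>
      emeasure lebesgue (ball 0 (1 - 10 * R) - touch a t u) \<le>
        ennreal K0 * (emeasure lebesgue (touch a (B0 * t) u - touch a t u) +
          ennreal (1 / (t powr (1 + g)) ^ DIM('a)) * (\<integral>\<^sup>+x\<in>ball 0 1. ennreal (f x ^ DIM('a)) \<partial>lebesgue))"
    by (rule touch_decay_step[OF lam bet g a_def, where 'a='a]) blast
  \<comment> \<open>Doubling makes \<open>B\<close> at least 2, so that the openings grow
    geometrically; \<open>touch_mono\<close> allows the larger factor.\<close>
  define B where "B = 2 * B0"
  have B: "2 \<le> B" "B0 \<le> B" using B0 by (auto simp: B_def)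
  define K where "K = K0 + 1"
  have K: "1 \<le> K" "K0 \<le> K" using K0 by (auto simp: K_def)
  define q where "q = sqrt (1 / B)"
  have q: "0 < q" "q < 1" using B by (auto simp: q_def)
  define m where "m = max (1 - 1 / K) q"
  define \<mu> where "\<mu> = (1 + m) / 2"
  have "m < 1" "0 < m" "1 - 1 / K \<le> m" "q \<le> m" using q K by (auto simp: m_def)
  then have mu: "0 < \<mu>" "\<mu> < 1" "1 - 1 / K < \<mu>" "q \<le> \<mu>" by (simp_all add: \<mu>_def)
  show ?thesis
  proof (rule that[OF B(1) mu(1,2)])
    fix u f :: "'a \<Rightarrow> real"
    assume uc: "continuous_on (cball 0 1) u"
      and fc: "continuous_on (ball 0 1) f" and f0: "\<And>x. x \<in> ball 0 1 \<Longrightarrow> 0 \<le> f x"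
      and fin: "(\<integral>\<^sup>+x\<in>ball 0 1. ennreal (f x ^ ?n) \<partial>lebesgue) < \<infinity>"
      and sup: "supersol lam bet g (ball 0 1) u f"
    obtain I where I: "0 \<le> I" "(\<integral>\<^sup>+x\<in>ball 0 1. ennreal (f x ^ ?n) \<partial>lebesgue) = ennreal I"
      using fin by (cases "\<integral>\<^sup>+x\<in>ball 0 1. ennreal (f x ^ ?n) \<partial>lebesgue") auto
    have uc': "continuous_on (ball 0 1) u" using uc by (rule continuous_on_subset) auto
    have "bounded (u ` cball 0 1)" using uc by (intro compact_imp_bounded compact_continuous_image) auto
    then obtain M0 where M0: "\<And>x. x \<in> cball 0 1 \<Longrightarrow> \<bar>u x\<bar> \<le> M0"
      unfolding bounded_iff real_norm_def by blast
    define M where "M = max 1 M0"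
    have M1: "1 \<le> M" and M: "\<And>x. x \<in> cball 0 1 \<Longrightarrow> \<bar>u x\<bar> \<le> M" using M0 by (force simp: M_def)+
    have M': "\<bar>u x\<bar> \<le> M" if "x \<in> ball 0 1" for x using M that by simp
    have tm: "touch a s u \<in> sets borel" for s
      by (rule borel_touch[OF open_ball_diff_touch[OF a(1) uc' M']])
    define V where "V = ball (0::'a) 1"
    have V: "V \<in> lmeasurable" by (simp add: V_def)
    show "\<exists>T. \<forall>t\<ge>T. \<exists>D\<ge>0. \<forall>k. measure lebesgue (ball 0 1 - touch a (t * B ^ k) u) \<le> D * \<mu> ^ k"
    \<comment> \<open>\<open>t >= 1200 * M\<close> gives \<open>12 * M / t <= 1/100\<close>, hence
      \<open>R <= 1/10\<close>, and the radius \<open>1 - 10 * R\<close> is nonnegative as the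
      volume formula requires.\<close>
    proof (rule exI[of _ "1200 * M"], intro allI impI)
      fix t assume t: "1200 * M \<le> t"
      define tk where "tk k = t * B ^ k" for k
      have Bk: "1 \<le> B ^ k" for k using B by (intro one_le_power) auto
      have tk: "t \<le> tk k" "B ^ k \<le> tk k" "1 \<le> tk k" for k
      proof -
        have "t * 1 \<le> t * B ^ k" using Bk t M1 by (intro mult_left_mono) auto
        then show "t \<le> tk k" by (simp add: tk_def)
        then show "1 \<le> tk k" using t M1 by simp
        have "1 * B ^ k \<le> t * B ^ k" using Bk[of k] t M1 by (intro mult_right_mono) auto
        then show "B ^ k \<le> tk k" by (simp add: tk_def)
      qed
      define E where "E k = measure lebesgue (V - touch a (tk k) u)" for k
      have Em: "V - touch a s u \<in> lmeasurable" for s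
        using V tm[of s] by (intro fmeasurable_Diff) auto
      define \<omega> where "\<omega> = measure lebesgue V"
      have om: "\<omega> = unit_ball_vol (real ?n)" using content_ball[of 1 "0::'a"] by (simp add: \<omega>_def V_def)
      define D0 where "D0 = K * I + \<omega> * (real ?n * 10)"
      have om0: "0 \<le> \<omega>" by (simp add: \<omega>_def)
      have D0: "0 \<le> D0" using K I om0 by (simp add: D0_def)
      have rec: "E k \<le> K * (E k - E (Suc k)) + D0 * q ^ k" for k
      proof -
        define R where "R = (12 * M / tk k) powr (1 / (1 + a))"
        have tk0: "0 < tk k" using tk(3)[of k] by linarith
        have y: "0 < 12 * M / tk k" "12 * M / tk k \<le> 1 / 100"
          using tk0 tk(1)[of k] t M1 by (auto simp: field_simps)
        have R_half: "R \<le> sqrt (12 * M / tk k)"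
        proof -
          have "12 * M / tk k \<le> 1" using y by linarith
          then have "R \<le> (12 * M / tk k) powr (1 / 2)" unfolding R_def
            using y(1) a by (intro powr_mono') (auto simp: field_simps)
          then show ?thesis using y by (simp add: powr_half_sqrt)
        qed
        also have "\<dots> \<le> sqrt (1 / 100)" using y by (intro real_sqrt_le_mono) auto
        also have "sqrt (1 / 100) = 1 / 10"
          by (rule real_sqrt_unique) (auto simp: power2_eq_square)
        finally have R10: "R \<le> 1 / 10" .
        have R0: "0 \<le> R" by (simp add: R_def)
        have Rq: "R \<le> q ^ k"
        proof -
          have "12 * M / tk k \<le> (1 / B) ^ k"
          proof -
            have "12 * M / tk k = (12 * M / t) * (1 / B) ^ k" by (simp add: tk_def power_divide)
            also have "\<dots> \<le> 1 * (1 / B) ^ k" using t M1 B by (intro mult_right_mono) auto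
            finally show ?thesis by simp
          qed
          then have "sqrt (12 * M / tk k) \<le> sqrt ((1 / B) ^ k)" by (rule real_sqrt_le_mono)
          also have "\<dots> = q ^ k" by (simp add: q_def real_sqrt_power)
          finally show ?thesis using R_half by linarith
        qed
        have tau: "1 / (tk k powr (1 + g)) ^ ?n \<le> q ^ k"
        proof -
          have "tk k powr 1 \<le> tk k powr (1 + g)" using g tk(3)[of k] by (intro powr_mono) auto
          then have 1: "tk k \<le> tk k powr (1 + g)" using tk0 by simp
          also have "\<dots> \<le> (tk k powr (1 + g)) ^ ?n"
            using 1 tk(3)[of k] by (intro self_le_power) auto
          finally have "B ^ k \<le> (tk k powr (1 + g)) ^ ?n" using tk(2)[of k] by linarith
          then have "1 / (tk k powr (1 + g)) ^ ?n \<le> 1 / B ^ k"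
            using Bk[of k] by (intro divide_left_mono mult_pos_pos) auto
          also have "\<dots> = (1 / B) ^ k" by (simp add: power_divide)
          also have "\<dots> \<le> q ^ k"
          proof (rule power_mono)
            have "q * q \<le> q * 1" using q by (intro mult_left_mono) auto
            moreover have "q * q = 1 / B" using B by (simp add: q_def)
            ultimately show "1 / B \<le> q" by simp
          qed (use B in auto)
          finally show ?thesis .
        qed
        define A where "A = ball 0 (1 - 10 * R) - touch a (tk k) u"
        define N where "N = touch a (tk (Suc k)) u - touch a (tk k) u"
        have TV: "touch a s u \<subseteq> V" for s by (auto simp: touch_def V_def)
        have Nm: "N \<in> lmeasurable"
        proof (rule fmeasurableI2[OF V])
          show "N \<subseteq> V" using TV by (auto simp: N_def)
          show "N \<in> sets lebesgue" using tm by (simp add: N_def)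
        qed
        have Am: "A \<in> lmeasurable"
          unfolding A_def using tm[of "tk k"] by (intro fmeasurable_Diff) auto
        have mono: "touch a (tk k) u \<subseteq> touch a (tk (Suc k)) u"
          using mult_right_mono[of 1 B "tk k"] tk0 B by (intro touch_mono) (simp add: tk_def mult_ac)
        have "emeasure lebesgue A \<le> ennreal K0 * (emeasure lebesgue (touch a (B0 * tk k) u - touch a (tk k) u) +
          ennreal (1 / (tk k powr (1 + g)) ^ ?n) * ennreal I)"
          unfolding A_def I(2)[symmetric] by (rule step[OF uc M fc f0 sup tk0 R_def])
        also have "emeasure lebesgue (touch a (B0 * tk k) u - touch a (tk k) u) \<le> emeasure lebesgue N"
        proof (rule emeasure_mono)
          have "touch a (B0 * tk k) u \<subseteq> touch a (tk (Suc k)) u"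
            using mult_right_mono[OF B(2), of "tk k"] tk0 by (intro touch_mono) (simp add: tk_def mult_ac)
          then show "touch a (B0 * tk k) u - touch a (tk k) u \<subseteq> N" by (auto simp: N_def)
        qed (use Nm in auto)
        also have "emeasure lebesgue N = ennreal (measure lebesgue N)"
          using Nm by (simp add: emeasure_eq_measure2)
        also have "emeasure lebesgue A = ennreal (measure lebesgue A)"
          using Am by (simp add: emeasure_eq_measure2)
        finally have "ennreal (measure lebesgue A) \<le> ennreal K0 * (ennreal (measure lebesgue N) + ennreal (1 / (tk k powr (1 + g)) ^ ?n) * ennreal I)"
          by (simp add: add_right_mono mult_left_mono)
        moreover have "ennreal K0 * (ennreal mN + ennreal cc * ennreal I) = ennreal (K0 * (mN + cc * I))" if "0 \<le> mN" "0 \<le> cc" for mN cc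
          using K0 I that by (simp add: ennreal_mult'[symmetric] ennreal_plus[symmetric] del: ennreal_plus)
        ultimately have "ennreal (measure lebesgue A) \<le> ennreal (K0 * (measure lebesgue N + 1 / (tk k powr (1 + g)) ^ ?n * I))"
          using zero_le_power[of "tk k powr (1 + g)" ?n] by simp
        then have "measure lebesgue A \<le> K0 * (measure lebesgue N + 1 / (tk k powr (1 + g)) ^ ?n * I)"
          using K0 I by (subst (asm) ennreal_le_iff) auto
        also have "\<dots> \<le> K * (measure lebesgue N + q ^ k * I)"
          using K K0 I tau q by (intro mult_mono add_mono) auto
        finally have Ab: "measure lebesgue A \<le> K * measure lebesgue N + K * I * q ^ k"
          by (simp add: algebra_simps)
        have NE: "measure lebesgue N = E k - E (Suc k)"
        proof -
          have "N = (V - touch a (tk k) u) - (V - touch a (tk (Suc k)) u)"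
            using TV by (auto simp: N_def)
          then show ?thesis unfolding E_def
            using mono by (subst measurable_measure_Diff[symmetric]) (auto intro: Em fmeasurableD)
        qed
        have strip: "measure lebesgue (V - ball 0 (1 - 10 * R)) \<le> \<omega> * (real ?n * 10) * q ^ k"
        proof -
          have "measure lebesgue (V - ball 0 (1 - 10 * R)) = \<omega> - measure lebesgue (ball (0::'a) (1 - 10 * R))"
            unfolding \<omega>_def using R0 by (subst measurable_measure_Diff) (auto simp: V_def)
          also have "measure lebesgue (ball (0::'a) (1 - 10 * R)) = \<omega> * (1 - 10 * R) ^ ?n"
            using content_ball[of "1 - 10 * R" "0::'a"] R10 by (simp add: om)
          also have "\<omega> - \<omega> * (1 - 10 * R) ^ ?n \<le> \<omega> * (real ?n * (10 * R))"
          proof -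
            have "1 + real ?n * (- 10 * R) \<le> (1 + (- 10 * R)) ^ ?n" using R10 by (intro Bernoulli_inequality) auto
            then have "\<omega> * (1 - real ?n * (10 * R)) \<le> \<omega> * (1 - 10 * R) ^ ?n" using om0 by (intro mult_left_mono) auto
            then show ?thesis by (simp add: right_diff_distrib)
          qed
          also have "\<dots> \<le> \<omega> * (real ?n * (10 * q ^ k))" using Rq om0 by (intro mult_left_mono) auto
          finally show ?thesis by simp
        qed
        have "E k \<le> measure lebesgue (A \<union> (V - ball 0 (1 - 10 * R)))"
          unfolding E_def using Am V Em[of "tk k"]
          by (intro measure_mono_fmeasurable fmeasurable.Un fmeasurable_Diff) (auto simp: A_def fmeasurableD)
        also have "\<dots> \<le> measure lebesgue A + measure lebesgue (V - ball 0 (1 - 10 * R))"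
          using Am V by (intro measure_Un_le) (auto simp: fmeasurableD)
        finally show ?thesis using Ab strip unfolding NE D0_def by (simp add: distrib_right)
      qed
      have "\<exists>D\<ge>0. \<forall>k. E k \<le> D * \<mu> ^ k"
        by (rule geometric_decay[OF rec K(1) D0 less_imp_le[OF q(1)] mu(4) mu(3)]) (simp add: E_def)
      then show "\<exists>D\<ge>0. \<forall>k. measure lebesgue (ball 0 1 - touch a (t * B ^ k) u) \<le> D * \<mu> ^ k"
        by (simp add: E_def V_def tk_def)
    qed
  qed
qed

section \<open>The pointwise seminorm\<close>

text \<open>A nonempty open superlevel set of a continuous function is not negligible, so the
  essential supremum is the pointwise one and the seminorm reduces to pointwise
  inequalities.\<close>

lemma Linf_norm_le_iff:
  fixes g :: "real^'n::finite \<Rightarrow> real"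
  assumes S: "open S" and g: "continuous_on S g"
  shows "Linf_norm S g \<le> c \<longleftrightarrow> (\<forall>z\<in>S. ennreal \<bar>g z\<bar> \<le> c)"
proof
  have Sm: "S \<in> sets lebesgue" using S by (simp add: borel_open)
  have cont: "continuous_on S (\<lambda>z. \<bar>g z\<bar>)" using g by (intro continuous_intros)
  have "(\<lambda>z. \<bar>g z\<bar>) \<in> borel_measurable (lebesgue_on S)"
    by (rule continuous_imp_measurable_on_sets_lebesgue[OF cont Sm])
  then have meas: "(\<lambda>z. ennreal \<bar>g z\<bar>) \<in> borel_measurable (lebesgue_on S)" by simp
  {
    assume "\<forall>z\<in>S. ennreal \<bar>g z\<bar> \<le> c"
    then show "Linf_norm S g \<le> c"
      unfolding Linf_norm_def by (intro esssup_I meas AE_I2) (simp add: space_restrict_space)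
  }
  assume le: "Linf_norm S g \<le> c"
  show "\<forall>z\<in>S. ennreal \<bar>g z\<bar> \<le> c"
  proof (rule ccontr)
    assume "\<not> (\<forall>z\<in>S. ennreal \<bar>g z\<bar> \<le> c)"
    then obtain z0 where z0: "z0 \<in> S" "c < ennreal \<bar>g z0\<bar>" by (auto simp: not_le)
    then obtain k where k: "c = ennreal k" "0 \<le> k"
      by (cases c) (auto simp: top_unique)
    define X where "X = S \<inter> (\<lambda>z. \<bar>g z\<bar>) -` {k<..}"
    have "open X" unfolding X_def using S cont by (intro continuous_open_preimage) auto
    moreover have "z0 \<in> X" using z0 k by (auto simp: X_def ennreal_less_iff)
    ultimately have "\<not> negligible X" using open_not_negligible by blast
    have "AE z in lebesgue_on S. ennreal \<bar>g z\<bar> \<le> c"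
      using esssup_AE[of "\<lambda>z. ennreal \<bar>g z\<bar>" "lebesgue_on S"] le
      unfolding Linf_norm_def by (auto elim: eventually_mono)
    then have "AE z in lebesgue. z \<in> S \<longrightarrow> ennreal \<bar>g z\<bar> \<le> c"
      using Sm by (subst (asm) AE_restrict_space_iff) auto
    then have "AE z in lebesgue. z \<notin> X"
    proof eventually_elim
      case (elim z)
      show ?case
      proof
        assume z: "z \<in> X"
        then have "ennreal \<bar>g z\<bar> \<le> ennreal k" using elim by (simp add: X_def k)
        then show False using z k by (simp add: X_def)
      qed
    qed
    then have "X \<in> null_sets lebesgue"
      using AE_iff_null_sets[of X lebesgue] \<open>open X\<close> by (simp add: borel_open)
    then show False using \<open>\<not> negligible X\<close> by (simp add: negligible_iff_null_sets)
  qed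
qed

lemma continuous_on_affine_function:
  "l \<in> affine_functions \<Longrightarrow> continuous_on S l"
proof -
  assume "l \<in> affine_functions"
  then obtain p c where l: "l = (\<lambda>x. p \<bullet> x + c)" unfolding affine_functions_def by auto
  show ?thesis unfolding l by (intro continuous_intros)
qed

text \<open>The superlevel sets are open: the norm over \<open>ball x r\<close> exceeds
  \<open>c\<close> exactly when \<open>x\<close> is within \<open>r\<close> of a point of the unit
  ball where the deviation exceeds \<open>c\<close>.\<close>

lemma C1_quotient_measurable:
  fixes u :: "real^'n::finite \<Rightarrow> real"
  assumes uc: "continuous_on (ball 0 1) u" and l: "l \<in> affine_functions"
  shows "(\<lambda>x. Linf_norm (ball x r \<inter> ball 0 1) (\<lambda>z. u z - l z) / k) \<in> borel_measurable (lebesgue_on (ball 0 1))"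
proof -
  have lc: "continuous_on S l" for S by (rule continuous_on_affine_function[OF l])
  have "(\<lambda>x. Linf_norm (ball x r \<inter> ball 0 1) (\<lambda>z. u z - l z)) \<in> borel_measurable (lebesgue_on (ball 0 1))"
  proof (rule borel_measurableI_greater)
    fix c :: ennreal
    have "{x \<in> space (lebesgue_on (ball 0 1)). c < Linf_norm (ball x r \<inter> ball 0 1) (\<lambda>z. u z - l z)}
      = ball 0 1 \<inter> (\<Union>z\<in>{z \<in> ball 0 1. c < ennreal \<bar>u z - l z\<bar>}. ball z r)"
    proof -
      have "c < Linf_norm (ball x r \<inter> ball 0 1) (\<lambda>z. u z - l z) \<longleftrightarrow>
          (\<exists>z\<in>ball x r \<inter> ball 0 1. c < ennreal \<bar>u z - l z\<bar>)" for x
        using Linf_norm_le_iff[of "ball x r \<inter> ball 0 1" "\<lambda>z. u z - l z" c]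
          continuous_on_subset[OF uc, of "ball x r \<inter> ball 0 1"] lc
        by (auto simp: not_le[symmetric] intro!: continuous_on_diff)
      then show ?thesis by (auto simp: space_restrict_space dist_commute)
    qed
    also have "\<dots> \<in> sets (lebesgue_on (ball 0 1))"
    proof -
      have "open (ball 0 1 \<inter> (\<Union>z\<in>{z \<in> ball 0 1. c < ennreal \<bar>u z - l z\<bar>}. ball z r))"
        by (intro open_Int open_UN) auto
      then show ?thesis by (subst sets_restrict_space_iff) (auto simp: borel_open)
    qed
    finally show "{x \<in> space (lebesgue_on (ball 0 1)). c < Linf_norm (ball x r \<inter> ball 0 1) (\<lambda>z. u z - l z)}
      \<in> sets (lebesgue_on (ball 0 1))" .
  qed
  then show ?thesis by measurable
qed

lemma countable_affine_dense:
  obtains L :: "(real^'n::finite \<Rightarrow> real) set" where "countable L" "L \<subseteq> affine_functions"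
    "\<And>l e. l \<in> affine_functions \<Longrightarrow> 0 < e \<Longrightarrow> \<exists>l'\<in>L. \<forall>z\<in>ball 0 1. \<bar>l z - l' z\<bar> \<le> e"
proof -
  obtain D :: "((real^'n) \<times> real) set" where D: "countable D" "\<And>X. open X \<Longrightarrow> X \<noteq> {} \<Longrightarrow> \<exists>d\<in>D. d \<in> X"
    using countable_dense_exists[where 'a="(real^'n) \<times> real"] by blast
  show thesis
  proof (rule that[of "(\<lambda>d z. fst d \<bullet> z + snd d) ` D"])
    show "countable ((\<lambda>d z. fst d \<bullet> z + snd d) ` D)" using D by simp
    show "(\<lambda>d z. fst d \<bullet> z + snd d) ` D \<subseteq> affine_functions" by (auto simp: affine_functions_def)
    fix l :: "real^'n \<Rightarrow> real" and e :: real
    assume "l \<in> affine_functions" and e: "0 < e"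
    then obtain p c where l: "\<And>z. l z = p \<bullet> z + c" unfolding affine_functions_def by blast
    have "open (ball p (e / 2) \<times> ball c (e / 2))" "ball p (e / 2) \<times> ball c (e / 2) \<noteq> {}"
      using e by (auto intro: open_Times)
    then obtain d where d: "d \<in> D" "d \<in> ball p (e / 2) \<times> ball c (e / 2)" using D(2) by blast
    have dd: "norm (p - fst d) \<le> e / 2" "\<bar>c - snd d\<bar> \<le> e / 2"
      using d(2) by (simp_all add: mem_Times_iff dist_norm)
    have "\<bar>l z - (fst d \<bullet> z + snd d)\<bar> \<le> e" if z: "z \<in> ball 0 1" for z
    proof -
      have "l z - (fst d \<bullet> z + snd d) = (p - fst d) \<bullet> z + (c - snd d)" by (simp add: l inner_diff_left)
      moreover have "\<bar>(p - fst d) \<bullet> z\<bar> \<le> norm (p - fst d) * norm z" by (rule Cauchy_Schwarz_ineq2)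
      moreover have "norm (p - fst d) * norm z \<le> (e / 2) * 1"
        using dd(1) z e by (intro mult_mono) auto
      ultimately show ?thesis using dd(2) by linarith
    qed
    then show "\<exists>l'\<in>(\<lambda>d z. fst d \<bullet> z + snd d) ` D. \<forall>z\<in>ball 0 1. \<bar>l z - l' z\<bar> \<le> e"
      by (intro bexI[OF _ imageI[OF d(1)]]) blast
  qed
qed

text \<open>Radii and affine functions can be restricted to countable sets, because the norm is monotone
  in the radius and continuous in the affine function.\<close>
lemma C1_seminorm_measurable:
  fixes u :: "real^'n::finite \<Rightarrow> real"
  assumes uc: "continuous_on (ball 0 1) u" and a: "0 < a"
  shows "C1_seminorm a u \<in> borel_measurable (lebesgue_on (ball 0 1))"
proof -
  obtain L :: "(real^'n \<Rightarrow> real) set" where L: "countable L" "L \<subseteq> affine_functions"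
    "\<And>l e. l \<in> affine_functions \<Longrightarrow> 0 < e \<Longrightarrow> \<exists>l'\<in>L. \<forall>z\<in>ball 0 1. \<bar>l z - l' z\<bar> \<le> e"
    using countable_affine_dense by blast
  define N where "N x r l = Linf_norm (ball x r \<inter> ball 0 1) (\<lambda>z. u z - l z)" for x r and l :: "real^'n \<Rightarrow> real"
  define \<rho> where "\<rho> r = ennreal (r powr (1 + a))" for r
  have Nle: "N x r l \<le> c \<longleftrightarrow> (\<forall>z\<in>ball x r \<inter> ball 0 1. ennreal \<bar>u z - l z\<bar> \<le> c)" if "l \<in> affine_functions" for x r l c
    unfolding N_def using that
    by (intro Linf_norm_le_iff continuous_on_diff continuous_on_affine_function continuous_on_subset[OF uc]) auto
  have inner: "(INF l\<in>L. N x r l / \<rho> r) = (INF l\<in>affine_functions. N x r l / \<rho> r)" if r: "0 < r" for x r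
  proof (rule antisym)
    show "(INF l\<in>affine_functions. N x r l / \<rho> r) \<le> (INF l\<in>L. N x r l / \<rho> r)"
      using L(2) by (rule INF_superset_mono) simp
    show "(INF l\<in>L. N x r l / \<rho> r) \<le> (INF l\<in>affine_functions. N x r l / \<rho> r)"
    proof (rule INF_greatest, rule ennreal_le_epsilon)
      fix l :: "real^'n \<Rightarrow> real" and e :: real assume l: "l \<in> affine_functions" and e: "0 < e"
      define \<epsilon> where "\<epsilon> = e * r powr (1 + a)"
      have eps: "0 < \<epsilon>" using e r by (simp add: \<epsilon>_def)
      obtain l' where l': "l' \<in> L" "\<And>z. z \<in> ball 0 1 \<Longrightarrow> \<bar>l z - l' z\<bar> \<le> \<epsilon>"
        using L(3)[OF l eps] by blast
      have "N x r l' \<le> N x r l + ennreal \<epsilon>"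
      proof (subst Nle, use l' L in blast, intro ballI)
        fix z assume z: "z \<in> ball x r \<inter> ball 0 1"
        then have "\<bar>u z - l' z\<bar> \<le> \<bar>u z - l z\<bar> + \<epsilon>" using l'(2)[of z] by auto
        then have "ennreal \<bar>u z - l' z\<bar> \<le> ennreal \<bar>u z - l z\<bar> + ennreal \<epsilon>"
          using eps by (simp add: ennreal_plus[symmetric] ennreal_leI del: ennreal_plus)
        also have "ennreal \<bar>u z - l z\<bar> \<le> N x r l" using Nle[OF l, of x r "N x r l"] z by blast
        finally show "ennreal \<bar>u z - l' z\<bar> \<le> N x r l + ennreal \<epsilon>" by (simp add: add_right_mono)
      qed
      then have "N x r l' / \<rho> r \<le> (N x r l + ennreal \<epsilon>) / \<rho> r" by (rule divide_right_mono_ennreal)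
      also have "\<dots> = N x r l / \<rho> r + ennreal \<epsilon> / \<rho> r" by (rule add_divide_distrib_ennreal)
      also have "ennreal \<epsilon> / \<rho> r = ennreal e"
        using eps r by (simp add: \<rho>_def divide_ennreal) (simp add: \<epsilon>_def)
      finally show "(INF l\<in>L. N x r l / \<rho> r) \<le> N x r l / \<rho> r + ennreal e"
        using l'(1) by (meson INF_lower order_trans)
    qed
  qed
  define Q where "Q x r = (INF l\<in>affine_functions. N x r l / \<rho> r)" for x r
  have outer: "(SUP r\<in>{0<..}. Q x r) = (SUP r\<in>{0<..} \<inter> \<rat>. Q x r)" for x
  proof (rule antisym)
    show "(SUP r\<in>{0<..} \<inter> \<rat>. Q x r) \<le> (SUP r\<in>{0<..}. Q x r)" by (rule SUP_subset_mono) auto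
    show "(SUP r\<in>{0<..}. Q x r) \<le> (SUP r\<in>{0<..} \<inter> \<rat>. Q x r)"
    proof (rule SUP_least, rule ennreal_le_epsilon)
      fix r e :: real assume r: "r \<in> {0<..}" and e: "0 < e"
        and fin: "(SUP r\<in>{0<..} \<inter> \<rat>. Q x r) < top"
      then obtain \<sigma> where \<sigma>: "0 \<le> \<sigma>" "(SUP r\<in>{0<..} \<inter> \<rat>. Q x r) = ennreal \<sigma>"
        by (cases "SUP r\<in>{0<..} \<inter> \<rat>. Q x r") auto
      have "((\<lambda>t. (t / r) powr (1 + a) * (\<sigma> + e / 2)) \<longlongrightarrow> (r / r) powr (1 + a) * (\<sigma> + e / 2)) (at_right r)"
        using r by (intro tendsto_intros) auto
      then have "\<forall>\<^sub>F t in at_right r. (t / r) powr (1 + a) * (\<sigma> + e / 2) < \<sigma> + e"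
        using r e by (intro order_tendstoD(2)) auto
      then obtain b where b: "r < b" "\<And>t. r < t \<Longrightarrow> t < b \<Longrightarrow> (t / r) powr (1 + a) * (\<sigma> + e / 2) < \<sigma> + e"
        unfolding eventually_at_right_field by blast
      \<comment> \<open>The norm over the larger ball of rational radius \<open>t\<close> bounds the
        one over \<open>ball x r\<close>, at the cost of the factor
        \<open>(t / r) powr (1 + a)\<close> close to 1.\<close>
      obtain t where t: "t \<in> \<rat>" "r < t" "t < b" using Rats_dense_in_real[OF b(1)] by blast
      have t0: "0 < t" using t r by simp
      have "Q x t \<le> ennreal \<sigma>" unfolding \<sigma>(2)[symmetric] using t t0 by (intro SUP_upper) auto
      also have "\<dots> < ennreal (\<sigma> + e / 2)" using \<sigma> e by (simp add: ennreal_less_iff)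
      finally obtain l where l: "l \<in> affine_functions" "N x t l / \<rho> t < ennreal (\<sigma> + e / 2)"
        unfolding Q_def by (auto simp: INF_less_iff)
      have Nt: "N x t l \<le> ennreal ((\<sigma> + e / 2) * t powr (1 + a))"
      proof (cases "N x t l")
        case (real y)
        then have "y / t powr (1 + a) \<le> \<sigma> + e / 2"
          using l(2) t0 by (simp add: \<rho>_def divide_ennreal ennreal_less_iff)
        then show ?thesis using real t0 by (simp add: ennreal_leI pos_divide_le_eq)
      next
        case top
        then show ?thesis using l(2) t0 by (simp add: \<rho>_def ennreal_top_divide)
      qed
      have "N x r l \<le> ennreal ((\<sigma> + e / 2) * t powr (1 + a))"
        unfolding Nle[OF l(1)] using Nt[unfolded Nle[OF l(1)]] t by auto
      then have "N x r l / \<rho> r \<le> ennreal ((\<sigma> + e / 2) * t powr (1 + a)) / \<rho> r" by (rule divide_right_mono_ennreal)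
      also have "\<dots> = ennreal ((\<sigma> + e / 2) * t powr (1 + a) / r powr (1 + a))"
        unfolding \<rho>_def using \<sigma> e r by (intro divide_ennreal) auto
      also have "(\<sigma> + e / 2) * t powr (1 + a) / r powr (1 + a) = (t / r) powr (1 + a) * (\<sigma> + e / 2)"
        using t0 r by (simp add: powr_divide)
      also have "ennreal \<dots> \<le> ennreal (\<sigma> + e)" using b(2)[OF t(2,3)] by (intro ennreal_leI) auto
      also have "\<dots> = (SUP r\<in>{0<..} \<inter> \<rat>. Q x r) + ennreal e" using \<sigma> e by simp
      finally show "Q x r \<le> (SUP r\<in>{0<..} \<inter> \<rat>. Q x r) + ennreal e"
        unfolding Q_def using l(1) by (meson INF_lower order_trans)
    qed
  qed
  have "C1_seminorm a u = (\<lambda>x. SUP r\<in>{0<..} \<inter> \<rat>. INF l\<in>L. N x r l / \<rho> r)"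
  proof
    fix x
    have "C1_seminorm a u x = (SUP r\<in>{0<..}. Q x r)"
      by (simp add: C1_seminorm_def Q_def N_def \<rho>_def)
    also have "\<dots> = (SUP r\<in>{0<..} \<inter> \<rat>. Q x r)" by (rule outer)
    also have "\<dots> = (SUP r\<in>{0<..} \<inter> \<rat>. INF l\<in>L. N x r l / \<rho> r)"
      using inner by (intro SUP_cong) (auto simp: Q_def)
    finally show "C1_seminorm a u x = (SUP r\<in>{0<..} \<inter> \<rat>. INF l\<in>L. N x r l / \<rho> r)" .
  qed
  also have "\<dots> \<in> borel_measurable (lebesgue_on (ball 0 1))"
    unfolding N_def using L
    by (intro borel_measurable_SUP borel_measurable_INF C1_quotient_measurable uc)
      (auto intro: countable_Int2 countable_rat)
  finally show ?thesis .
qed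

text \<open>The slopes of the two touching functions add up to a vector \<open>w\<close> with
  \<open>w \<bullet> h <= 2 * t * norm h powr (1 + a)\<close> for small \<open>h\<close>; the
  exponent above 1 forces \<open>w = 0\<close>. Hence a single affine function approximates
  \<open>u\<close> from both sides.\<close>

lemma C1_seminorm_le:
  fixes u :: "real^'n::finite \<Rightarrow> real"
  assumes uc: "continuous_on (ball 0 1) u" and a: "0 < a" and t: "0 \<le> t"
    and x1: "x \<in> touch a t u" and x2: "x \<in> touch a t (\<lambda>z. - u z)"
  shows "C1_seminorm a u x \<le> ennreal t"
proof -
  have x: "x \<in> ball 0 1" using x1 by (simp add: touch_def)
  obtain p where p: "\<And>z. z \<in> ball 0 1 \<Longrightarrow> u x + p \<bullet> (z - x) - t * norm (z - x) powr (1 + a) \<le> u z"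
    using x1 unfolding touch_def by blast
  obtain p' where p': "\<And>z. z \<in> ball 0 1 \<Longrightarrow> - u x + p' \<bullet> (z - x) - t * norm (z - x) powr (1 + a) \<le> - u z"
    using x2 unfolding touch_def by blast
  define w where "w = p + p'"
  have "w = 0"
  proof (rule ccontr)
    assume w: "w \<noteq> 0"
    have "((\<lambda>s. 2 * t * s powr a) \<longlongrightarrow> 2 * t * 0 powr a) (at_right 0)"
      using a by (intro tendsto_intros tendsto_powr') (auto simp: eventually_at_right_field intro: exI[of _ 1])
    then have "\<forall>\<^sub>F s in at_right 0. 2 * t * s powr a < norm w"
      using w by (intro order_tendstoD(2)) auto
    then obtain b where b: "0 < b" "\<And>s. 0 < s \<Longrightarrow> s < b \<Longrightarrow> 2 * t * s powr a < norm w"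
      unfolding eventually_at_right_field by blast
    define s where "s = min (b / 2) ((1 - norm x) / 2)"
    have "(1 - norm x) / 2 < 1 - norm x" using x by simp
    moreover have "s \<le> (1 - norm x) / 2" unfolding s_def by (rule min.cobounded2)
    ultimately have s: "0 < s" "s < b" "s < 1 - norm x" using b x by (auto simp: s_def)
    define h where "h = (s / norm w) *\<^sub>R w"
    have h: "norm h = s" "w \<bullet> h = s * norm w"
      using w s by (auto simp: h_def dot_square_norm power2_eq_square)
    have xh: "x + h \<in> ball 0 1" using s h norm_triangle_ineq[of x h] by simp
    have "w \<bullet> h \<le> 2 * t * s powr (1 + a)"
      using p[OF xh] p'[OF xh] h by (simp add: w_def inner_add_left)
    also have "\<dots> = s * (2 * t * s powr a)" using s by (simp add: powr_add)
    also have "\<dots> < s * norm w" using b(2)[OF s(1,2)] s by simp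
    finally show False using h by simp
  qed
  then have pp: "p' = - p" by (simp add: w_def add_eq_0_iff)
  define l where "l z = p \<bullet> z + (u x - p \<bullet> x)" for z
  have l: "l \<in> affine_functions" unfolding affine_functions_def l_def by blast
  have ul: "\<bar>u z - l z\<bar> \<le> t * norm (z - x) powr (1 + a)" if "z \<in> ball 0 1" for z
    using p[OF that] p'[OF that] by (simp add: pp l_def inner_diff_right abs_le_iff)
  show ?thesis
    unfolding C1_seminorm_def
  proof (rule SUP_least)
    fix r :: real assume r: "r \<in> {0<..}"
    have "Linf_norm (ball x r \<inter> ball 0 1) (\<lambda>z. u z - l z) \<le> ennreal (t * r powr (1 + a))"
    proof (subst Linf_norm_le_iff)
      show "continuous_on (ball x r \<inter> ball 0 1) (\<lambda>z. u z - l z)"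
        by (intro continuous_on_diff continuous_on_affine_function[OF l] continuous_on_subset[OF uc]) auto
      show "\<forall>z\<in>ball x r \<inter> ball 0 1. ennreal \<bar>u z - l z\<bar> \<le> ennreal (t * r powr (1 + a))"
      proof
        fix z assume z: "z \<in> ball x r \<inter> ball 0 1"
        then have "norm (z - x) powr (1 + a) \<le> r powr (1 + a)"
          using a by (intro powr_mono2) (auto simp: dist_norm norm_minus_commute)
        then have "t * norm (z - x) powr (1 + a) \<le> t * r powr (1 + a)" using t by (intro mult_left_mono)
        then show "ennreal \<bar>u z - l z\<bar> \<le> ennreal (t * r powr (1 + a))"
          using ul[of z] z by (intro ennreal_leI) auto
      qed
    qed auto
    then have "Linf_norm (ball x r \<inter> ball 0 1) (\<lambda>z. u z - l z) / ennreal (r powr (1 + a))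
       \<le> ennreal (t * r powr (1 + a)) / ennreal (r powr (1 + a))" by (rule divide_right_mono_ennreal)
    also have "\<dots> = ennreal t" using t r by (simp add: divide_ennreal)
    finally show "(INF l\<in>affine_functions. Linf_norm (ball x r \<inter> ball 0 1) (\<lambda>z. u z - l z) / ennreal (r powr (1 + a))) \<le> ennreal t"
      using l by (meson INF_lower order_trans)
  qed
qed

text \<open>If \<open>k\<close> is the first index with \<open>x\<close> outside
  \<open>Bad k\<close>, then \<open>S x\<close> is at most \<open>t * B ^ k\<close>, and for
  \<open>k > 0\<close> the point lies in \<open>Bad (k - 1)\<close>. Charging the value to that set
  gives a geometric series with ratio \<open>B powr \<delta> * \<mu>\<close>.\<close>

lemma geometric_bad_sets_integrable:
  fixes S :: "'a \<Rightarrow> ennreal"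
  assumes Sm: "S \<in> borel_measurable M" and fin: "emeasure M (space M) < \<infinity>"
    and Bad: "\<And>k. Bad k \<in> sets M" "\<And>k. emeasure M (Bad k) \<le> ennreal (D * \<mu> ^ k)"
    and SB: "\<And>k x. x \<in> space M \<Longrightarrow> x \<notin> Bad k \<Longrightarrow> S x \<le> ennreal (t * B ^ k)"
    and D: "0 \<le> D" and mu: "0 < \<mu>" "\<mu> < 1" and t: "0 < t" and B: "1 < B"
    and \<delta>: "0 < \<delta>" "B powr \<delta> * \<mu> < 1"
  shows "(\<integral>\<^sup>+x. (if S x = \<infinity> then \<infinity> else ennreal (enn2real (S x) powr \<delta>)) \<partial>M) < \<infinity>"
    and "AE x in M. S x < \<infinity>"
proof -
  have "(\<Inter>k. Bad k) \<in> null_sets M"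
  proof (rule null_setsI)
    have lim: "(\<lambda>k. ennreal (D * \<mu> ^ k)) \<longlonglongrightarrow> ennreal (D * 0)"
      using mu by (intro tendsto_ennrealI tendsto_intros LIMSEQ_power_zero) auto
    have "emeasure M (\<Inter>k. Bad k) \<le> ennreal (D * \<mu> ^ k)" for k
      using Bad by (intro order_trans[OF emeasure_mono Bad(2)[of k]]) auto
    then have "emeasure M (\<Inter>k. Bad k) \<le> ennreal (D * 0)"
      by (intro LIMSEQ_le_const[OF lim]) auto
    then show "emeasure M (\<Inter>k. Bad k) = 0" by simp
  qed (use Bad in auto)
  then have AEB: "AE x in M. x \<notin> (\<Inter>k. Bad k)" by (rule AE_not_in)
  then have AEB': "AE x in M. x \<in> space M \<and> x \<notin> (\<Inter>k. Bad k)" by (simp add: AE_conjI)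
  show "AE x in M. S x < \<infinity>"
    using AEB'
  proof eventually_elim
    case (elim x)
    then obtain k where "x \<notin> Bad k" by auto
    then have "S x \<le> ennreal (t * B ^ k)" using SB elim by blast
    then show ?case by (simp add: le_less_trans)
  qed
  let ?h = "\<lambda>x. if S x = \<infinity> then \<infinity> else ennreal (enn2real (S x) powr \<delta>)"
  have hb: "?h x \<le> ennreal ((t * B ^ k) powr \<delta>)" if "x \<in> space M" "x \<notin> Bad k" for x k
  proof -
    have Sx: "S x \<le> ennreal (t * B ^ k)" using SB that by blast
    then have "S x < \<infinity>" by (simp add: le_less_trans)
    moreover have "enn2real (S x) \<le> t * B ^ k" using Sx t B by (intro enn2real_leI) auto
    then have "enn2real (S x) powr \<delta> \<le> (t * B ^ k) powr \<delta>" using \<delta> by (intro powr_mono2) auto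
    ultimately show ?thesis by (auto simp: ennreal_leI)
  qed
  \<comment> \<open>A point that first leaves the bad sets at index \<open>Suc k\<close> is charged
    to \<open>Bad k\<close>, hence the shift; index 0 is covered by the constant
    \<open>t powr \<delta>\<close>.\<close>
  define c where "c k = ennreal ((t * B ^ Suc k) powr \<delta>)" for k
  have "AE x in M. ?h x \<le> ennreal (t powr \<delta>) + (\<Sum>k. c k * indicator (Bad k) x)"
    using AEB'
  proof eventually_elim
    case (elim x)
    then obtain k0 where "x \<notin> Bad k0" by auto
    then obtain k where k: "x \<notin> Bad k" "\<And>j. j < k \<Longrightarrow> x \<in> Bad j"
      using exists_least_iff[of "\<lambda>k. x \<notin> Bad k"] by blast
    have xs: "x \<in> space M" using elim by blast
    show ?case
    proof (cases k)
      case 0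
      then have "?h x \<le> ennreal (t powr \<delta>)" using hb[OF xs k(1)] by simp
      also have "\<dots> \<le> ennreal (t powr \<delta>) + (\<Sum>k. c k * indicator (Bad k) x)" by (rule add_increasing2) auto
      finally show ?thesis .
    next
      case (Suc j)
      have "?h x \<le> c j" using hb[OF xs k(1)] unfolding Suc c_def .
      also have "\<dots> = c j * indicator (Bad j) x" using k(2)[of j] Suc by simp
      also have "\<dots> = sum (\<lambda>i. c i * indicator (Bad i) x) {j}" by (subst sum.insert) auto
      also have "\<dots> \<le> (\<Sum>k. c k * indicator (Bad k) x)" by (intro sum_le_suminf) auto
      also have "\<dots> \<le> ennreal (t powr \<delta>) + (\<Sum>k. c k * indicator (Bad k) x)" by (rule add_increasing) auto
      finally show ?thesis .
    qed
  qed
  then have "(\<integral>\<^sup>+x. ?h x \<partial>M) \<le> (\<integral>\<^sup>+x. ennreal (t powr \<delta>) + (\<Sum>k. c k * indicator (Bad k) x) \<partial>M)"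
    by (rule nn_integral_mono_AE)
  also have "\<dots> = (\<integral>\<^sup>+x. ennreal (t powr \<delta>) \<partial>M) + (\<integral>\<^sup>+x. (\<Sum>k. c k * indicator (Bad k) x) \<partial>M)"
    using Bad by (intro nn_integral_add borel_measurable_suminf borel_measurable_times_ennreal borel_measurable_indicator) auto
  also have "(\<integral>\<^sup>+x. (\<Sum>k. c k * indicator (Bad k) x) \<partial>M) = (\<Sum>k. \<integral>\<^sup>+x. c k * indicator (Bad k) x \<partial>M)"
    using Bad by (intro nn_integral_suminf borel_measurable_times_ennreal borel_measurable_indicator) auto
  also have "\<dots> = (\<Sum>k. c k * emeasure M (Bad k))"
    using Bad by (intro suminf_cong nn_integral_cmult_indicator) auto
  also have "(\<integral>\<^sup>+x. ennreal (t powr \<delta>) \<partial>M) = ennreal (t powr \<delta>) * emeasure M (space M)" by simp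
  also have "(\<Sum>k. c k * emeasure M (Bad k)) \<le> (\<Sum>k. ennreal ((t * B) powr \<delta> * D * (B powr \<delta> * \<mu>) ^ k))"
  proof (intro suminf_le)
    fix k
    have "c k * emeasure M (Bad k) \<le> c k * ennreal (D * \<mu> ^ k)" using Bad by (intro mult_left_mono) auto
    also have "\<dots> = ennreal ((t * B ^ Suc k) powr \<delta> * (D * \<mu> ^ k))"
      using D mu by (simp add: c_def ennreal_mult)
    also have "(t * B ^ Suc k) powr \<delta> = (t * B) powr \<delta> * (B powr \<delta>) ^ k"
    proof -
      have "(t * B ^ Suc k) powr \<delta> = ((t * B) * B ^ k) powr \<delta>" by (simp add: mult_ac)
      also have "\<dots> = (t * B) powr \<delta> * (B ^ k) powr \<delta>" by (rule powr_mult)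
      also have "(B ^ k) powr \<delta> = (B powr \<delta>) ^ k"
        using B by (simp add: powr_powr mult.commute flip: powr_realpow)
      finally show ?thesis .
    qed
    finally show "c k * emeasure M (Bad k) \<le> ennreal ((t * B) powr \<delta> * D * (B powr \<delta> * \<mu>) ^ k)"
      by (simp add: power_mult_distrib mult_ac)
  qed auto
  also have "\<dots> = ennreal (\<Sum>k. (t * B) powr \<delta> * D * (B powr \<delta> * \<mu>) ^ k)"
    using D mu \<delta> B by (intro suminf_ennreal2 summable_mult summable_geometric) (auto simp: abs_mult)
  also have "ennreal (t powr \<delta>) * emeasure M (space M) + ennreal (\<Sum>k. (t * B) powr \<delta> * D * (B powr \<delta> * \<mu>) ^ k) < \<infinity>"
    using fin by (simp add: ennreal_mult_less_top)
  finally show "(\<integral>\<^sup>+x. ?h x \<partial>M) < \<infinity>" by (simp add: add_left_mono)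
qed

theorem corollary1p1:
  fixes lam Lam \<gamma> \<alpha> :: real
  assumes "CARD('n::finite) \<ge> 2"
    and "0 < lam" and "lam \<le> Lam"
    and "\<gamma> \<ge> 0" and "\<alpha> = 1 / (1 + \<gamma>)"
  shows "\<exists>\<delta>>0. \<forall>(f :: real^'n \<Rightarrow> real) (u :: real^'n \<Rightarrow> real).
           continuous_on (ball 0 1) f \<longrightarrow>
           set_integrable lebesgue (ball 0 1) (\<lambda>x. \<bar>f x\<bar> ^ CARD('n)) \<longrightarrow>
           continuous_on (cball 0 1) u \<longrightarrow>
           visc_pucci_minus_le lam Lam \<gamma> u f \<longrightarrow>
           visc_pucci_plus_ge lam Lam \<gamma> u f \<longrightarrow>
             in_Lp \<delta> (ball 0 1) (C1_seminorm \<alpha> u) \<and>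
             (AE x in lebesgue_on (ball 0 1). C1_seminorm \<alpha> u x < \<infinity>)"
proof -
  define bet where "bet = Lam * (CARD('n) - 1)"
  have bet: "0 \<le> bet" using assms by (simp add: bet_def)
  have a: "0 < \<alpha>" using assms by simp
  obtain B \<mu> :: real where B: "2 \<le> B" and mu: "0 < \<mu>" "\<mu> < 1" and decay:
    "\<And>(u::real^'n \<Rightarrow> real) f.
      continuous_on (cball 0 1) u \<Longrightarrow>
      continuous_on (ball 0 1) f \<Longrightarrow> (\<And>x. x \<in> ball 0 1 \<Longrightarrow> 0 \<le> f x) \<Longrightarrow>
      (\<integral>\<^sup>+x\<in>ball 0 1. ennreal (f x ^ DIM(real^'n)) \<partial>lebesgue) < \<infinity> \<Longrightarrow>
      supersol lam bet \<gamma> (ball 0 1) u f \<Longrightarrow>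
      \<exists>T. \<forall>t\<ge>T. \<exists>D\<ge>0. \<forall>k. measure lebesgue (ball 0 1 - touch \<alpha> (t * B ^ k) u) \<le> D * \<mu> ^ k"
    by (rule touch_decay[OF assms(2) bet assms(4,5), where 'a="real^'n"]) blast
  \<comment> \<open>This gives \<open>B powr \<delta> = \<mu> powr (- 1/2)\<close>, so that the
    ratio \<open>B powr \<delta> * \<mu>\<close> is the square root of \<mu>. It is fixed before
    \<open>f\<close> and \<open>u\<close>, since \<open>B\<close> and \<mu> come from the structural
    constants alone.\<close>
  define \<delta> where "\<delta> = - ln \<mu> / (2 * ln B)"
  have d: "0 < \<delta>" unfolding \<delta>_def using mu B by (intro divide_pos_pos) auto
  have dB: "B powr \<delta> * \<mu> < 1"
  proof -
    have "\<delta> * ln B = - ln \<mu> / 2" using B by (simp add: \<delta>_def)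
    then have "B powr \<delta> * \<mu> = exp (- ln \<mu> / 2) * exp (ln \<mu>)" using B mu by (simp add: powr_def)
    also have "\<dots> = exp (ln \<mu> / 2)" by (simp flip: exp_add)
    also have "\<dots> < 1" using mu by simp
    finally show ?thesis .
  qed
  show ?thesis
  proof (rule exI[of _ \<delta>], intro conjI d allI impI)
    fix f u :: "real^'n \<Rightarrow> real"
    assume fc: "continuous_on (ball 0 1) f" and fi: "set_integrable lebesgue (ball 0 1) (\<lambda>x. \<bar>f x\<bar> ^ CARD('n))"
      and uc: "continuous_on (cball 0 1) u"
      and vm: "visc_pucci_minus_le lam Lam \<gamma> u f" and vp: "visc_pucci_plus_ge lam Lam \<gamma> u f"
    have uc': "continuous_on (ball 0 1) u" using uc by (rule continuous_on_subset) auto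
    have nuc: "continuous_on (cball 0 1) (\<lambda>z. - u z)" using uc by (intro continuous_intros)
    have afc: "continuous_on (ball 0 1) (\<lambda>x. \<bar>f x\<bar>)" using fc by (intro continuous_intros)
    have fin: "(\<integral>\<^sup>+x\<in>ball 0 1. ennreal (\<bar>f x\<bar> ^ DIM(real^'n)) \<partial>lebesgue) < \<infinity>"
    proof -
      have "(\<integral>\<^sup>+x. ennreal (norm (indicator (ball 0 1) x *\<^sub>R \<bar>f x\<bar> ^ CARD('n))) \<partial>lebesgue) < \<infinity>"
        using fi unfolding set_integrable_def integrable_iff_bounded by blast
      also have "(\<integral>\<^sup>+x. ennreal (norm (indicator (ball 0 1) x *\<^sub>R \<bar>f x\<bar> ^ CARD('n))) \<partial>lebesgue)
        = (\<integral>\<^sup>+x\<in>ball 0 1. ennreal (\<bar>f x\<bar> ^ DIM(real^'n)) \<partial>lebesgue)"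
        by (intro nn_integral_cong) (auto simp: indicator_def)
      finally show ?thesis .
    qed
    have "\<exists>T. \<forall>t\<ge>T. \<exists>D\<ge>0. \<forall>k. measure lebesgue (ball 0 1 - touch \<alpha> (t * B ^ k) u) \<le> D * \<mu> ^ k"
      using visc_pucci_minus_imp_supersol[OF vm] unfolding bet_def[symmetric]
      by (intro decay[OF uc afc _ fin]) auto
    moreover have "\<exists>T. \<forall>t\<ge>T. \<exists>D\<ge>0. \<forall>k. measure lebesgue (ball 0 1 - touch \<alpha> (t * B ^ k) (\<lambda>z. - u z)) \<le> D * \<mu> ^ k"
      using visc_pucci_plus_imp_supersol[OF vp] unfolding bet_def[symmetric]
      by (intro decay[OF nuc afc _ fin]) auto
    ultimately obtain T1 T2 where
      T1: "\<And>t. T1 \<le> t \<Longrightarrow> \<exists>D\<ge>0. \<forall>k. measure lebesgue (ball 0 1 - touch \<alpha> (t * B ^ k) u) \<le> D * \<mu> ^ k" and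
      T2: "\<And>t. T2 \<le> t \<Longrightarrow> \<exists>D\<ge>0. \<forall>k. measure lebesgue (ball 0 1 - touch \<alpha> (t * B ^ k) (\<lambda>z. - u z)) \<le> D * \<mu> ^ k"
      by blast
    define t where "t = max 1 (max T1 T2)"
    have t: "0 < t" "T1 \<le> t" "T2 \<le> t" by (auto simp: t_def)
    obtain D1 where D1: "0 \<le> D1" "\<And>k. measure lebesgue (ball 0 1 - touch \<alpha> (t * B ^ k) u) \<le> D1 * \<mu> ^ k"
      using T1[OF t(2)] by blast
    obtain D2 where D2: "0 \<le> D2" "\<And>k. measure lebesgue (ball 0 1 - touch \<alpha> (t * B ^ k) (\<lambda>z. - u z)) \<le> D2 * \<mu> ^ k"
      using T2[OF t(3)] by blast
    have "bounded (u ` cball 0 1)" using uc by (intro compact_imp_bounded compact_continuous_image) auto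
    then obtain M where M: "\<And>x. x \<in> cball 0 1 \<Longrightarrow> \<bar>u x\<bar> \<le> M"
      unfolding bounded_iff real_norm_def by blast
    have o1: "open (ball 0 1 - touch \<alpha> s u)" for s
      using M by (intro open_ball_diff_touch[OF a uc', where M=M]) simp
    have o2: "open (ball 0 1 - touch \<alpha> s (\<lambda>z. - u z))" for s
      using M by (intro open_ball_diff_touch[OF a continuous_on_minus[OF uc'], where M=M]) simp
    define Bad where "Bad k = (ball 0 1 - touch \<alpha> (t * B ^ k) u) \<union> (ball 0 1 - touch \<alpha> (t * B ^ k) (\<lambda>z. - u z))" for k
    let ?M = "lebesgue_on (ball (0::real^'n) 1)"
    have Bo: "open (Bad k)" "Bad k \<subseteq> ball 0 1" for k unfolding Bad_def using o1 o2 by auto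
    have Bs: "Bad k \<in> sets ?M" for k
      using Bo by (subst sets_restrict_space_iff) (auto simp: borel_open)
    have Bm: "emeasure ?M (Bad k) \<le> ennreal ((D1 + D2) * \<mu> ^ k)" for k
    proof -
      have lm: "X \<in> lmeasurable" if "open X" "X \<subseteq> ball 0 1" for X :: "(real^'n) set"
        by (rule fmeasurableI2[OF lmeasurable_ball that(2)]) (simp add: borel_open that(1))
      have "emeasure ?M (Bad k) = emeasure lebesgue (Bad k)"
        using Bo by (intro emeasure_restrict_space) auto
      also have "\<dots> = ennreal (measure lebesgue (Bad k))"
        using lm[OF Bo] by (simp add: emeasure_eq_measure2)
      also have "measure lebesgue (Bad k) \<le> D1 * \<mu> ^ k + D2 * \<mu> ^ k"
      proof -
        have "measure lebesgue (Bad k) \<le> measure lebesgue (ball 0 1 - touch \<alpha> (t * B ^ k) u)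
            + measure lebesgue (ball 0 1 - touch \<alpha> (t * B ^ k) (\<lambda>z. - u z))"
          unfolding Bad_def using o1 o2 by (intro measure_Un_le) (simp_all add: borel_open)
        then show ?thesis using D1(2)[of k] D2(2)[of k] by linarith
      qed
      finally show ?thesis by (simp add: distrib_right ennreal_leI)
    qed
    have Sb: "C1_seminorm \<alpha> u x \<le> ennreal (t * B ^ k)" if "x \<in> space ?M" "x \<notin> Bad k" for x k
    proof (rule C1_seminorm_le[OF uc' a])
      show "0 \<le> t * B ^ k" using t B by simp
      show "x \<in> touch \<alpha> (t * B ^ k) u" "x \<in> touch \<alpha> (t * B ^ k) (\<lambda>z. - u z)"
        using that by (simp_all add: Bad_def space_restrict_space)
    qed
    have fs: "emeasure ?M (space ?M) < \<infinity>"
      using fmeasurableD2[OF lmeasurable_ball[of "0::real^'n" 1]]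
      by (subst emeasure_restrict_space) (auto simp: space_restrict_space less_top)
    have Sm: "C1_seminorm \<alpha> u \<in> borel_measurable ?M" by (rule C1_seminorm_measurable[OF uc' a])
    have D: "0 \<le> D1 + D2" and B1: "1 < B" using D1 D2 B by auto
    note res = geometric_bad_sets_integrable[OF Sm fs Bs Bm Sb D mu t(1) B1 d dB]
    show "in_Lp \<delta> (ball 0 1) (C1_seminorm \<alpha> u)" unfolding in_Lp_def using Sm res(1) by blast
    show "AE x in ?M. C1_seminorm \<alpha> u x < \<infinity>" by (rule res(2))
  qed
qed

end
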